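(* For every $g \in \overline{B}_{\mathcal{H}^\infty(B_{c_0},\ell_\infty)}$ there is a map $$\Psi_g: (\beta(\mathbb{N})\setminus \mathbb{N}) \times B_{\mathcal{H}^\infty(B_{c_0}, \ell_\infty)} \to \mathscr{F}(g)\subset\mathcal{M}_\infty(B_{c_0},B_{c_0})$$ satisfying: (1) For all $\eta \in \beta(\mathbb{N}) \setminus \mathbb{N}$, the mapping $\Psi_g^\eta: B_{\mathcal{H}^\infty(B_{c_0}, \ell_\infty)} \to \mathscr{F}(g)$ given by $\Psi_g^\eta(h) = \Psi_g(\eta,h)$ is an analytic Gleason isometry. (2) If $\eta_1 \neq \eta_2$ are in $\beta(\mathbb{N}) \setminus \mathbb{N}$, then the images $\Psi_g^{\eta_1}(B_{\mathcal{H}^\infty(B_{c_0}, \ell_\infty)})$ and $\Psi_g^{\eta_2}(B_{\mathcal{H}^\infty(B_{c_0}, \ell_\infty)})$ lie in different Gleason parts (of $\mathcal{M}_\infty(B_{c_0},B_{c_0})$).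
   Context: All Banach spaces are complex. $B_X$ and $\overline{B}_X$ denote the open and closed unit balls of a Banach space $X$. $\mathcal{H}^\infty(B_{c_0})$ is the Banach algebra of bounded holomorphic functions $B_{c_0}\to\mathbb{C}$ with the sup norm; $\mathcal{H}^\infty(B_{c_0},\ell_\infty)$ is the Banach space of bounded holomorphic maps $B_{c_0}\to\ell_\infty$ with norm $\|g\|=\sup_{x\in B_{c_0}}\|g(x)\|_\infty$. $\mathcal{M}_\infty(B_{c_0},B_{c_0})$ is the set of nonzero algebra homomorphisms $\Phi:\mathcal{H}^\infty(B_{c_0})\to\mathcal{H}^\infty(B_{c_0})$. There is a projection $\xi:\mathcal{M}_\infty(B_{c_0},B_{c_0})\to\overline{B}_{\mathcal{H}^\infty(B_{c_0},\ell_\infty)}$ given by $\xi(\Phi)(x)(x^* )=\Phi(x^* )(x)$ for $x\in B_{c_0}$, $x^*\in\ell_1=c_0^*\subset\mathcal{H}^\infty(B_{c_0})$ (with $\ell_\infty=\ell_1^*$). The fiber over $g\in\overline{B}_{\mathcal{H}^\infty(B_{c_0},\ell_\infty)}$ is $\mathscr{F}(g)=\{\Phi\in\mathcal{M}_\infty(B_{c_0},B_{c_0}):\xi(\Phi)=g\}$. The canonical (Aron–Berner/Davie–Gamelin) extension $f\mapsto\widetilde f$ is an isometric algebra homomorphism from $\mathcal{H}^\infty(B_{c_0})$ to $\mathcal{H}^\infty(B_{\ell_\infty})$ (concretely, $\widetilde f(w)=\lim_n f(w_1,\dots,w_n,0,0,\dots)$). If $h\in\mathcal{H}^\infty(B_{c_0},\ell_\infty)$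 satisfies $h(B_{c_0})\subset B_{\ell_\infty}$ (in particular if $\|h\|<1$), the composition homomorphism $C_h\in\mathcal{M}_\infty(B_{c_0},B_{c_0})$ is $C_h(f)=\widetilde f\circ h$. The Gleason metric on $\mathcal{M}_\infty(B_{c_0},B_{c_0})$ is the operator-norm distance $\|\Phi-\Psi\|$. The Gleason part of $\Phi$ is $\{\Psi\in\mathcal{M}_\infty(B_{c_0},B_{c_0}):\|\Phi-\Psi\|<2\}$; Gleason parts form a partition. A map $F:B_{\mathcal{H}^\infty(B_{c_0},\ell_\infty)}\to\mathcal{M}_\infty(B_{c_0},B_{c_0})$ is a Gleason isometry if $\|F(h)-F(h')\|=\|C_h-C_{h'}\|$ for all $h,h'$ in its domain, and it is analytic if for every $f\in\mathcal{H}^\infty(B_{c_0})$ and $x\in B_{c_0}$ the function $h\mapsto F(h)(f)(x)$ is holomorphic on $B_{\mathcal{H}^\infty(B_{c_0},\ell_\infty)}$. The image of such a Gleason isometry is contained in a single Gleason part; two such images lie in different Gleason parts when no element of one is in the Gleason part of an element of the other. $\beta(\mathbb{N})$ is the Stone–Čech compactification of $\mathbb{N}$. *)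

theory Defs
  imports "HOL-Analysis.Analysis"
begin

section \<open>Complex normed spaces\<close>

class complex_normed_vector = real_normed_vector +
  fixes scaleC :: "complex \<Rightarrow> 'a \<Rightarrow> 'a" (infixr \<open>*\<^sub>C\<close> 75)
  assumes scaleC_add_right: "c *\<^sub>C (x + y) = c *\<^sub>C x + c *\<^sub>C y"
    and scaleC_add_left: "(c + d) *\<^sub>C x = c *\<^sub>C x + d *\<^sub>C x"
    and scaleC_scaleC: "c *\<^sub>C d *\<^sub>C x = (c * d) *\<^sub>C x"
    and scaleC_of_real: "complex_of_real r *\<^sub>C x = r *\<^sub>R x"
    and norm_scaleC: "norm (c *\<^sub>C x) = cmod c * norm x"

lemma scaleC_zero_right [simp]: "c *\<^sub>C 0 = (0 :: 'a::complex_normed_vector)"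
  using norm_scaleC[of c "0 :: 'a"] by simp

lemma bounded_linear_scaleC_right:
  "bounded_linear (\<lambda>x :: 'a::complex_normed_vector. c *\<^sub>C x)"
proof
  show "c *\<^sub>C (x + y) = c *\<^sub>C x + c *\<^sub>C y" for x y :: 'a
    by (rule scaleC_add_right)
  show "c *\<^sub>C (r *\<^sub>R x) = r *\<^sub>R (c *\<^sub>C x)" for r and x :: 'a
    by (metis scaleC_of_real scaleC_scaleC mult.commute)
  show "\<exists>K. \<forall>x :: 'a. norm (c *\<^sub>C x) \<le> norm x * K"
    by (metis norm_scaleC mult.commute order_refl)
qed

class complex_normed_algebra = complex_normed_vector + real_normed_algebra +
  assumes mult_scaleC_left: "(c *\<^sub>C x) * y = c *\<^sub>C (x * y)"
    and mult_scaleC_right: "x * (c *\<^sub>C y) = c *\<^sub>C (x * y)"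

instantiation complex :: complex_normed_algebra
begin

definition scaleC_complex :: "complex \<Rightarrow> complex \<Rightarrow> complex"
  where "scaleC_complex c x = c * x"

instance
  by standard (auto simp: scaleC_complex_def algebra_simps norm_mult scaleR_conv_of_real)

end

definition clinear :: "('a::complex_normed_vector \<Rightarrow> 'b::complex_normed_vector) \<Rightarrow> bool"
  where "clinear D \<longleftrightarrow> (\<forall>x y. D (x + y) = D x + D y) \<and> (\<forall>c x. D (c *\<^sub>C x) = c *\<^sub>C D x)"

text \<open>Complex Frechet differentiability at every point; used for open \<open>S\<close> only.\<close>

definition cholomorphic_on ::
  "('a::complex_normed_vector \<Rightarrow> 'b::complex_normed_vector) \<Rightarrow> 'a set \<Rightarrow> bool" (infix \<open>cholomorphic'_on\<close> 50)
  where "f cholomorphic_on S \<longleftrightarrow> (\<forall>x\<in>S. \<exists>D. clinear D \<and> (f has_derivative D) (at x))"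

section \<open>The spaces \<open>\<ell>\<^sub>\<infinity>\<close>, \<open>c\<^sub>0\<close> and \<open>\<ell>\<^sub>1\<close>\<close>

instantiation bcontfun :: (topological_space, complex_normed_vector) complex_normed_vector
begin

definition scaleC_bcontfun :: "complex \<Rightarrow> ('a \<Rightarrow>\<^sub>C 'b) \<Rightarrow> 'a \<Rightarrow>\<^sub>C 'b"
  where "scaleC_bcontfun c f = Bcontfun (\<lambda>x. c *\<^sub>C f x)"

lemma scaleC_bcontfun_apply [simp]:
  "apply_bcontfun (c *\<^sub>C f) x = c *\<^sub>C apply_bcontfun f x" for f :: "'a \<Rightarrow>\<^sub>C 'b"
proof -
  have "continuous_on UNIV (\<lambda>x. c *\<^sub>C apply_bcontfun f x)"
    by (intro bounded_linear.continuous_on[OF bounded_linear_scaleC_right]) auto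
  moreover have "bounded (range (\<lambda>x. c *\<^sub>C apply_bcontfun f x))"
    using bounded_linear_image[OF bounded_apply_bcontfun bounded_linear_scaleC_right]
    by (simp add: image_image)
  ultimately have "(\<lambda>x. c *\<^sub>C apply_bcontfun f x) \<in> bcontfun"
    by (simp add: bcontfun_def)
  then show ?thesis
    by (simp add: scaleC_bcontfun_def Bcontfun_inverse)
qed

instance
proof
  fix c d :: complex and r :: real and f g :: "'a \<Rightarrow>\<^sub>C 'b"
  have le: "norm (c *\<^sub>C f) \<le> cmod c * norm f" for c and f :: "'a \<Rightarrow>\<^sub>C 'b"
    by (rule norm_bound) (simp add: norm_scaleC norm_bounded mult_left_mono)
  show cc: "c *\<^sub>C d *\<^sub>C f = (c * d) *\<^sub>C f" for c d
    by (rule bcontfun_eqI) (simp add: scaleC_scaleC)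
  show one: "complex_of_real r *\<^sub>C f = r *\<^sub>R f" for r
    by (rule bcontfun_eqI) (simp add: scaleC_of_real)
  show "norm (c *\<^sub>C f) = cmod c * norm f"
  proof (cases "c = 0")
    case True
    then show ?thesis using one[of 0] by simp
  next
    case False
    have "f = inverse c *\<^sub>C c *\<^sub>C f"
      using False cc one[of 1] by simp
    then have "norm f \<le> inverse (cmod c) * norm (c *\<^sub>C f)"
      using le[of "inverse c" "c *\<^sub>C f"] by (simp add: norm_inverse)
    then have "cmod c * norm f \<le> norm (c *\<^sub>C f)"
      using False by (simp add: field_simps)
    with le[of c f] show ?thesis by simp
  qed
  show "c *\<^sub>C (f + g) = c *\<^sub>C f + c *\<^sub>C g"
    by (rule bcontfun_eqI) (simp add: scaleC_add_right)
  show "(c + d) *\<^sub>C f = c *\<^sub>C f + d *\<^sub>C f"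
    by (rule bcontfun_eqI) (simp add: scaleC_add_left)
qed

end

text \<open>Bounded continuous functions on the discrete space of natural numbers, with the supremum
  norm: this is \<open>\<ell>\<^sub>\<infinity>\<close>.  Sequences are indexed from 0.\<close>

type_synonym linf = "nat \<Rightarrow>\<^sub>C complex"

typedef c0 = "{x :: linf. apply_bcontfun x \<longlonglongrightarrow> 0}" morphisms linf_of_c0 Abs_c0
  by (rule exI[of _ 0]) simp

setup_lifting type_definition_c0

instantiation c0 :: complex_normed_vector
begin

lift_definition zero_c0 :: c0 is 0 by simp

lift_definition plus_c0 :: "c0 \<Rightarrow> c0 \<Rightarrow> c0" is "\<lambda>x y. x + y"
  using tendsto_add by fastforce

lift_definition minus_c0 :: "c0 \<Rightarrow> c0 \<Rightarrow> c0" is "\<lambda>x y. x - y"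
  using tendsto_diff by fastforce

lift_definition uminus_c0 :: "c0 \<Rightarrow> c0" is "\<lambda>x. - x"
  using tendsto_minus by fastforce

lift_definition scaleR_c0 :: "real \<Rightarrow> c0 \<Rightarrow> c0" is "\<lambda>r x. r *\<^sub>R x"
  by (auto intro: tendsto_eq_intros)

lift_definition scaleC_c0 :: "complex \<Rightarrow> c0 \<Rightarrow> c0" is "\<lambda>c x. c *\<^sub>C x"
proof -
  fix c and x :: linf
  assume "apply_bcontfun x \<longlonglongrightarrow> 0"
  then have "(\<lambda>n. c * apply_bcontfun x n) \<longlonglongrightarrow> 0"
    by (auto intro: tendsto_mult_right_zero)
  also have "(\<lambda>n. c * apply_bcontfun x n) = apply_bcontfun (c *\<^sub>C x)"
    by (rule ext) (simp only: scaleC_bcontfun_apply scaleC_complex_def)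
  finally show "apply_bcontfun (c *\<^sub>C x) \<longlonglongrightarrow> 0" .
qed

lift_definition norm_c0 :: "c0 \<Rightarrow> real" is norm .

definition dist_c0 :: "c0 \<Rightarrow> c0 \<Rightarrow> real" where "dist_c0 x y = norm (x - y)"

definition sgn_c0 :: "c0 \<Rightarrow> c0" where "sgn_c0 x = scaleR (inverse (norm x)) x"

definition
  "(uniformity :: (c0 \<times> c0) filter) = (INF e\<in>{0 <..}. principal {(x, y). dist x y < e})"

definition open_c0 :: "c0 set \<Rightarrow> bool"
  where "open_c0 S = (\<forall>x\<in>S. \<forall>\<^sub>F (x', y) in uniformity. x' = x \<longrightarrow> y \<in> S)"

instance
  apply standard
  unfolding dist_c0_def open_c0_def sgn_c0_def uniformity_c0_def
  apply (rule refl | (transfer, force simp: algebra_simps norm_triangle_ineq scaleC_add_right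
        scaleC_add_left scaleC_scaleC scaleC_of_real norm_scaleC))+
  done

end

definition c0_nth :: "c0 \<Rightarrow> nat \<Rightarrow> complex"
  where "c0_nth x = apply_bcontfun (linf_of_c0 x)"

typedef l1 = "{a :: nat \<Rightarrow> complex. summable (\<lambda>n. cmod (a n))}" morphisms l1_nth Abs_l1
  by (rule exI[of _ "\<lambda>_. 0"]) simp

text \<open>The duality between \<open>\<ell>\<^sub>1\<close> and bounded sequences; it gives both \<open>c\<^sub>0\<^sup>* = \<ell>\<^sub>1\<close> and
  \<open>\<ell>\<^sub>1\<^sup>* = \<ell>\<^sub>\<infinity>\<close>.\<close>

definition l1_pairing :: "l1 \<Rightarrow> linf \<Rightarrow> complex"
  where "l1_pairing a w = (\<Sum>n. l1_nth a n * apply_bcontfun w n)"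

lemma summable_l1_pairing: "summable (\<lambda>n. cmod (l1_nth a n * apply_bcontfun w n))"
proof (rule summable_comparison_test')
  show "summable (\<lambda>n. cmod (l1_nth a n) * norm w)"
    using l1_nth[of a] by (auto intro: summable_mult2)
  show "norm (cmod (l1_nth a n * apply_bcontfun w n)) \<le> cmod (l1_nth a n) * norm w" for n
    by (simp add: norm_mult mult_left_mono norm_bounded)
qed

lemma clinear_l1_pairing: "clinear (l1_pairing a)"
proof -
  have "l1_pairing a (x + y) = l1_pairing a x + l1_pairing a y" for x y
    unfolding l1_pairing_def
    by (subst suminf_add)
      (auto simp: distrib_left intro: summable_norm_cancel[OF summable_l1_pairing])
  moreover have "l1_pairing a (c *\<^sub>C x) = c *\<^sub>C l1_pairing a x" for c x
    unfolding l1_pairing_def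
    by (simp add: scaleC_complex_def mult.left_commute[of _ c] suminf_mult
        summable_norm_cancel[OF summable_l1_pairing])
  ultimately show ?thesis
    by (simp add: clinear_def)
qed

lemma norm_l1_pairing_le: "cmod (l1_pairing a w) \<le> norm w * (\<Sum>n. cmod (l1_nth a n))"
proof -
  have sa: "summable (\<lambda>n. cmod (l1_nth a n))"
    using l1_nth[of a] by auto
  have "cmod (l1_pairing a w) \<le> (\<Sum>n. cmod (l1_nth a n * apply_bcontfun w n))"
    unfolding l1_pairing_def by (rule summable_norm[OF summable_l1_pairing])
  also have "\<dots> \<le> (\<Sum>n. norm w * cmod (l1_nth a n))"
    by (intro suminf_le summable_l1_pairing summable_mult sa)
      (simp add: norm_mult mult.commute[of "norm w"] mult_left_mono norm_bounded)
  also have "\<dots> = norm w * (\<Sum>n. cmod (l1_nth a n))"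
    by (rule suminf_mult[OF sa])
  finally show ?thesis .
qed

lemma clinear_l1_pairing_c0: "clinear (\<lambda>x. l1_pairing a (linf_of_c0 x))"
  using clinear_l1_pairing[of a] by (simp add: clinear_def plus_c0.rep_eq scaleC_c0.rep_eq)

lemma bounded_linear_l1_pairing_c0: "bounded_linear (\<lambda>x. l1_pairing a (linf_of_c0 x))"
proof
  show "l1_pairing a (linf_of_c0 (x + y)) = l1_pairing a (linf_of_c0 x) + l1_pairing a (linf_of_c0 y)"
    for x y
    using clinear_l1_pairing_c0[of a] by (simp add: clinear_def)
  show "l1_pairing a (linf_of_c0 (r *\<^sub>R x)) = r *\<^sub>R l1_pairing a (linf_of_c0 x)" for r x
    using clinear_l1_pairing_c0[of a] by (metis clinear_def scaleC_of_real)
  show "\<exists>K. \<forall>x. norm (l1_pairing a (linf_of_c0 x)) \<le> norm x * K"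
    using norm_l1_pairing_le[of a] by (auto simp: norm_c0.rep_eq)
qed

section \<open>Bounded holomorphic maps on the open unit ball\<close>

text \<open>\<open>('a, 'b) hinf\<close> is the space of bounded holomorphic maps from the open unit ball of \<open>'a\<close>
  to \<open>'b\<close>.  Functions in HOL being total, such a map is represented by its extension by 0.\<close>

definition hinf_funs :: "('a::complex_normed_vector \<Rightarrow> 'b::complex_normed_vector) set"
  where "hinf_funs = {f. f cholomorphic_on ball 0 1 \<and> bounded (f ` ball 0 1) \<and>
    (\<forall>x. x \<notin> ball 0 1 \<longrightarrow> f x = 0)}"

lemma zero_hinf_funs:
  "(\<lambda>_ :: 'a::complex_normed_vector. 0 :: 'b::complex_normed_vector) \<in> hinf_funs"
proof -
  have "(\<lambda>_ :: 'a. 0 :: 'b) cholomorphic_on ball 0 1"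
    unfolding cholomorphic_on_def
    by (intro ballI exI[of _ "\<lambda>_. 0"] conjI has_derivative_const) (simp add: clinear_def)
  moreover have "bounded ((\<lambda>_ :: 'a. 0 :: 'b) ` ball 0 1)"
    by (simp add: image_constant_conv)
  ultimately show ?thesis
    by (simp add: hinf_funs_def)
qed

typedef (overloaded) ('a, 'b) hinf =
  "hinf_funs :: ('a::complex_normed_vector \<Rightarrow> 'b::complex_normed_vector) set"
  morphisms hinf_apply Abs_hinf
  using zero_hinf_funs by blast

setup_lifting type_definition_hinf

lemma hinf_eqI:
  fixes f g :: "('a::complex_normed_vector, 'b::complex_normed_vector) hinf"
  assumes "\<And>x. x \<in> ball 0 1 \<Longrightarrow> hinf_apply f x = hinf_apply g x"
  shows "f = g"
proof -
  have out: "hinf_apply h x = 0" if "x \<notin> ball 0 1" for h :: "('a, 'b) hinf" and x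
    using hinf_apply[of h] that by (simp add: hinf_funs_def)
  have "hinf_apply f x = hinf_apply g x" for x
    using assms[of x] out[of x f] out[of x g] by (cases "x \<in> ball 0 1") simp_all
  then have "hinf_apply f = hinf_apply g"
    by (rule ext)
  then show ?thesis
    by (simp only: hinf_apply_inject)
qed

lemma bounded_hinf_apply: "bounded (hinf_apply f ` ball 0 1)"
  using hinf_apply[of f] by (simp add: hinf_funs_def)

instantiation hinf :: (complex_normed_vector, complex_normed_vector) complex_normed_vector
begin

lift_definition zero_hinf :: "('a, 'b) hinf" is "\<lambda>_. 0"
  by (rule zero_hinf_funs)

lift_definition plus_hinf :: "('a, 'b) hinf \<Rightarrow> ('a, 'b) hinf \<Rightarrow> ('a, 'b) hinf"
  is "\<lambda>f g x. f x + g x"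
proof -
  fix f g :: "'a \<Rightarrow> 'b"
  assume f: "f \<in> hinf_funs"
    and g: "g \<in> hinf_funs"
  have "(\<lambda>x. f x + g x) cholomorphic_on ball 0 1"
    unfolding cholomorphic_on_def
  proof
    fix x :: 'a assume x: "x \<in> ball 0 1"
    obtain D E where "clinear D" "(f has_derivative D) (at x)" "clinear E" "(g has_derivative E) (at x)"
      using f g x unfolding hinf_funs_def cholomorphic_on_def by blast
    then show "\<exists>D. clinear D \<and> ((\<lambda>x. f x + g x) has_derivative D) (at x)"
      by (intro exI[of _ "\<lambda>v. D v + E v"])
        (auto simp: clinear_def scaleC_add_right intro!: has_derivative_add)
  qed
  with f g show "(\<lambda>x. f x + g x) \<in> hinf_funs"
    by (auto simp: hinf_funs_def intro: bounded_plus_comp)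
qed

lift_definition scaleC_hinf :: "complex \<Rightarrow> ('a, 'b) hinf \<Rightarrow> ('a, 'b) hinf"
  is "\<lambda>c f x. c *\<^sub>C f x"
proof -
  fix c and f :: "'a \<Rightarrow> 'b"
  assume f: "f \<in> hinf_funs"
  have "(\<lambda>x. c *\<^sub>C f x) cholomorphic_on ball 0 1"
    unfolding cholomorphic_on_def
  proof
    fix x :: 'a assume x: "x \<in> ball 0 1"
    obtain D where "clinear D" "(f has_derivative D) (at x)"
      using f x unfolding hinf_funs_def cholomorphic_on_def by blast
    then show "\<exists>D. clinear D \<and> ((\<lambda>x. c *\<^sub>C f x) has_derivative D) (at x)"
      by (intro exI[of _ "\<lambda>v. c *\<^sub>C D v"])
        (auto simp: clinear_def scaleC_add_right scaleC_scaleC mult.commute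
          intro!: bounded_linear.has_derivative[OF bounded_linear_scaleC_right])
  qed
  moreover have "bounded ((\<lambda>x. c *\<^sub>C f x) ` ball 0 1)"
    using bounded_linear_image[OF _ bounded_linear_scaleC_right, of "f ` ball 0 1" c] f
    by (simp add: hinf_funs_def image_image)
  ultimately show "(\<lambda>x. c *\<^sub>C f x) \<in> hinf_funs"
    using f by (auto simp: hinf_funs_def)
qed

definition scaleR_hinf :: "real \<Rightarrow> ('a, 'b) hinf \<Rightarrow> ('a, 'b) hinf"
  where "scaleR_hinf r f = complex_of_real r *\<^sub>C f"

definition uminus_hinf :: "('a, 'b) hinf \<Rightarrow> ('a, 'b) hinf"
  where "uminus_hinf f = (-1) *\<^sub>C f"

definition minus_hinf :: "('a, 'b) hinf \<Rightarrow> ('a, 'b) hinf \<Rightarrow> ('a, 'b) hinf"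
  where "minus_hinf f g = f + - g"

definition norm_hinf :: "('a, 'b) hinf \<Rightarrow> real"
  where "norm_hinf f = (SUP x\<in>ball 0 1. norm (hinf_apply f x))"

definition dist_hinf :: "('a, 'b) hinf \<Rightarrow> ('a, 'b) hinf \<Rightarrow> real"
  where "dist_hinf f g = norm (f - g)"

definition sgn_hinf :: "('a, 'b) hinf \<Rightarrow> ('a, 'b) hinf"
  where "sgn_hinf f = scaleR (inverse (norm f)) f"

definition
  "(uniformity :: (('a, 'b) hinf \<times> ('a, 'b) hinf) filter)
    = (INF e\<in>{0 <..}. principal {(x, y). dist x y < e})"

definition open_hinf :: "('a, 'b) hinf set \<Rightarrow> bool"
  where "open_hinf S = (\<forall>x\<in>S. \<forall>\<^sub>F (x', y) in uniformity. x' = x \<longrightarrow> y \<in> S)"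

lemma scaleR_hinf_apply: "hinf_apply (r *\<^sub>R f) x = r *\<^sub>R hinf_apply f x" for f :: "('a, 'b) hinf"
  by (simp add: scaleR_hinf_def scaleC_hinf.rep_eq scaleC_of_real)

lemma uminus_hinf_apply: "hinf_apply (- f) x = - hinf_apply f x" for f :: "('a, 'b) hinf"
  using scaleC_of_real[of "-1" "hinf_apply f x"]
  by (simp add: uminus_hinf_def scaleC_hinf.rep_eq)

lemma minus_hinf_apply: "hinf_apply (f - g) x = hinf_apply f x - hinf_apply g x"
  for f g :: "('a, 'b) hinf"
  by (simp add: minus_hinf_def plus_hinf.rep_eq uminus_hinf_apply)

lemma norm_hinf_apply_le: "norm (hinf_apply f x) \<le> norm f" if "x \<in> ball 0 1" for f :: "('a, 'b) hinf"
  unfolding norm_hinf_def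
proof (rule cSUP_upper[OF that])
  show "bdd_above ((\<lambda>x. norm (hinf_apply f x)) ` ball 0 1)"
    using bounded_hinf_apply[of f] by (auto simp: bounded_iff bdd_above_def)
qed

lemma norm_hinf_le: "norm f \<le> b" if "\<And>x. x \<in> ball 0 1 \<Longrightarrow> norm (hinf_apply f x) \<le> b"
  for f :: "('a, 'b) hinf"
  unfolding norm_hinf_def using that by (intro cSUP_least) auto

instance
proof
  fix c d :: complex and r s :: real and f g h :: "('a, 'b) hinf"
  note ap = plus_hinf.rep_eq scaleC_hinf.rep_eq scaleR_hinf_apply uminus_hinf_apply
    minus_hinf_apply zero_hinf.rep_eq
  have le: "norm (c *\<^sub>C f) \<le> cmod c * norm f" for c and f :: "('a, 'b) hinf"
    by (rule norm_hinf_le) (simp add: ap norm_scaleC norm_hinf_apply_le mult_left_mono)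
  show "f + g + h = f + (g + h)" "f + g = g + f" "0 + f = f" "- f + f = 0" "f - g = f + - g"
    by (auto intro!: hinf_eqI simp: ap)
  show "r *\<^sub>R (f + g) = r *\<^sub>R f + r *\<^sub>R g" "(r + s) *\<^sub>R f = r *\<^sub>R f + s *\<^sub>R f"
    "r *\<^sub>R s *\<^sub>R f = (r * s) *\<^sub>R f" "1 *\<^sub>R f = f"
    by (auto intro!: hinf_eqI simp: ap algebra_simps)
  have one: "1 *\<^sub>R f = f"
    by (rule hinf_eqI) (simp add: ap)
  show "dist f g = norm (f - g)" "sgn f = scaleR (inverse (norm f)) f"
    by (simp_all add: dist_hinf_def sgn_hinf_def)
  show "(uniformity :: (('a, 'b) hinf \<times> ('a, 'b) hinf) filter)
      = (INF e\<in>{0 <..}. principal {(x, y). dist x y < e})"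
    by (simp add: uniformity_hinf_def)
  show "open S \<longleftrightarrow> (\<forall>x\<in>S. \<forall>\<^sub>F (x', y) in uniformity. x' = x \<longrightarrow> y \<in> S)"
    for S :: "('a, 'b) hinf set"
    by (simp add: open_hinf_def)
  show "norm f = 0 \<longleftrightarrow> f = 0"
  proof
    assume "norm f = 0"
    then have "hinf_apply f x = 0" if "x \<in> ball 0 1" for x
      using norm_hinf_apply_le[OF that, of f] by simp
    then show "f = 0"
      by (intro hinf_eqI) (simp add: ap)
  qed (simp add: norm_hinf_def ap)
  show "norm (f + g) \<le> norm f + norm g"
    by (rule norm_hinf_le) (simp only: ap, intro norm_triangle_mono norm_hinf_apply_le)
  show cc: "c *\<^sub>C d *\<^sub>C f = (c * d) *\<^sub>C f" for c d
    by (rule hinf_eqI) (simp add: ap scaleC_scaleC)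
  show cr: "complex_of_real r *\<^sub>C f = r *\<^sub>R f" for r
    by (simp add: scaleR_hinf_def)
  show nc: "norm (c *\<^sub>C f) = cmod c * norm f" for c
  proof (cases "c = 0")
    case True
    have "hinf_apply (0 *\<^sub>C f) x = 0" for x
      using scaleC_of_real[of 0 "hinf_apply f x"] by (simp add: ap)
    with True show ?thesis
      by (simp add: norm_hinf_def)
  next
    case False
    have "f = inverse c *\<^sub>C c *\<^sub>C f"
      using False cc[of "inverse c" c] cr[of 1] one by simp
    then have "norm f \<le> inverse (cmod c) * norm (c *\<^sub>C f)"
      using le[of "inverse c" "c *\<^sub>C f"] by (simp add: norm_inverse)
    then have "cmod c * norm f \<le> norm (c *\<^sub>C f)"
      using False by (simp add: field_simps)
    with le[of c f] show ?thesis by simp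
  qed
  show "norm (r *\<^sub>R f) = \<bar>r\<bar> * norm f"
    using nc[of "complex_of_real r"] by (simp add: cr)
  show "c *\<^sub>C (f + g) = c *\<^sub>C f + c *\<^sub>C g"
    by (rule hinf_eqI) (simp add: ap scaleC_add_right)
  show "(c + d) *\<^sub>C f = c *\<^sub>C f + d *\<^sub>C f"
    by (rule hinf_eqI) (simp add: ap scaleC_add_left)
qed

end

instantiation hinf :: (complex_normed_vector, complex_normed_algebra) complex_normed_algebra
begin

lift_definition times_hinf :: "('a, 'b) hinf \<Rightarrow> ('a, 'b) hinf \<Rightarrow> ('a, 'b) hinf"
  is "\<lambda>f g x. f x * g x"
proof -
  fix f g :: "'a \<Rightarrow> 'b"
  assume f: "f \<in> hinf_funs"
    and g: "g \<in> hinf_funs"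
  have hol: "(\<lambda>x. f x * g x) cholomorphic_on ball 0 1"
    unfolding cholomorphic_on_def
  proof
    fix x :: 'a assume x: "x \<in> ball 0 1"
    have "f cholomorphic_on ball 0 1" "g cholomorphic_on ball 0 1"
      using f g by (simp_all add: hinf_funs_def)
    then obtain D E where D: "clinear D" "(f has_derivative D) (at x)"
      and E: "clinear E" "(g has_derivative E) (at x)"
      using x unfolding cholomorphic_on_def by blast
    have "clinear (\<lambda>v. f x * E v + D v * g x)"
      using D(1) E(1) by (simp add: clinear_def scaleC_add_right mult_scaleC_left mult_scaleC_right
          distrib_left distrib_right add_ac)
    with has_derivative_mult[OF D(2) E(2)]
    show "\<exists>D. clinear D \<and> ((\<lambda>x. f x * g x) has_derivative D) (at x)"
      by blast
  qed
  have "bounded (f ` ball 0 1)" "bounded (g ` ball 0 1)"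
    using f g by (simp_all add: hinf_funs_def)
  then obtain B C where B: "\<forall>x\<in>ball 0 1. norm (f x) \<le> B" and C: "\<forall>x\<in>ball 0 1. norm (g x) \<le> C"
    unfolding bounded_iff by blast
  have "norm (f x * g x) \<le> B * C" if "x \<in> ball 0 1" for x
  proof -
    have "norm (f x * g x) \<le> norm (f x) * norm (g x)"
      by (rule norm_mult_ineq)
    also have "\<dots> \<le> B * C"
      using B C that by (intro mult_mono') auto
    finally show ?thesis .
  qed
  then have bdd: "bounded ((\<lambda>x. f x * g x) ` ball 0 1)"
    unfolding bounded_iff by blast
  have zero: "\<forall>x. x \<notin> ball 0 1 \<longrightarrow> f x * g x = 0"
    using f by (simp add: hinf_funs_def)
  show "(\<lambda>x. f x * g x) \<in> hinf_funs"
    unfolding hinf_funs_def by (intro CollectI conjI hol bdd zero)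
qed

instance
proof
  fix c :: complex and r :: real and f g h :: "('a, 'b) hinf"
  note ap = plus_hinf.rep_eq scaleC_hinf.rep_eq scaleR_hinf_apply times_hinf.rep_eq
  show "f * g * h = f * (g * h)" "(f + g) * h = f * h + g * h" "f * (g + h) = f * g + f * h"
    "r *\<^sub>R f * g = r *\<^sub>R (f * g)" "f * r *\<^sub>R g = r *\<^sub>R (f * g)"
    "c *\<^sub>C f * g = c *\<^sub>C (f * g)" "f * c *\<^sub>C g = c *\<^sub>C (f * g)"
    by (auto intro!: hinf_eqI simp: ap algebra_simps mult_scaleC_left mult_scaleC_right)
  show "norm (f * g) \<le> norm f * norm g"
  proof (rule norm_hinf_le)
    fix x :: 'a assume x: "x \<in> ball 0 1"
    have "norm (hinf_apply f x * hinf_apply g x) \<le> norm (hinf_apply f x) * norm (hinf_apply g x)"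
      by (rule norm_mult_ineq)
    also have "\<dots> \<le> norm f * norm g"
      using norm_hinf_apply_le[OF x] by (intro mult_mono) auto
    finally show "norm (hinf_apply (f * g) x) \<le> norm f * norm g"
      by (simp add: ap)
  qed
qed

end

text \<open>The inclusion of \<open>c\<^sub>0\<^sup>* = \<ell>\<^sub>1\<close> into the algebra.\<close>

lift_definition hinf_of_l1 :: "l1 \<Rightarrow> (c0, complex) hinf"
  is "\<lambda>a x. if x \<in> ball 0 1 then l1_pairing a (linf_of_c0 x) else 0"
proof -
  fix a
  let ?f = "\<lambda>x. if x \<in> ball 0 1 then l1_pairing a (linf_of_c0 x) else 0"
  have hol: "?f cholomorphic_on ball 0 1"
    unfolding cholomorphic_on_def
  proof (intro ballI exI conjI)
    fix x :: c0 assume x: "x \<in> ball 0 1"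
    show "clinear (\<lambda>x. l1_pairing a (linf_of_c0 x))"
      by (rule clinear_l1_pairing_c0)
    show "(?f has_derivative (\<lambda>x. l1_pairing a (linf_of_c0 x))) (at x)"
      by (rule has_derivative_transform_within_open[OF
            bounded_linear_imp_has_derivative[OF bounded_linear_l1_pairing_c0] open_ball x]) simp
  qed
  have im: "?f ` ball 0 1 = (\<lambda>x. l1_pairing a (linf_of_c0 x)) ` ball 0 1"
    by (rule image_cong[OF refl]) (rule if_P)
  have bdd: "bounded (?f ` ball 0 1)"
    unfolding im by (rule bounded_linear_image[OF bounded_ball bounded_linear_l1_pairing_c0])
  show "?f \<in> hinf_funs"
    unfolding hinf_funs_def
  proof (intro CollectI conjI allI impI)
    show "?f x = 0" if "x \<notin> ball 0 1" for x
      using that by (rule if_not_P)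
  qed (rule hol bdd)+
qed

section \<open>Homomorphisms of \<open>\<H>\<^sup>\<infinity>(B\<^bsub>c0\<^esub>)\<close>\<close>

type_synonym endo = "(c0, complex) hinf \<Rightarrow> (c0, complex) hinf"

definition Minf :: "endo set"
  where "Minf = {\<Phi>. clinear \<Phi> \<and> (\<forall>f g. \<Phi> (f * g) = \<Phi> f * \<Phi> g) \<and> \<Phi> \<noteq> (\<lambda>_. 0)}"

text \<open>\<open>\<xi>(\<Phi>)(x)\<close> is the functional \<open>a \<mapsto> \<Phi>(a)(x)\<close> on \<open>\<ell>\<^sub>1\<close>, read as an element of \<open>\<ell>\<^sub>\<infinity>\<close>;
  there is at most one such map, since the pairing separates the points of \<open>\<ell>\<^sub>\<infinity>\<close>.\<close>

definition xi :: "endo \<Rightarrow> (c0, linf) hinf"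
  where "xi \<Phi> = (THE g. \<forall>x\<in>ball 0 1. \<forall>a.
    l1_pairing a (hinf_apply g x) = hinf_apply (\<Phi> (hinf_of_l1 a)) x)"

definition fiber :: "(c0, linf) hinf \<Rightarrow> endo set"
  where "fiber g = {\<Phi> \<in> Minf. xi \<Phi> = g}"

text \<open>\<open>truncate n w = (w\<^sub>0, \<dots>, w\<^sub>n\<^sub>-\<^sub>1, 0, 0, \<dots>)\<close>\<close>

definition truncate :: "nat \<Rightarrow> linf \<Rightarrow> c0"
  where "truncate n w = Abs_c0 (Bcontfun (\<lambda>i. if i < n then apply_bcontfun w i else 0))"

lemma c0_nth_truncate: "c0_nth (truncate n w) i = (if i < n then apply_bcontfun w i else 0)"
proof -
  let ?s = "\<lambda>i. if i < n then apply_bcontfun w i else 0"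
  have "norm (?s i) \<le> norm w" for i
    by (simp add: norm_bounded)
  then have "?s \<in> bcontfun"
    by (auto intro!: bcontfun_normI)
  then have s: "apply_bcontfun (Bcontfun ?s) = ?s"
    by (rule Bcontfun_inverse)
  have "\<forall>\<^sub>F i in sequentially. ?s i = 0"
    using eventually_ge_at_top[of n] by eventually_elim simp
  then have "?s \<longlonglongrightarrow> 0"
    by (rule tendsto_eventually)
  then have "linf_of_c0 (truncate n w) = Bcontfun ?s"
    unfolding truncate_def by (intro Abs_c0_inverse) (simp add: s)
  then show ?thesis
    by (simp add: c0_nth_def s)
qed

text \<open>The Aron-Berner extension; the limit exists for \<open>w\<close> in the open unit ball.\<close>

definition canonical_ext :: "(c0, complex) hinf \<Rightarrow> linf \<Rightarrow> complex"
  where "canonical_ext f w = lim (\<lambda>n. hinf_apply f (truncate n w))"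

text \<open>The composition homomorphism; meaningful for \<open>h\<close> mapping the ball of \<open>c\<^sub>0\<close> into the open
  unit ball of \<open>\<ell>\<^sub>\<infinity>\<close>.\<close>

definition comp_hom :: "(c0, linf) hinf \<Rightarrow> endo"
  where "comp_hom h f =
    Abs_hinf (\<lambda>x. if x \<in> ball 0 1 then canonical_ext f (hinf_apply h x) else 0)"

definition gleason_dist :: "endo \<Rightarrow> endo \<Rightarrow> real"
  where "gleason_dist \<Phi> \<Psi> = onorm (\<lambda>f. \<Phi> f - \<Psi> f)"

definition gleason_part :: "endo \<Rightarrow> endo set"
  where "gleason_part \<Phi> = {\<Psi> \<in> Minf. gleason_dist \<Phi> \<Psi> < 2}"

definition gleason_isometry :: "((c0, linf) hinf \<Rightarrow> endo) \<Rightarrow> bool"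
  where "gleason_isometry F \<longleftrightarrow> (\<forall>h\<in>ball 0 1. \<forall>h'\<in>ball 0 1.
    gleason_dist (F h) (F h') = gleason_dist (comp_hom h) (comp_hom h'))"

definition analytic_into_Minf :: "((c0, linf) hinf \<Rightarrow> endo) \<Rightarrow> bool"
  where "analytic_into_Minf F \<longleftrightarrow>
    (\<forall>f. \<forall>x\<in>ball 0 1. (\<lambda>h. hinf_apply (F h f) x) cholomorphic_on ball 0 1)"

definition in_different_gleason_parts :: "endo set \<Rightarrow> endo set \<Rightarrow> bool"
  where "in_different_gleason_parts A B \<longleftrightarrow> (\<forall>\<Phi>\<in>A. \<forall>\<Psi>\<in>B. \<Phi> \<notin> gleason_part \<Psi> \<and> \<Psi> \<notin> gleason_part \<Phi>)"

section \<open>The Stone-Cech compactification of the natural numbers\<close>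

definition ultrafilter :: "'a filter \<Rightarrow> bool"
  where "ultrafilter F \<longleftrightarrow> F \<noteq> bot \<and> (\<forall>P. eventually P F \<or> eventually (\<lambda>x. \<not> P x) F)"

text \<open>The space of ultrafilters on the natural numbers with the Stone topology; the natural
  numbers embed as principal ultrafilters.  The lemmas below show that this is a compact
  Hausdorff space containing the discrete space of natural numbers densely, and that maps from
  the natural numbers to compact Hausdorff spaces extend to it.\<close>

definition betaN :: "nat filter topology"
  where "betaN = topology_generated_by (range (\<lambda>P. {F. ultrafilter F \<and> eventually P F}))"

definition betaN_of_nat :: "nat \<Rightarrow> nat filter"
  where "betaN_of_nat n = principal {n}"

lemma ultrafilter_not: "ultrafilter F \<Longrightarrow> eventually (\<lambda>x. \<not> P x) F \<longleftrightarrow> \<not> eventually P F"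
proof
  assume F: "ultrafilter F" and np: "eventually (\<lambda>x. \<not> P x) F"
  show "\<not> eventually P F"
  proof
    assume "eventually P F"
    with np have "eventually (\<lambda>_. False) F" by eventually_elim simp
    with F show False by (simp add: ultrafilter_def eventually_False)
  qed
qed (auto simp: ultrafilter_def)

lemma ex_ultrafilter_le:
  fixes F :: "'a filter"
  assumes "F \<noteq> bot"
  shows "\<exists>U\<le>F. ultrafilter U"
proof -
  let ?A = "{G. G \<noteq> bot \<and> G \<le> F}"
  have "\<exists>m\<in>?A. \<forall>a\<in>?A. m \<ge> a \<longrightarrow> a = m"
  proof (rule predicate_Zorn)
    show "partial_order_on ?A (relation_of (\<ge>) ?A)"
      by (rule partial_order_on_relation_ofI) auto
    fix C assume C: "C \<in> Chains (relation_of (\<ge>) ?A)"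
    then have CA: "C \<subseteq> ?A" and lin: "\<And>a b. a \<in> C \<Longrightarrow> b \<in> C \<Longrightarrow> a \<le> b \<or> b \<le> a"
      by (auto simp: Chains_def relation_of_def)
    show "\<exists>u\<in>?A. \<forall>a\<in>C. a \<ge> u"
    proof (cases "C = {}")
      case True
      with assms show ?thesis by auto
    next
      case False
      have "Inf C \<noteq> bot"
      proof
        assume "Inf C = bot"
        then have "eventually (\<lambda>_. False) (Inf C)" by simp
        moreover have "\<exists>x\<in>C. x \<le> inf a b" if "a \<in> C" "b \<in> C" for a b
          using lin[OF that] that by (auto simp: inf_absorb1 inf_absorb2)
        ultimately obtain b where "b \<in> C" "eventually (\<lambda>_. False) b"
          using eventually_Inf_base[OF False, of "\<lambda>_. False"] by blast
        with CA show False by (auto simp: eventually_False)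
      qed
      moreover have "Inf C \<le> F"
      proof -
        obtain b where "b \<in> C" using False by blast
        with CA show ?thesis by (intro Inf_lower2[of b]) auto
      qed
      ultimately show ?thesis
        by (auto intro: Inf_lower)
    qed
  qed
  then obtain U where U: "U \<noteq> bot" "U \<le> F" and mx': "\<forall>a\<in>?A. a \<le> U \<longrightarrow> a = U"
    by blast
  have mx: "a = U" if "a \<noteq> bot" "a \<le> U" for a
    using mx' that order_trans[OF that(2) U(2)] by blast
  have "eventually P U \<or> eventually (\<lambda>x. \<not> P x) U" for P
  proof (rule disjCI)
    assume n: "\<not> eventually (\<lambda>x. \<not> P x) U"
    have "inf U (principal {x. P x}) \<noteq> bot"
      using n by (auto simp: trivial_limit_def eventually_inf_principal)
    then have "inf U (principal {x. P x}) = U"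
      by (intro mx) auto
    moreover have "eventually P (inf U (principal {x. P x}))"
      by (simp add: eventually_inf_principal)
    ultimately show "eventually P U" by simp
  qed
  with U show ?thesis
    by (auto simp: ultrafilter_def)
qed

lemma ultrafilter_principal: "ultrafilter (principal {x})"
  by (auto simp: ultrafilter_def principal_eq_bot_iff eventually_principal)

lemma topspace_betaN: "topspace betaN = {F. ultrafilter F}"
  unfolding betaN_def topology_generated_by_topspace using eventually_True by blast

lemma openin_betaN_basic: "openin betaN {F. ultrafilter F \<and> eventually P F}"
  unfolding betaN_def by (rule topology_generated_by_Basis) auto

lemma openin_betaN_iff:
  "openin betaN S \<longleftrightarrow> S \<subseteq> {F. ultrafilter F} \<and>
    (\<forall>F\<in>S. \<exists>P. eventually P F \<and> {F. ultrafilter F \<and> eventually P F} \<subseteq> S)"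
proof
  assume "openin betaN S"
  then have "generate_topology_on (range (\<lambda>P. {F. ultrafilter F \<and> eventually P F})) S"
    by (simp add: betaN_def openin_topology_generated_by_iff)
  then show "S \<subseteq> {F. ultrafilter F} \<and>
    (\<forall>F\<in>S. \<exists>P. eventually P F \<and> {F. ultrafilter F \<and> eventually P F} \<subseteq> S)"
  proof induction
    case (Int a b)
    show ?case
    proof (intro conjI ballI)
      show "a \<inter> b \<subseteq> {F. ultrafilter F}"
        using Int.IH(1) by blast
      fix F assume "F \<in> a \<inter> b"
      then obtain P Q where "eventually P F" "{F. ultrafilter F \<and> eventually P F} \<subseteq> a"
        "eventually Q F" "{F. ultrafilter F \<and> eventually Q F} \<subseteq> b"
        using Int.IH by blast
      then show "\<exists>P. eventually P F \<and> {F. ultrafilter F \<and> eventually P F} \<subseteq> a \<inter> b"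
        by (intro exI[of _ "\<lambda>x. P x \<and> Q x"]) (auto simp: eventually_conj_iff)
    qed
  next
    case (UN K)
    show ?case
    proof (intro conjI ballI)
      show "\<Union>K \<subseteq> {F. ultrafilter F}"
        using UN.IH by (intro Union_least) simp
      fix F assume "F \<in> \<Union>K"
      then obtain k where k: "k \<in> K" "F \<in> k" by blast
      then obtain P where P: "eventually P F" "{F. ultrafilter F \<and> eventually P F} \<subseteq> k"
        using UN.IH[OF k(1)] by blast
      then show "\<exists>P. eventually P F \<and> {F. ultrafilter F \<and> eventually P F} \<subseteq> \<Union>K"
        using k(1) by blast
    qed
  next
    case (Basis s)
    then show ?case by fast
  qed auto
next
  assume S: "S \<subseteq> {F. ultrafilter F} \<and>
    (\<forall>F\<in>S. \<exists>P. eventually P F \<and> {F. ultrafilter F \<and> eventually P F} \<subseteq> S)"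
  show "openin betaN S"
  proof (subst openin_subopen, intro ballI)
    fix F assume "F \<in> S"
    with S obtain P where "eventually P F" "{F. ultrafilter F \<and> eventually P F} \<subseteq> S" "ultrafilter F"
      by blast
    then show "\<exists>T. openin betaN T \<and> F \<in> T \<and> T \<subseteq> S"
      by (intro exI[of _ "{F. ultrafilter F \<and> eventually P F}"]) (auto simp: openin_betaN_basic)
  qed
qed

lemma compact_space_betaN: "compact_space betaN"
  unfolding compact_space_alt
proof (intro allI impI, elim conjE)
  fix \<U> assume op: "\<forall>U\<in>\<U>. openin betaN U" and cov: "topspace betaN \<subseteq> \<Union>\<U>"
  define B where "B P = {F :: nat filter. ultrafilter F \<and> eventually P F}" for P
  define \<P> where "\<P> = {P. \<exists>U\<in>\<U>. B P \<subseteq> U}"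
  have covP: "\<exists>P\<in>\<P>. eventually P F" if F: "ultrafilter F" for F
  proof -
    obtain U where U: "U \<in> \<U>" "F \<in> U"
      using cov F by (auto simp: topspace_betaN)
    have "openin betaN U"
      using op U(1) by simp
    then obtain P where P: "eventually P F" "B P \<subseteq> U"
      using U(2) unfolding openin_betaN_iff B_def by blast
    then have "P \<in> \<P>"
      using U(1) unfolding \<P>_def by blast
    with P(1) show ?thesis by blast
  qed
  define G where "G = (INF P\<in>\<P>. principal {n. \<not> P n})"
  have "G = bot"
  proof (rule ccontr)
    assume "G \<noteq> bot"
    then obtain U where U: "U \<le> G" "ultrafilter U"
      using ex_ultrafilter_le by blast
    obtain P where P: "P \<in> \<P>" "eventually P U"
      using covP U by blast
    have "U \<le> principal {n. \<not> P n}"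
      using U(1) INF_lower[OF P(1), of "\<lambda>P. principal {n. \<not> P n}"] unfolding G_def
      by (rule order_trans)
    then have "eventually (\<lambda>n. \<not> P n) U"
      by (simp add: le_principal)
    with P U show False by (simp add: ultrafilter_not)
  qed
  then have "eventually (\<lambda>_. False) (INF P\<in>\<P>. principal {n. \<not> P n})"
    by (simp add: G_def)
  from eventually_INF[THEN iffD1, OF this] obtain X where X: "finite X" "X \<subseteq> \<P>"
    and "eventually (\<lambda>_. False) (INF P\<in>X. principal {n. \<not> P n})"
    by blast
  then have Xbot: "(INF P\<in>X. principal {n. \<not> P n}) = bot"
    by (simp only: eventually_False)
  have "\<forall>P\<in>X. \<exists>U. U \<in> \<U> \<and> B P \<subseteq> U"
    using X(2) unfolding \<P>_def by blast
  then obtain \<phi> where \<phi>: "\<And>P. P \<in> X \<Longrightarrow> \<phi> P \<in> \<U> \<and> B P \<subseteq> \<phi> P"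
    using bchoice[of X "\<lambda>P U. U \<in> \<U> \<and> B P \<subseteq> U"] by blast
  have "topspace betaN \<subseteq> \<Union>(\<phi> ` X)"
  proof
    fix F assume "F \<in> topspace betaN"
    then have F: "ultrafilter F" by (simp add: topspace_betaN)
    have "\<exists>P\<in>X. eventually P F"
    proof (rule ccontr)
      assume "\<not> (\<exists>P\<in>X. eventually P F)"
      then have "F \<le> (INF P\<in>X. principal {n. \<not> P n})"
        using F by (intro INF_greatest) (simp add: le_principal ultrafilter_not)
      with F show False
        unfolding Xbot by (simp add: bot_unique ultrafilter_def)
    qed
    then obtain P where P: "P \<in> X" "eventually P F" by blast
    then have "F \<in> \<phi> P"
      using F \<phi>[OF P(1)] by (auto simp: B_def)
    with P(1) show "F \<in> \<Union>(\<phi> ` X)" by blast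
  qed
  moreover have "\<phi> ` X \<subseteq> \<U>"
    using \<phi> by (simp add: image_subset_iff)
  ultimately show "\<exists>\<F>. finite \<F> \<and> \<F> \<subseteq> \<U> \<and> topspace betaN \<subseteq> \<Union>\<F>"
    using X(1) finite_imageI by blast
qed

lemma Hausdorff_space_betaN: "Hausdorff_space betaN"
  unfolding Hausdorff_space_def
proof (intro allI impI, elim conjE)
  fix F G assume F: "F \<in> topspace betaN" and G: "G \<in> topspace betaN" and "F \<noteq> G"
  then obtain P where P: "eventually P F \<noteq> eventually P G"
    by (auto simp: filter_eq_iff)
  define Q where "Q = (if eventually P F then P else (\<lambda>n. \<not> P n))"
  have Q: "eventually Q F" "eventually (\<lambda>n. \<not> Q n) G"
    using P F G unfolding Q_def by (auto simp: topspace_betaN ultrafilter_not)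
  show "\<exists>U V. openin betaN U \<and> openin betaN V \<and> F \<in> U \<and> G \<in> V \<and> disjnt U V"
    using F G Q openin_betaN_basic[of Q] openin_betaN_basic[of "\<lambda>n. \<not> Q n"]
    by (intro exI[of _ "{F. ultrafilter F \<and> eventually Q F}"]
        exI[of _ "{F. ultrafilter F \<and> eventually (\<lambda>n. \<not> Q n) F}"])
      (auto simp: topspace_betaN disjnt_def ultrafilter_not)
qed

lemma embedding_betaN_of_nat: "embedding_map (discrete_topology UNIV) betaN betaN_of_nat"
  unfolding embedding_map_def
proof -
  let ?R = "range betaN_of_nat"
  have inj: "inj betaN_of_nat"
    by (auto simp: inj_def betaN_of_nat_def)
  have R: "topspace (subtopology betaN ?R) = ?R"
    by (auto simp: topspace_betaN betaN_of_nat_def ultrafilter_principal)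
  have "openin betaN {betaN_of_nat n}" for n
  proof -
    have "{F. ultrafilter F \<and> eventually (\<lambda>m. m = n) F} = {betaN_of_nat n}" (is "?L = _")
    proof (intro equalityI subsetI)
      fix F assume "F \<in> ?L"
      then have F: "ultrafilter F" "F \<le> principal {n}"
        by (auto simp: le_principal)
      have "eventually P F \<longleftrightarrow> P n" for P
      proof (cases "P n")
        case True
        then show ?thesis
          using F filter_leD[of F "principal {n}" P] by (auto simp: eventually_principal)
      next
        case False
        then have "eventually (\<lambda>x. \<not> P x) F"
          using F filter_leD[of F "principal {n}" "\<lambda>x. \<not> P x"] by (auto simp: eventually_principal)
        with False F show ?thesis by (simp add: ultrafilter_not)
      qed
      then show "F \<in> {betaN_of_nat n}"
        by (simp add: betaN_of_nat_def filter_eq_iff eventually_principal)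
    qed (auto simp: betaN_of_nat_def ultrafilter_principal eventually_principal)
    then show ?thesis
      using openin_betaN_basic[of "\<lambda>m. m = n"] by simp
  qed
  then have "openin betaN (betaN_of_nat ` S)" for S
    using openin_Union[of "(\<lambda>n. {betaN_of_nat n}) ` S" betaN] by (auto simp: UNION_singleton_eq_range)
  then have "openin (subtopology betaN ?R) (betaN_of_nat ` S)" for S
    by (metis image_mono openin_subtopology_Int2 inf.absorb_iff2 inf_commute subset_UNIV)
  then have "open_map (discrete_topology UNIV) (subtopology betaN ?R) betaN_of_nat"
    by (simp add: open_map_def)
  with inj R show "homeomorphic_map (discrete_topology UNIV)
      (subtopology betaN (betaN_of_nat ` topspace (discrete_topology UNIV))) betaN_of_nat"
    by (intro bijective_open_imp_homeomorphic_map) (auto simp: Pi_def)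
qed

lemma dense_betaN_of_nat: "betaN closure_of (range betaN_of_nat) = topspace betaN"
proof -
  have "\<exists>G. G \<in> range betaN_of_nat \<and> G \<in> T" if T: "F \<in> T" "openin betaN T" for F T
  proof -
    obtain P where P: "eventually P F" "{F. ultrafilter F \<and> eventually P F} \<subseteq> T" "ultrafilter F"
      using T unfolding openin_betaN_iff by blast
    then obtain n where "P n"
      using eventually_happens'[of F P] by (auto simp: ultrafilter_def)
    then have "betaN_of_nat n \<in> T"
      using P by (auto simp: betaN_of_nat_def ultrafilter_principal eventually_principal)
    then show ?thesis by blast
  qed
  then show ?thesis
    unfolding closure_of_def by blast
qed

lemma betaN_extension:
  assumes K: "compact_space K" "Hausdorff_space K" and f: "\<And>n. f n \<in> topspace K"
  shows "\<exists>g. continuous_map betaN K g \<and> (\<forall>n. g (betaN_of_nat n) = f n)"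
proof -
  have lim: "\<exists>l. limitin K f l F" if F: "ultrafilter F" for F
  proof (rule ccontr)
    assume "\<not> ?thesis"
    then have "\<forall>l\<in>topspace K. \<exists>U. openin K U \<and> l \<in> U \<and> \<not> eventually (\<lambda>n. f n \<in> U) F"
      by (auto simp: limitin_def)
    then obtain U where U: "\<And>l. l \<in> topspace K \<Longrightarrow>
        openin K (U l) \<and> l \<in> U l \<and> \<not> eventually (\<lambda>n. f n \<in> U l) F"
      by metis
    then have "\<forall>V\<in>U ` topspace K. openin K V" "topspace K \<subseteq> \<Union>(U ` topspace K)"
      by auto
    then obtain \<F> where \<F>: "finite \<F>" "\<F> \<subseteq> U ` topspace K" "topspace K \<subseteq> \<Union>\<F>"
      using K(1) unfolding compact_space_alt by meson
    have "\<forall>V\<in>\<F>. eventually (\<lambda>n. f n \<notin> V) F"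
      using \<F>(2) U F by (auto simp: ultrafilter_not)
    then have "eventually (\<lambda>n. \<forall>V\<in>\<F>. f n \<notin> V) F"
      using \<F>(1) by (simp add: eventually_ball_finite)
    then obtain n where "\<forall>V\<in>\<F>. f n \<notin> V"
      using F eventually_happens'[of F "\<lambda>n. \<forall>V\<in>\<F>. f n \<notin> V"] by (auto simp: ultrafilter_def)
    with \<F>(3) f[of n] show False by blast
  qed
  define g where "g F = (SOME l. limitin K f l F)" for F
  have g: "limitin K f (g F) F" if "ultrafilter F" for F
    unfolding g_def by (rule someI_ex) (rule lim[OF that])
  have reg: "regular_space K"
    using K by (simp add: compact_Hausdorff_imp_regular_space)
  have "continuous_map betaN K g"
    unfolding continuous_map_def
  proof (intro conjI allI impI)
    show "g \<in> topspace betaN \<rightarrow> topspace K"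
      using limitin_topspace[OF g] by (simp add: topspace_betaN)
    fix U assume U: "openin K U"
    show "openin betaN {F \<in> topspace betaN. g F \<in> U}"
      unfolding openin_betaN_iff
    proof (intro conjI ballI)
      fix F assume "F \<in> {F \<in> topspace betaN. g F \<in> U}"
      then have F: "ultrafilter F" "g F \<in> U" by (auto simp: topspace_betaN)
      have "\<exists>V C. openin K V \<and> closedin K C \<and> g F \<in> V \<and> V \<subseteq> C \<and> C \<subseteq> U"
        using reg U F(2) unfolding neighbourhood_base_of_closedin[symmetric] neighbourhood_base_of
        by blast
      then obtain V C where V: "openin K V" "closedin K C" "g F \<in> V" "V \<subseteq> C" "C \<subseteq> U"
        by blast
      show "\<exists>P. eventually P F \<and> {F. ultrafilter F \<and> eventually P F} \<subseteq> {F \<in> topspace betaN. g F \<in> U}"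
      proof (intro exI conjI)
        show "eventually (\<lambda>n. f n \<in> V) F"
          using limitinD[OF g[OF F(1)] V(1,3)] .
        show "{F. ultrafilter F \<and> eventually (\<lambda>n. f n \<in> V) F} \<subseteq> {F \<in> topspace betaN. g F \<in> U}"
        proof safe
          fix G assume G: "ultrafilter G" "eventually (\<lambda>n. f n \<in> V) G"
          have "g G \<in> C"
          proof (rule limitin_closedin[OF g[OF G(1)] V(2)])
            show "eventually (\<lambda>n. f n \<in> C) G"
              using G(2) by eventually_elim (use V in auto)
            show "G \<noteq> bot" using G(1) by (simp add: ultrafilter_def)
          qed
          with V show "g G \<in> U" by auto
          show "G \<in> topspace betaN" using G by (simp add: topspace_betaN)
        qed
      qed
    qed (auto simp: topspace_betaN)
  qed
  moreover have "g (betaN_of_nat n) = f n" for n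
  proof (rule limitin_Hausdorff_unique[OF _ _ _ K(2)])
    show "limitin K f (g (betaN_of_nat n)) (betaN_of_nat n)"
      by (rule g) (simp add: betaN_of_nat_def ultrafilter_principal)
    show "limitin K f (f n) (betaN_of_nat n)"
      using f by (simp add: limitin_def betaN_of_nat_def eventually_principal)
    show "betaN_of_nat n \<noteq> bot"
      by (simp add: betaN_of_nat_def principal_eq_bot_iff)
  qed
  ultimately show ?thesis by blast
qed

abbreviation betaN_remainder :: "nat filter set"
  where "betaN_remainder \<equiv> topspace betaN - range betaN_of_nat"

end

theory Submission
  imports Defs "HOL-Complex_Analysis.Complex_Analysis"
begin

text \<open>
  The homomorphism with parameters \<open>\<eta>\<close> and \<open>h\<close> in the fiber over \<open>g\<close> is
  \<open>f \<mapsto> (x \<mapsto> lim\<^sub>k f (P k (g x) (h x)))\<close>, the limit being taken along the ultrafilter \<open>\<eta>\<close>.  Here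
  \<open>P k u w = (t u\<^sub>0, \<dots>, t u\<^sub>k\<^sub>-\<^sub>1, w\<^sub>0, \<dots>, w\<^sub>k\<^sub>-\<^sub>1, t, 0, 0, \<dots>)\<close>, with \<open>t = t\<^sub>k < 1\<close> tending to 1, is a
  finitely supported point of the open ball (\<open>spot\<close> below).  As \<open>k\<close> grows, functionals in \<open>\<ell>\<^sub>1\<close> see
  only \<open>u\<close>, which puts the homomorphism into the fiber over \<open>g\<close>.  Limits of uniformly bounded
  holomorphic functions along an ultrafilter are holomorphic (\<open>cholomorphic_on_pointwise_limit\<close>),
  which gives both the membership of the values in the algebra and the analytic dependence on \<open>h\<close>.

  The coordinate \<open>t\<close> at the position \<open>2 k\<close> is a marker.  There are holomorphic weights with moduli
  summing to at most 1 which recognise the index \<open>k\<close> from the position of the last marker, so that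
  any uniformly bounded sequence of functions \<open>\<phi> k\<close> is interpolated, asymptotically and without
  increase of norm, by a single function at the points \<open>P k u w\<close> (\<open>interpolation_at_markers\<close>).
  Interpolating the functions that apply a given \<open>f\<close> to the copy of \<open>w\<close> in \<open>P k u w\<close> shows that the
  construction does not decrease the Gleason distance of composition homomorphisms; that it does
  not increase it is elementary, since \<open>w \<mapsto> f (P k u w)\<close> depends on finitely many coordinates.
  Interpolating the constants 1 and -1, according to a set of indices that separates two
  ultrafilters, gives the distance 2 between their images.

  All this compares the construction with composition homomorphisms, whose definition presupposes
  that \<open>f (w\<^sub>0, \<dots>, w\<^sub>n\<^sub>-\<^sub>1, 0, \<dots>)\<close> converges for every \<open>w\<close> in the open ball of \<open>\<ell>\<^sub>\<infinity>\<close>.  This is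
  \<open>convergent_truncate\<close>.  It rests on \<open>tendsto_far_perturbation\<close>: perturbations of bounded size
  whose supports move off to infinity do not change \<open>f\<close> in the limit.
\<close>


section \<open>Bounded holomorphic functions of one variable\<close>

lemma Schwarz_scaled:
  fixes f :: "complex \<Rightarrow> complex"
  assumes f: "f holomorphic_on ball 0 R" "f 0 = 0" and B: "\<And>z. cmod z < R \<Longrightarrow> cmod (f z) \<le> B"
    and z: "cmod z < R"
  shows "cmod (f z) \<le> B * cmod z / R" and "cmod (deriv f 0) \<le> B / R"
proof -
  have R: "0 < R"
    using z norm_ge_zero[of z] by linarith
  have "0 \<le> B"
    using B[OF z] norm_ge_zero[of "f z"] by linarith
  \<comment> \<open>The Schwarz lemma asks for a strict bound; \<open>B + e\<close> is one.\<close>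
  have scaled: "cmod (f z) \<le> (B + e) * cmod z / R \<and> cmod (deriv f 0) \<le> (B + e) / R"
    if e: "0 < e" for e
  proof -
    define C where "C = B + e"
    have C: "0 < C" "B < C"
      using \<open>0 \<le> B\<close> e by (auto simp: C_def)
    define F where "F = (\<lambda>u. f (of_real R * u) / of_real C)"
    have in_ball: "cmod (of_real R * u) < R" if "cmod u < 1" for u
      using that R by (simp add: norm_mult)
    have hol: "(\<lambda>u. f (of_real R * u)) holomorphic_on ball 0 1"
      using in_ball
      by (intro holomorphic_on_compose_gen[OF _ f(1), unfolded o_def] holomorphic_intros) auto
    then have F: "F holomorphic_on ball 0 1"
      unfolding F_def by (intro holomorphic_intros) (use C in auto)
    have F0: "F 0 = 0"
      by (simp add: F_def f)
    have Fn: "cmod (F u) < 1" if "cmod u < 1" for u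
      using B[OF in_ball[OF that]] C by (simp add: F_def norm_divide)
    have u: "cmod (z / of_real R) < 1"
      using z R by (simp add: norm_divide)
    have "cmod (F (z / of_real R)) \<le> cmod (z / of_real R)"
      by (rule Schwarz_Lemma(1)[OF F F0 Fn u])
    then have 1: "cmod (f z) \<le> C * cmod z / R"
      using R C by (simp add: F_def norm_divide field_simps)
    have "f field_differentiable at (of_real R * 0)"
      using f(1) R by (auto intro: holomorphic_on_imp_differentiable_at)
    then have "(F has_field_derivative deriv f 0 * of_real R / of_real C) (at 0)"
      unfolding F_def
      using C(1) by (auto intro!: derivative_eq_intros DERIV_chain'[where g=f] field_differentiable_derivI)
    then have "deriv F 0 = deriv f 0 * of_real R / of_real C"
      by (rule DERIV_imp_deriv)
    moreover have "cmod (deriv F 0) \<le> 1"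
      by (rule Schwarz_Lemma(2)[OF F F0 Fn u])
    ultimately have "cmod (deriv f 0) \<le> C / R"
      using R C by (auto simp: norm_divide norm_mult pos_divide_le_eq pos_le_divide_eq mult.commute)
    with 1 show ?thesis
      by (simp add: C_def)
  qed
  show "cmod (f z) \<le> B * cmod z / R"
  proof (rule field_le_epsilon)
    fix e :: real assume e: "0 < e"
    have "cmod (f z) \<le> (B + e) * cmod z / R"
      using scaled[OF e] by simp
    also have "\<dots> = B * cmod z / R + e * (cmod z / R)"
      by (simp add: add_divide_distrib distrib_right)
    also have "e * (cmod z / R) \<le> e * 1"
      using z R e by (intro mult_left_mono) auto
    finally show "cmod (f z) \<le> B * cmod z / R + e"
      by simp
  qed
  show "cmod (deriv f 0) \<le> B / R"
  proof (rule field_le_epsilon)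
    fix e :: real assume e: "0 < e"
    have "cmod (deriv f 0) \<le> (B + e * R) / R"
      using scaled[of "e * R"] e R by simp
    then show "cmod (deriv f 0) \<le> B / R + e"
      using R by (simp add: add_divide_distrib)
  qed
qed

text \<open>The zero of \<open>f z - f 0\<close> is divided out, and then the zero of the quotient minus its value at the
  centre; each division improves the bound by the Schwarz lemma.\<close>

lemma first_order_remainder_le:
  fixes f :: "complex \<Rightarrow> complex"
  assumes f: "f holomorphic_on ball 0 R" and B: "\<And>z. cmod z < R \<Longrightarrow> cmod (f z) \<le> B"
    and z: "cmod z < R"
  shows "cmod (f z - f 0 - deriv f 0 * z) \<le> 4 * B * (cmod z)\<^sup>2 / R\<^sup>2"
proof -
  have R: "0 < R"
    using z norm_ge_zero[of z] by linarith
  define h where "h = (\<lambda>z. f z - f 0)"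
  have h: "h holomorphic_on ball 0 R" "h 0 = 0"
    unfolding h_def by (auto intro!: holomorphic_intros f)
  have hB: "cmod (h u) \<le> 2 * B" if "cmod u < R" for u
    using B[OF that] B[of 0] R norm_triangle_ineq4[of "f u" "f 0"] by (simp add: h_def)
  obtain k where k: "k holomorphic_on ball 0 R" "\<And>z. cmod z < R \<Longrightarrow> h z = z * k z" "deriv h 0 = k 0"
    using Schwarz3[OF h] by blast
  have kB: "cmod (k u) \<le> 2 * B / R" if u: "cmod u < R" for u
  proof (cases "u = 0")
    case True
    then show ?thesis
      using Schwarz_scaled(2)[OF h hB u] k(3) by simp
  next
    case False
    then show ?thesis
      using Schwarz_scaled(1)[OF h hB u] k(2)[OF u] mult_le_cancel_left_pos[of "cmod u" "cmod (k u)" "2 * B / R"]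
      by (simp add: norm_mult mult_ac)
  qed
  have "cmod (k z - k 0) \<le> (4 * B / R) * cmod z / R"
  proof (rule Schwarz_scaled(1)[where f="\<lambda>z. k z - k 0"])
    fix u assume "cmod u < R"
    then show "cmod (k u - k 0) \<le> 4 * B / R"
      using kB[of u] kB[of 0] R norm_triangle_ineq4[of "k u" "k 0"] by simp
  qed (auto intro!: holomorphic_intros k z)
  then have "cmod (z * (k z - k 0)) \<le> cmod z * ((4 * B / R) * cmod z / R)"
    by (simp add: norm_mult mult_left_mono del: times_divide_eq_left times_divide_eq_right)
  moreover have "deriv h 0 = deriv f 0"
    unfolding h_def using f R by (subst deriv_diff) (auto intro: holomorphic_on_imp_differentiable_at)
  then have "z * (k z - k 0) = f z - f 0 - deriv f 0 * z"
    using k(2)[OF z] k(3) by (simp add: h_def algebra_simps)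
  ultimately show ?thesis
    by (simp add: power2_eq_square field_simps)
qed

definition circle_mean :: "(complex \<Rightarrow> complex) \<Rightarrow> complex"
  where "circle_mean F = integral {0..1} (\<lambda>t. F (exp (2 * of_real pi * \<i> * of_real t)))"

lemma Cauchy_circle_mean:
  assumes F: "F holomorphic_on ball 0 R" and R: "1 < R" and w: "cmod w < 1"
  shows "circle_mean (\<lambda>u. F u * (u / (u - w))) = F w"
proof -
  have "((\<lambda>u. F u / (u - w)) has_contour_integral (2 * of_real pi * \<i> * F w)) (circlepath 0 1)"
  proof (rule Cauchy_integral_circlepath)
    show "continuous_on (cball 0 1) F"
      by (intro holomorphic_on_imp_continuous_on holomorphic_on_subset[OF F]) (use R in auto)
    show "F holomorphic_on ball 0 1"
      by (rule holomorphic_on_subset[OF F]) (use R in auto)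
  qed (use w in simp)
  then have "((\<lambda>t. F (exp (2 * of_real pi * \<i> * of_real t)) / (exp (2 * of_real pi * \<i> * of_real t) - w)
      * (2 * of_real pi * \<i> * exp (2 * of_real pi * \<i> * of_real t)))
      has_integral 2 * of_real pi * \<i> * F w) {0..1}"
    unfolding has_contour_integral vector_derivative_circlepath unfolding circlepath by (simp add: mult_ac)
  then have "((\<lambda>t. (1 / (2 * of_real pi * \<i>)) * (F (exp (2 * of_real pi * \<i> * of_real t)) /
      (exp (2 * of_real pi * \<i> * of_real t) - w) * (2 * of_real pi * \<i> * exp (2 * of_real pi * \<i> * of_real t))))
      has_integral (1 / (2 * of_real pi * \<i>)) * (2 * of_real pi * \<i> * F w)) {0..1}"
    by (rule has_integral_mult_right)
  moreover have "(1 / (2 * of_real pi * \<i>)) * (a / b * (2 * of_real pi * \<i> * c)) = a * (c / b)" for a b c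
    by (simp only: times_divide_eq_left times_divide_eq_right) (simp add: mult_ac)
  moreover have "(1 / (2 * of_real pi * \<i>)) * (2 * of_real pi * \<i> * F w) = F w"
    by simp
  ultimately have "((\<lambda>t. F (exp (2 * of_real pi * \<i> * of_real t)) * (exp (2 * of_real pi * \<i> * of_real t) /
      (exp (2 * of_real pi * \<i> * of_real t) - w))) has_integral F w) {0..1}"
    by (simp only:)
  then show ?thesis
    unfolding circle_mean_def by (rule integral_unique)
qed

text \<open>The mean of \<open>\<bar>h\<bar>\<^sup>2\<close> over the circle exceeds \<open>\<bar>h 0\<bar>\<^sup>2\<close> by the mean of \<open>\<bar>h - h 0\<bar>\<^sup>2\<close>, and the latter
  controls the increment of \<open>h\<close> at an interior point.  Consequently, if the pair \<open>(h, k)\<close> has almost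
  maximal length at the centre of the disc, then \<open>h\<close> alone is almost constant inside the disc.\<close>

lemma circle_mean_growth:
  fixes h k :: "complex \<Rightarrow> complex" and K s B :: real
  assumes h: "h holomorphic_on ball 0 R" and k: "k holomorphic_on ball 0 R" and R: "1 < R"
    and K: "0 \<le> K" and s: "0 \<le> s" "s < 1"
    and B: "\<And>z. cmod z = 1 \<Longrightarrow> (cmod (h z))\<^sup>2 + K * (cmod (k z))\<^sup>2 \<le> B"
  shows "(cmod (h 0))\<^sup>2 + K * (cmod (k 0))\<^sup>2 + (1 - s) * (cmod (h s - h 0))\<^sup>2 \<le> B"
proof -
  define \<gamma> :: "real \<Rightarrow> complex" where "\<gamma> = (\<lambda>t. exp (2 * of_real pi * \<i> * of_real t))"
  have \<gamma>: "cmod (\<gamma> t) = 1" for t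
    by (simp add: \<gamma>_def)
  have cont_\<gamma>: "continuous_on {0..1} \<gamma>"
    unfolding \<gamma>_def by (intro continuous_intros)
  have cont: "continuous_on {0..1} (\<lambda>t. F (\<gamma> t))" if "F holomorphic_on ball 0 R" for F
  proof (rule continuous_on_compose2[OF holomorphic_on_imp_continuous_on[OF that]])
    show "continuous_on {0..1} \<gamma>"
      by (rule cont_\<gamma>)
    show "\<gamma> ` {0..1} \<subseteq> ball 0 R"
      using R by (auto simp: \<gamma>)
  qed
  have mean: "circle_mean (\<lambda>u. F u * (u / (u - w))) = integral {0..1} (\<lambda>t. F (\<gamma> t) * (\<gamma> t / (\<gamma> t - w)))" for F w
    by (simp add: circle_mean_def \<gamma>_def)
  \<comment> \<open>Cauchy's formula is applied to the square of \<open>F\<close>, so that the kernel is bounded by its maximum.\<close>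
  have square: "(1 - r) * (cmod (F r))\<^sup>2 \<le> integral {0..1} (\<lambda>t. (cmod (F (\<gamma> t)))\<^sup>2)"
    if F: "F holomorphic_on ball 0 R" and r: "0 \<le> r" "r < 1" for F and r :: real
  proof -
    have F2: "(\<lambda>u. F u ^ 2) holomorphic_on ball 0 R"
      by (intro holomorphic_intros F)
    have ne: "\<gamma> t \<noteq> of_real r" for t
      using \<gamma>[of t] r by auto
    have "(F r)\<^sup>2 = integral {0..1} (\<lambda>t. (F (\<gamma> t))\<^sup>2 * (\<gamma> t / (\<gamma> t - of_real r)))"
      using Cauchy_circle_mean[OF F2 R, of "of_real r"] r unfolding mean by simp
    also have "cmod \<dots> \<le> integral {0..1} (\<lambda>t. (cmod (F (\<gamma> t)))\<^sup>2 * (1 / (1 - r)))"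
    proof (rule integral_norm_bound_integral)
      show "(\<lambda>t. (F (\<gamma> t))\<^sup>2 * (\<gamma> t / (\<gamma> t - of_real r))) integrable_on {0..1}"
        by (intro integrable_continuous_interval continuous_on_mult continuous_on_power
            continuous_on_divide continuous_on_diff continuous_on_const cont F cont_\<gamma>) (simp add: ne)
      show "(\<lambda>t. (cmod (F (\<gamma> t)))\<^sup>2 * (1 / (1 - r))) integrable_on {0..1}"
        by (rule integrable_continuous_interval) (intro continuous_intros cont F)
      fix t :: real
      have "1 - r \<le> cmod (\<gamma> t - of_real r)"
        using norm_triangle_ineq2[of "\<gamma> t" "of_real r"] r by (simp add: \<gamma>)
      then have "1 / cmod (\<gamma> t - of_real r) \<le> 1 / (1 - r)"
        using r by (intro divide_left_mono mult_pos_pos) (auto simp: ne)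
      then show "cmod ((F (\<gamma> t))\<^sup>2 * (\<gamma> t / (\<gamma> t - of_real r))) \<le> (cmod (F (\<gamma> t)))\<^sup>2 * (1 / (1 - r))"
        unfolding norm_mult norm_divide norm_power \<gamma> by (intro mult_left_mono) auto
    qed
    also have "\<dots> = integral {0..1} (\<lambda>t. (cmod (F (\<gamma> t)))\<^sup>2) * (1 / (1 - r))"
      by (rule integral_mult_left)
    finally show ?thesis
      using r by (simp add: norm_power field_simps)
  qed
  define d where "d = (\<lambda>u. h u - h 0)"
  have d: "d holomorphic_on ball 0 R"
    unfolding d_def by (intro holomorphic_intros h)
  \<comment> \<open>The cross term of \<open>\<bar>h\<bar>\<^sup>2 = \<bar>h 0\<bar>\<^sup>2 + 2 Re (cnj (h 0) d) + \<bar>d\<bar>\<^sup>2\<close> has mean 0.\<close>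
  have "integral {0..1} (\<lambda>t. d (\<gamma> t)) = 0"
  proof -
    have "\<gamma> t \<noteq> 0" for t
      by (simp add: \<gamma>_def)
    then show ?thesis
      using Cauchy_circle_mean[OF d R, of 0] unfolding mean by (simp add: d_def)
  qed
  then have "integral {0..1} (\<lambda>t. cnj (h 0) * d (\<gamma> t)) = 0"
    by simp
  then have "((\<lambda>t. cnj (h 0) * d (\<gamma> t)) has_integral 0) {0..1}"
    by (metis has_integral_integral integrable_continuous_interval continuous_on_mult_left cont[OF d])
  from has_integral_linear[OF this bounded_linear_Re]
  have cross: "((\<lambda>t. Re (cnj (h 0) * d (\<gamma> t))) has_integral 0) {0..1}"
    by (simp add: o_def)
  have intd: "((\<lambda>t. (cmod (d (\<gamma> t)))\<^sup>2) has_integral integral {0..1} (\<lambda>t. (cmod (d (\<gamma> t)))\<^sup>2)) {0..1}"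
    by (rule integrable_integral, rule integrable_continuous_interval) (intro continuous_intros cont d)
  have intk: "((\<lambda>t. (cmod (k (\<gamma> t)))\<^sup>2) has_integral integral {0..1} (\<lambda>t. (cmod (k (\<gamma> t)))\<^sup>2)) {0..1}"
    by (rule integrable_integral, rule integrable_continuous_interval) (intro continuous_intros cont k)
  have const: "((\<lambda>t::real. c) has_integral c) {0..1}" for c :: real
    using has_integral_const_real[of c 0 1] by simp
  have "(cmod (h 0))\<^sup>2 + 2 * 0 + integral {0..1} (\<lambda>t. (cmod (d (\<gamma> t)))\<^sup>2)
      + K * integral {0..1} (\<lambda>t. (cmod (k (\<gamma> t)))\<^sup>2) \<le> B"
  proof (rule has_integral_le[OF _ const])
    show "((\<lambda>t. (cmod (h 0))\<^sup>2 + 2 * Re (cnj (h 0) * d (\<gamma> t)) + (cmod (d (\<gamma> t)))\<^sup>2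
        + K * (cmod (k (\<gamma> t)))\<^sup>2) has_integral
        (cmod (h 0))\<^sup>2 + 2 * 0 + integral {0..1} (\<lambda>t. (cmod (d (\<gamma> t)))\<^sup>2)
        + K * integral {0..1} (\<lambda>t. (cmod (k (\<gamma> t)))\<^sup>2)) {0..1}"
      by (intro has_integral_add has_integral_mult_right const cross intd intk)
    fix t :: real
    have "(cmod (h 0))\<^sup>2 + 2 * Re (cnj (h 0) * d (\<gamma> t)) + (cmod (d (\<gamma> t)))\<^sup>2 = (cmod (h (\<gamma> t)))\<^sup>2"
      unfolding d_def cmod_power2 by (simp add: power2_eq_square algebra_simps)
    then show "(cmod (h 0))\<^sup>2 + 2 * Re (cnj (h 0) * d (\<gamma> t)) + (cmod (d (\<gamma> t)))\<^sup>2
        + K * (cmod (k (\<gamma> t)))\<^sup>2 \<le> B"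
      using B[OF \<gamma>, of t] by simp
  qed
  moreover have "(1 - s) * (cmod (h s - h 0))\<^sup>2 \<le> integral {0..1} (\<lambda>t. (cmod (d (\<gamma> t)))\<^sup>2)"
    using square[OF d s] by (simp add: d_def)
  moreover have "K * (cmod (k 0))\<^sup>2 \<le> K * integral {0..1} (\<lambda>t. (cmod (k (\<gamma> t)))\<^sup>2)"
    using square[OF k, of 0] K by (intro mult_left_mono) auto
  ultimately show ?thesis
    by simp
qed


section \<open>Complex differentiable maps between normed spaces\<close>

lemma cholomorphic_on_subset: "f cholomorphic_on S \<Longrightarrow> T \<subseteq> S \<Longrightarrow> f cholomorphic_on T"
  by (auto simp: cholomorphic_on_def)

lemma cholomorphic_on_continuous_at:
  "f cholomorphic_on S \<Longrightarrow> x \<in> S \<Longrightarrow> isCont f x"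
  unfolding cholomorphic_on_def by (auto dest!: bspec has_derivative_continuous)

lemma cholomorphic_on_transform:
  assumes f: "f cholomorphic_on S" and S: "open S" and eq: "\<And>x. x \<in> S \<Longrightarrow> f x = g x"
  shows "g cholomorphic_on S"
  unfolding cholomorphic_on_def
proof
  fix x assume x: "x \<in> S"
  then obtain D where "clinear D" "(f has_derivative D) (at x)"
    using f by (auto simp: cholomorphic_on_def)
  then show "\<exists>D. clinear D \<and> (g has_derivative D) (at x)"
    by (intro exI[of _ D] conjI has_derivative_transform_within_open[OF _ S x eq])
qed

lemma cholomorphic_on_compose:
  assumes g: "g cholomorphic_on T" and f: "f cholomorphic_on S" and ST: "f ` S \<subseteq> T"
  shows "(\<lambda>x. g (f x)) cholomorphic_on S"
  unfolding cholomorphic_on_def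
proof
  fix x assume x: "x \<in> S"
  then obtain D E where "clinear D" "(f has_derivative D) (at x)" "clinear E" "(g has_derivative E) (at (f x))"
    using f g ST unfolding cholomorphic_on_def by blast
  then show "\<exists>D. clinear D \<and> ((\<lambda>x. g (f x)) has_derivative D) (at x)"
    by (intro exI[of _ "\<lambda>v. E (D v)"] conjI has_derivative_compose[of f D x UNIV g E])
      (auto simp: clinear_def)
qed

lemma cholomorphic_on_const: "(\<lambda>_. c) cholomorphic_on S"
  unfolding cholomorphic_on_def
  by (intro ballI exI[of _ "\<lambda>_. 0"] conjI has_derivative_const) (simp add: clinear_def)

lemma cholomorphic_on_bounded_clinear:
  assumes "clinear L" "bounded_linear L" shows "L cholomorphic_on S"
  unfolding cholomorphic_on_def using assms bounded_linear_imp_has_derivative by blast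

lemma cholomorphic_on_add:
  assumes "f cholomorphic_on S" "g cholomorphic_on S"
  shows "(\<lambda>x. f x + g x) cholomorphic_on S"
  unfolding cholomorphic_on_def
proof
  fix x assume "x \<in> S"
  then obtain D E where "clinear D" "(f has_derivative D) (at x)" "clinear E" "(g has_derivative E) (at x)"
    using assms unfolding cholomorphic_on_def by blast
  then show "\<exists>D. clinear D \<and> ((\<lambda>x. f x + g x) has_derivative D) (at x)"
    by (intro exI[of _ "\<lambda>v. D v + E v"])
      (auto simp: clinear_def scaleC_add_right intro!: has_derivative_add)
qed

lemma cholomorphic_on_scaleC:
  assumes "f cholomorphic_on S" shows "(\<lambda>x. c *\<^sub>C f x) cholomorphic_on S"
  by (rule cholomorphic_on_compose[OF cholomorphic_on_bounded_clinear assms subset_UNIV])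
    (auto simp: clinear_def scaleC_add_right scaleC_scaleC mult.commute bounded_linear_scaleC_right)

lemma cholomorphic_on_mult:
  fixes f g :: "'a::complex_normed_vector \<Rightarrow> complex"
  assumes "f cholomorphic_on S" "g cholomorphic_on S"
  shows "(\<lambda>x. f x * g x) cholomorphic_on S"
  unfolding cholomorphic_on_def
proof
  fix x assume "x \<in> S"
  then obtain D E where "clinear D" "(f has_derivative D) (at x)" "clinear E" "(g has_derivative E) (at x)"
    using assms unfolding cholomorphic_on_def by blast
  then show "\<exists>D. clinear D \<and> ((\<lambda>x. f x * g x) has_derivative D) (at x)"
    by (intro exI[of _ "\<lambda>v. f x * E v + D v * g x"])
      (auto simp: clinear_def scaleC_complex_def algebra_simps intro!: derivative_eq_intros)
qed

lemma cholomorphic_on_diff: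
  fixes f g :: "'a::complex_normed_vector \<Rightarrow> complex"
  assumes "f cholomorphic_on S" "g cholomorphic_on S"
  shows "(\<lambda>x. f x - g x) cholomorphic_on S"
  using cholomorphic_on_add[OF assms(1) cholomorphic_on_scaleC[OF assms(2), of "-1"]]
  by (simp add: scaleC_complex_def)

lemma clinear_complex: "clinear D \<Longrightarrow> D = (\<lambda>t::complex. t *\<^sub>C D 1)"
  unfolding clinear_def scaleC_complex_def by (metis mult.right_neutral)

lemma cholomorphic_on_iff_holomorphic_on:
  fixes f :: "complex \<Rightarrow> complex"
  assumes "open S"
  shows "f cholomorphic_on S \<longleftrightarrow> f holomorphic_on S"
proof
  assume f: "f cholomorphic_on S"
  have "f field_differentiable at x" if "x \<in> S" for x
  proof -
    obtain D where D: "clinear D" "(f has_derivative D) (at x)"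
      using f \<open>x \<in> S\<close> by (auto simp: cholomorphic_on_def)
    have "D = (*) (D 1)"
      by (subst clinear_complex[OF D(1)]) (simp add: scaleC_complex_def mult.commute fun_eq_iff)
    with D(2) have "(f has_field_derivative D 1) (at x)"
      unfolding has_field_derivative_def by metis
    then show ?thesis
      by (auto simp: field_differentiable_def)
  qed
  then show "f holomorphic_on S"
    by (auto simp: holomorphic_on_def field_differentiable_at_within)
next
  assume f: "f holomorphic_on S"
  show "f cholomorphic_on S"
    unfolding cholomorphic_on_def
  proof
    fix x assume "x \<in> S"
    then have "f field_differentiable at x"
      using f assms holomorphic_on_imp_differentiable_at by blast
    then obtain c where "(f has_derivative (*) c) (at x)"
      by (auto simp: field_differentiable_def has_field_derivative_def)
    then show "\<exists>D. clinear D \<and> (f has_derivative D) (at x)"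
      by (intro exI[of _ "(*) c"]) (auto simp: clinear_def scaleC_complex_def algebra_simps)
  qed
qed

lemma clinear_scaleC_left: "clinear (\<lambda>t::complex. t *\<^sub>C v)"
  by (auto simp: clinear_def scaleC_complex_def scaleC_add_left scaleC_scaleC)

lemma bounded_linear_scaleC_left: "bounded_linear (\<lambda>t::complex. t *\<^sub>C v)"
proof
  show "(r *\<^sub>R t) *\<^sub>C v = r *\<^sub>R (t *\<^sub>C v)" for r t
    by (metis scaleC_of_real scaleC_scaleC scaleR_conv_of_real)
  show "\<exists>K. \<forall>t. norm (t *\<^sub>C v) \<le> norm t * K"
    by (auto simp: norm_scaleC)
qed (rule scaleC_add_left)

lemma cholomorphic_on_line: "(\<lambda>t. x + t *\<^sub>C v) cholomorphic_on S"
  by (intro cholomorphic_on_add cholomorphic_on_const cholomorphic_on_bounded_clinear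
      clinear_scaleC_left bounded_linear_scaleC_left)

lemma scaleC_0_left: "0 *\<^sub>C (v::'a::complex_normed_vector) = 0"
  using scaleC_of_real[of 0 v] by simp

lemma scaleC_1_left: "1 *\<^sub>C (v::'a::complex_normed_vector) = v"
  using scaleC_of_real[of 1 v] by simp

text \<open>The second-order remainder is bounded in terms of the bound of the function only.  This
  uniformity is what allows derivatives to be passed to pointwise limits.\<close>

lemma bounded_cholomorphic_estimates:
  fixes f :: "'a::complex_normed_vector \<Rightarrow> complex"
  assumes f: "f cholomorphic_on ball x r" and M: "\<And>y. y \<in> ball x r \<Longrightarrow> cmod (f y) \<le> M" and r: "0 < r"
  shows bounded_cholomorphic_increment: "norm v < r \<Longrightarrow> cmod (f (x + v) - f x) \<le> 2 * M * norm v / r"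
    and bounded_cholomorphic_derivative:
      "clinear D \<Longrightarrow> (f has_derivative D) (at x) \<Longrightarrow> cmod (D v) \<le> 2 * M / r * norm v"
    and bounded_cholomorphic_remainder:
      "clinear D \<Longrightarrow> (f has_derivative D) (at x) \<Longrightarrow> norm v < r \<Longrightarrow>
        cmod (f (x + v) - f x - D v) \<le> 4 * M * (norm v)\<^sup>2 / r\<^sup>2"
proof -
  define \<phi> where "\<phi> = (\<lambda>t. f (x + t *\<^sub>C v))"
  define R where "R = r / norm v"
  have inb: "x + t *\<^sub>C v \<in> ball x r" if "cmod t < R" "v \<noteq> 0" for t
    using that by (simp add: dist_norm norm_scaleC R_def field_simps)
  have hol: "\<phi> holomorphic_on ball 0 R" if "v \<noteq> 0"
    unfolding \<phi>_def using inb[OF _ that]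
    by (subst cholomorphic_on_iff_holomorphic_on[symmetric])
      (auto intro!: cholomorphic_on_compose[OF f cholomorphic_on_line])
  have M': "cmod (\<phi> t) \<le> M" if "cmod t < R" "v \<noteq> 0" for t
    unfolding \<phi>_def by (rule M[OF inb[OF that]])
  have deriv: "(\<phi> has_field_derivative D v) (at 0)" if D: "clinear D" "(f has_derivative D) (at x)" for D
  proof -
    have "((\<lambda>t. x + t *\<^sub>C v) has_derivative (\<lambda>t. t *\<^sub>C v)) (at 0)"
      by (auto intro!: derivative_eq_intros bounded_linear_imp_has_derivative[OF bounded_linear_scaleC_left])
    then have "(\<phi> has_derivative (\<lambda>t. D (t *\<^sub>C v))) (at 0)"
      unfolding \<phi>_def by (rule has_derivative_compose) (use D in \<open>simp add: scaleC_0_left\<close>)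
    moreover have "(\<lambda>t. D (t *\<^sub>C v)) = (*) (D v)"
      using D(1) by (simp add: clinear_def scaleC_complex_def fun_eq_iff)
    ultimately show ?thesis
      by (simp add: has_field_derivative_def)
  qed
  have M0: "0 \<le> M"
    using M[of x] r order_trans[OF norm_ge_zero] by auto
  define h where "h = (\<lambda>t. \<phi> t - \<phi> 0)"
  have h: "h holomorphic_on ball 0 R" "h 0 = 0" "\<And>t. cmod t < R \<Longrightarrow> cmod (h t) \<le> 2 * M" if "v \<noteq> 0"
  proof -
    show "h holomorphic_on ball 0 R"
      unfolding h_def by (intro holomorphic_intros hol that)
    fix t assume t: "cmod t < R"
    then have "cmod 0 < R"
      using norm_ge_zero[of t] by (simp del: norm_ge_zero)
    then show "cmod (h t) \<le> 2 * M"
      using M'[OF t that] M'[OF _ that, of 0] norm_triangle_ineq4[of "\<phi> t" "\<phi> 0"] unfolding h_def by linarith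
  qed (simp add: h_def)
  show "cmod (f (x + v) - f x) \<le> 2 * M * norm v / r" if v: "norm v < r"
  proof (cases "v = 0")
    case False
    then have "cmod 1 < R"
      using v by (simp add: R_def)
    from Schwarz_scaled(1)[OF h(1,2,3)[OF False] this] show ?thesis
      by (simp add: h_def \<phi>_def R_def scaleC_0_left scaleC_1_left)
  qed simp
  show "cmod (D v) \<le> 2 * M / r * norm v" if D: "clinear D" "(f has_derivative D) (at x)"
  proof (cases "v = 0")
    case True
    then show ?thesis
      using has_derivative_bounded_linear[OF D(2)] by (simp add: linear_simps)
  next
    case False
    have "cmod 0 < R"
      using False r by (simp add: R_def)
    from Schwarz_scaled(2)[OF h(1,2,3)[OF False] this]
    have "cmod (deriv h 0) \<le> 2 * M / R" .
    moreover have "deriv h 0 = D v"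
      unfolding h_def by (rule DERIV_imp_deriv) (auto intro!: derivative_eq_intros deriv D)
    ultimately show ?thesis
      by (simp add: R_def)
  qed
  show "cmod (f (x + v) - f x - D v) \<le> 4 * M * (norm v)\<^sup>2 / r\<^sup>2"
    if D: "clinear D" "(f has_derivative D) (at x)" and v: "norm v < r"
  proof (cases "v = 0")
    case True
    then show ?thesis
      using has_derivative_bounded_linear[OF D(2)] by (simp add: linear_simps)
  next
    case False
    then have "cmod 1 < R"
      using v by (simp add: R_def)
    from first_order_remainder_le[OF hol[OF False] M'[OF _ False] this] show ?thesis
      using DERIV_imp_deriv[OF deriv[OF D]]
      by (simp add: \<phi>_def R_def scaleC_0_left scaleC_1_left power_divide)
  qed
qed

section \<open>Limits along ultrafilters\<close>

lemma ultrafilter_convergent_in_compact: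
  fixes s :: "'i \<Rightarrow> 'a::topological_space"
  assumes U: "ultrafilter U" and K: "compact K" and s: "eventually (\<lambda>i. s i \<in> K) U"
  shows "\<exists>l\<in>K. (s \<longlongrightarrow> l) U"
proof (rule ccontr)
  assume "\<not> ?thesis"
  then have nbhd: "\<exists>V. open V \<and> l \<in> V \<and> \<not> eventually (\<lambda>i. s i \<in> V) U" if "l \<in> K" for l
    using that by (auto simp: tendsto_def)
  have "l \<in> \<Union>{V. open V \<and> eventually (\<lambda>i. s i \<notin> V) U}" if l: "l \<in> K" for l
  proof -
    obtain V where "open V" "l \<in> V" "\<not> eventually (\<lambda>i. s i \<in> V) U"
      using nbhd[OF l] by (elim exE conjE)
    then show ?thesis
      using ultrafilter_not[OF U, of "\<lambda>i. s i \<in> V"] by (intro UnionI[of V]) simp_all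
  qed
  then have cover: "K \<subseteq> \<Union>{V. open V \<and> eventually (\<lambda>i. s i \<notin> V) U}"
    by (rule subsetI)
  have opn: "open V" if "V \<in> {V. open V \<and> eventually (\<lambda>i. s i \<notin> V) U}" for V
    using that by simp
  obtain C where C: "C \<subseteq> {V. open V \<and> eventually (\<lambda>i. s i \<notin> V) U}" "finite C" "K \<subseteq> \<Union>C"
    by (rule compactE[OF K cover opn])
  have "eventually (\<lambda>i. \<forall>V\<in>C. s i \<notin> V) U"
    using C(1) by (intro eventually_ball_finite C) auto
  with s have "eventually (\<lambda>i. False) U"
    by eventually_elim (use C in auto)
  with U show False
    by (simp add: ultrafilter_def)
qed

lemma ultrafilter_bounded_tendsto:
  fixes s :: "'i \<Rightarrow> complex"
  assumes U: "ultrafilter U" and s: "eventually (\<lambda>i. cmod (s i) \<le> B) U"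
  shows "(s \<longlongrightarrow> Lim U s) U" and "cmod (Lim U s) \<le> B"
proof -
  have "eventually (\<lambda>i. s i \<in> cball 0 B) U"
    using s by simp
  from ultrafilter_convergent_in_compact[OF U compact_cball this]
  obtain l where l: "cmod l \<le> B" "(s \<longlongrightarrow> l) U"
    by auto
  moreover have "Lim U s = l"
    using U l(2) by (intro tendsto_Lim) (auto simp: ultrafilter_def)
  ultimately show "(s \<longlongrightarrow> Lim U s) U" "cmod (Lim U s) \<le> B"
    by simp_all
qed

text \<open>Passing to an ultrafilter makes the derivatives converge as well, and the uniform
  remainder bound survives in the limit.\<close>

lemma cholomorphic_on_pointwise_limit:
  fixes f :: "'i \<Rightarrow> 'a::complex_normed_vector \<Rightarrow> complex"
  assumes F: "F \<noteq> bot" and S: "open S" and hol: "\<forall>\<^sub>F i in F. f i cholomorphic_on S"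
    and M: "\<forall>\<^sub>F i in F. \<forall>x\<in>S. cmod (f i x) \<le> M"
    and lim: "\<And>x. x \<in> S \<Longrightarrow> ((\<lambda>i. f i x) \<longlongrightarrow> g x) F"
  shows "g cholomorphic_on S"
  unfolding cholomorphic_on_def
proof
  fix x assume x: "x \<in> S"
  obtain U where UF: "U \<le> F" and U: "ultrafilter U"
    using ex_ultrafilter_le[OF F] by blast
  have Ubot: "U \<noteq> bot"
    using U by (simp add: ultrafilter_def)
  obtain r where r: "0 < r" "ball x r \<subseteq> S"
    using S x open_contains_ball by blast
  define D where "D i = (SOME D. clinear D \<and> (f i has_derivative D) (at x))" for i
  have ev: "\<forall>\<^sub>F i in U. f i cholomorphic_on S \<and> (\<forall>x\<in>S. cmod (f i x) \<le> M)"
    using hol M UF by (intro filter_leD[OF UF] eventually_conj)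
  have evD: "\<forall>\<^sub>F i in U. clinear (D i) \<and> (\<forall>v. cmod (D i v) \<le> 2 * M / r * norm v) \<and>
      (\<forall>v. norm v < r \<longrightarrow> cmod (f i (x + v) - f i x - D i v) \<le> 4 * M * (norm v)\<^sup>2 / r\<^sup>2)"
    using ev
  proof eventually_elim
    case (elim i)
    have "\<exists>D. clinear D \<and> (f i has_derivative D) (at x)"
      using elim x by (simp add: cholomorphic_on_def)
    then have "clinear (D i) \<and> (f i has_derivative D i) (at x)"
      unfolding D_def by (rule someI_ex)
    then have Di: "clinear (D i)" "(f i has_derivative D i) (at x)"
      by simp_all
    have fi: "f i cholomorphic_on ball x r" "\<And>y. y \<in> ball x r \<Longrightarrow> cmod (f i y) \<le> M"
      using elim r cholomorphic_on_subset by blast+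
    show ?case
      using Di bounded_cholomorphic_derivative[OF fi r(1) Di] bounded_cholomorphic_remainder[OF fi r(1) Di]
      by simp
  qed
  define E where "E v = Lim U (\<lambda>i. D i v)" for v
  have bdd: "\<forall>\<^sub>F i in U. cmod (D i v) \<le> 2 * M / r * norm v" for v
    using evD by eventually_elim simp
  note E = ultrafilter_bounded_tendsto[OF U bdd, folded E_def]
  have fU: "((\<lambda>i. f i y) \<longlongrightarrow> g y) U" if "y \<in> S" for y
    using tendsto_mono[OF UF lim[OF that]] .
  have add: "E (v + w) = E v + E w" for v w
  proof (rule tendsto_unique[OF Ubot E(1)])
    show "((\<lambda>i. D i (v + w)) \<longlongrightarrow> E v + E w) U"
      by (rule Lim_transform_eventually[OF tendsto_add[OF E(1) E(1)]])
        (use evD in eventually_elim, simp add: clinear_def)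
  qed
  have scale: "E (c *\<^sub>C v) = c *\<^sub>C E v" for c v
  proof (rule tendsto_unique[OF Ubot E(1)])
    show "((\<lambda>i. D i (c *\<^sub>C v)) \<longlongrightarrow> c *\<^sub>C E v) U"
      unfolding scaleC_complex_def
      by (rule Lim_transform_eventually[OF tendsto_mult_left[OF E(1)]])
        (use evD in eventually_elim, simp add: clinear_def scaleC_complex_def)
  qed
  have blE: "bounded_linear E"
  proof (rule bounded_linear_intro)
    show "E (r *\<^sub>R v) = r *\<^sub>R E v" for r v
      by (metis scale scaleC_of_real)
    show "norm (E v) \<le> norm v * (2 * M / r)" for v
      using E(2)[of v] by (simp add: mult.commute)
  qed (rule add)
  have rem: "cmod (g (x + v) - g x - E v) \<le> 4 * M * (norm v)\<^sup>2 / r\<^sup>2" if v: "norm v < r" for v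
  proof (rule tendsto_le[OF Ubot tendsto_const])
    have "x + v \<in> S"
      using v r(2) by (auto simp: dist_norm)
    then show "((\<lambda>i. cmod (f i (x + v) - f i x - D i v)) \<longlongrightarrow> cmod (g (x + v) - g x - E v)) U"
      using x by (intro tendsto_intros fU E)
    show "\<forall>\<^sub>F i in U. cmod (f i (x + v) - f i x - D i v) \<le> 4 * M * (norm v)\<^sup>2 / r\<^sup>2"
      using evD by eventually_elim (use v in simp)
  qed
  have "(g has_derivative E) (at x)"
    unfolding has_derivative_at
  proof (intro conjI blE)
    have "((\<lambda>h::'a. 4 * M / r\<^sup>2 * norm h) \<longlongrightarrow> 4 * M / r\<^sup>2 * norm (0::'a)) (at 0)"
      by (intro tendsto_mult tendsto_const tendsto_norm[OF tendsto_ident_at])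
    then have lim0: "((\<lambda>h::'a. 4 * M / r\<^sup>2 * norm h) \<longlongrightarrow> 0) (at 0)"
      by simp
    show "(\<lambda>h. norm (g (x + h) - g x - E h) / norm h) \<midarrow>0\<rightarrow> 0"
    proof (rule tendsto_sandwich[OF _ _ tendsto_const lim0])
      have "\<forall>\<^sub>F h::'a in at 0. norm h < r \<and> h \<noteq> 0"
        using r(1) by (auto simp: eventually_at dist_norm)
      then show "\<forall>\<^sub>F h in at 0. norm (g (x + h) - g x - E h) / norm h \<le> 4 * M / r\<^sup>2 * norm h"
      proof eventually_elim
        case (elim h)
        then have "norm (g (x + h) - g x - E h) / norm h \<le> (4 * M * (norm h)\<^sup>2 / r\<^sup>2) / norm h"
          by (intro divide_right_mono rem) auto
        also have "\<dots> = 4 * M / r\<^sup>2 * norm h"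
          using elim by (simp add: power2_eq_square)
        finally show ?case .
      qed
    qed simp
  qed
  moreover have "clinear E"
    using add scale by (simp add: clinear_def)
  ultimately show "\<exists>D. clinear D \<and> (g has_derivative D) (at x)"
    by blast
qed


section \<open>Coordinates in \<open>c\<^sub>0\<close> and \<open>\<ell>\<^sub>\<infinity>\<close>\<close>

lemma c0_eqI: "(\<And>i. c0_nth x i = c0_nth y i) \<Longrightarrow> x = y"
  unfolding c0_nth_def by (intro linf_of_c0_inject[THEN iffD1] bcontfun_eqI) simp

lemma c0_nth_simps [simp]:
  "c0_nth 0 i = 0" "c0_nth (x + y) i = c0_nth x i + c0_nth y i"
  "c0_nth (x - y) i = c0_nth x i - c0_nth y i" "c0_nth (c *\<^sub>C x) i = c * c0_nth x i"
  by (simp_all add: c0_nth_def zero_c0.rep_eq plus_c0.rep_eq minus_c0.rep_eq scaleC_c0.rep_eq scaleC_complex_def)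

lemma norm_c0_nth_le: "cmod (c0_nth x i) \<le> norm x"
  by (simp add: c0_nth_def norm_c0.rep_eq norm_bounded)

lemma norm_c0_le: "(\<And>i. cmod (c0_nth x i) \<le> b) \<Longrightarrow> norm x \<le> b"
  by (simp add: c0_nth_def norm_c0.rep_eq norm_bound)

definition fin_supp :: "nat \<Rightarrow> c0 \<Rightarrow> bool"
  where "fin_supp n x \<longleftrightarrow> (\<forall>i\<ge>n. c0_nth x i = 0)"

definition tail_supp :: "nat \<Rightarrow> c0 \<Rightarrow> bool"
  where "tail_supp n x \<longleftrightarrow> (\<forall>i<n. c0_nth x i = 0)"

lemma norm_add_disjoint_supp:
  assumes "fin_supp n p" "tail_supp n d" "norm p \<le> b" "norm d \<le> b"
  shows "norm (p + d) \<le> b"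
proof (rule norm_c0_le)
  fix i
  show "cmod (c0_nth (p + d) i) \<le> b"
  proof (cases "i < n")
    case True
    then show ?thesis
      using assms norm_c0_nth_le[of p i] by (simp add: tail_supp_def)
  next
    case False
    then show ?thesis
      using assms norm_c0_nth_le[of d i] by (simp add: fin_supp_def)
  qed
qed

lemma fin_supp_mono: "fin_supp m x \<Longrightarrow> m \<le> n \<Longrightarrow> fin_supp n x"
  by (auto simp: fin_supp_def)

lemma tail_supp_mono: "tail_supp n x \<Longrightarrow> m \<le> n \<Longrightarrow> tail_supp m x"
  by (auto simp: tail_supp_def)

lemma fin_supp_add: "fin_supp n x \<Longrightarrow> fin_supp n y \<Longrightarrow> fin_supp n (x + y)"
  by (auto simp: fin_supp_def)

lemma fin_supp_scaleC: "fin_supp n x \<Longrightarrow> fin_supp n (c *\<^sub>C x)"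
  by (auto simp: fin_supp_def)

lemma tail_supp_scaleC: "tail_supp n x \<Longrightarrow> tail_supp n (c *\<^sub>C x)"
  by (auto simp: tail_supp_def)

text \<open>One finite rearrangement map covers truncation, shifting a block of coordinates to another
  position, and reading a shifted block back.\<close>

definition rearrange :: "nat set \<Rightarrow> (nat \<Rightarrow> nat) \<Rightarrow> linf \<Rightarrow> c0"
  where "rearrange I r w = Abs_c0 (Bcontfun (\<lambda>i. if i \<in> I then apply_bcontfun w (r i) else 0))"

lemma c0_nth_rearrange:
  assumes "finite I"
  shows "c0_nth (rearrange I r w) i = (if i \<in> I then apply_bcontfun w (r i) else 0)"
proof -
  let ?s = "\<lambda>i. if i \<in> I then apply_bcontfun w (r i) else 0"
  have "norm (?s i) \<le> norm w" for i
    by (simp add: norm_bounded)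
  then have "?s \<in> bcontfun"
    by (auto intro!: bcontfun_normI)
  then have s: "apply_bcontfun (Bcontfun ?s) = ?s"
    by (rule Bcontfun_inverse)
  have "\<forall>\<^sub>F i in sequentially. ?s i = 0"
    using eventually_gt_at_top[of "Max (insert 0 I)"]
  proof eventually_elim
    case (elim i)
    then show ?case
      using assms by auto
  qed
  then have "?s \<longlonglongrightarrow> 0"
    by (rule tendsto_eventually)
  then have "linf_of_c0 (rearrange I r w) = Bcontfun ?s"
    unfolding rearrange_def by (intro Abs_c0_inverse) (simp add: s)
  then show ?thesis
    by (simp add: c0_nth_def s)
qed

lemma truncate_eq_rearrange: "truncate n w = rearrange {..<n} (\<lambda>i. i) w"
  by (rule c0_eqI) (simp add: c0_nth_truncate c0_nth_rearrange)

lemma clinear_rearrange: "finite I \<Longrightarrow> clinear (rearrange I r)"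
  unfolding clinear_def by (auto intro!: c0_eqI simp: c0_nth_rearrange scaleC_complex_def)

lemma norm_rearrange_le: "finite I \<Longrightarrow> norm (rearrange I r w) \<le> norm w"
  by (rule norm_c0_le) (simp add: c0_nth_rearrange norm_bounded)

lemma bounded_linear_clinear:
  fixes L :: "'a::complex_normed_vector \<Rightarrow> 'b::complex_normed_vector"
  assumes "clinear L" and "\<And>x. norm (L x) \<le> K * norm x"
  shows "bounded_linear L"
proof (rule bounded_linear_intro)
  show "L (r *\<^sub>R x) = r *\<^sub>R L x" for r x
    using assms(1) by (metis clinear_def scaleC_of_real)
  show "norm (L x) \<le> norm x * K" for x
    using assms(2) by (simp add: mult.commute)
qed (use assms(1) in \<open>simp add: clinear_def\<close>)

lemma cholomorphic_on_rearrange: "finite I \<Longrightarrow> rearrange I r cholomorphic_on S"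
  by (rule cholomorphic_on_bounded_clinear[OF clinear_rearrange bounded_linear_clinear[OF clinear_rearrange, of _ _ 1]])
    (simp_all add: norm_rearrange_le)

lemma cholomorphic_on_truncate: "truncate n cholomorphic_on S"
  using cholomorphic_on_rearrange[of "{..<n}" "\<lambda>i. i"] by (simp add: truncate_eq_rearrange[abs_def])

lemma norm_truncate_le: "norm (truncate n w) \<le> norm w"
  by (simp add: truncate_eq_rearrange norm_rearrange_le)

lemma cholomorphic_on_linf_of_c0: "linf_of_c0 cholomorphic_on S"
  by (rule cholomorphic_on_bounded_clinear[OF _ bounded_linear_clinear[of _ 1]])
    (simp_all add: clinear_def plus_c0.rep_eq scaleC_c0.rep_eq norm_c0.rep_eq)

lemma cholomorphic_on_c0_nth: "(\<lambda>x. c0_nth x i) cholomorphic_on S"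
  by (rule cholomorphic_on_bounded_clinear[OF _ bounded_linear_clinear[of _ 1]])
    (simp_all add: clinear_def scaleC_complex_def norm_c0_nth_le)

definition unit_c0 :: "nat \<Rightarrow> c0"
  where "unit_c0 n = rearrange {n} (\<lambda>i. i) (const_bcontfun 1)"

lemma c0_nth_unit [simp]: "c0_nth (unit_c0 n) i = (if i = n then 1 else 0)"
  by (simp add: unit_c0_def c0_nth_rearrange)

section \<open>Elements of \<open>\<H>\<^sup>\<infinity>\<close>\<close>

text \<open>The extension by 0 outside the ball is the normal form of the type \<open>hinf\<close>.\<close>

definition to_hinf :: "('a::complex_normed_vector \<Rightarrow> 'b::complex_normed_vector) \<Rightarrow> ('a, 'b) hinf"
  where "to_hinf f = Abs_hinf (\<lambda>x. if x \<in> ball 0 1 then f x else 0)"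

lemma hinf_apply_to_hinf:
  assumes f: "f cholomorphic_on ball 0 1" and B: "\<And>x. x \<in> ball 0 1 \<Longrightarrow> norm (f x) \<le> B"
    and x: "x \<in> ball 0 1"
  shows "hinf_apply (to_hinf f) x = f x"
proof -
  have "(\<lambda>x. if x \<in> ball 0 1 then f x else 0) cholomorphic_on ball 0 1"
    by (rule cholomorphic_on_transform[OF f]) auto
  moreover have "bounded ((\<lambda>x. if x \<in> ball 0 1 then f x else 0) ` ball 0 1)"
    using B unfolding bounded_iff by (intro exI[of _ B]) (auto simp del: mem_ball mem_ball_0)
  ultimately have "(\<lambda>x. if x \<in> ball 0 1 then f x else 0) \<in> hinf_funs"
    by (simp add: hinf_funs_def)
  then show ?thesis
    unfolding to_hinf_def using x by (simp add: Abs_hinf_inverse)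
qed

lemma cholomorphic_on_hinf_apply: "hinf_apply f cholomorphic_on ball 0 1"
  using hinf_apply[of f] by (simp add: hinf_funs_def)

lemmas hinf_apply_simps = plus_hinf.rep_eq scaleC_hinf.rep_eq minus_hinf_apply times_hinf.rep_eq zero_hinf.rep_eq

lemma cholomorphic_on_hinf_eval:
  fixes x :: "'a::complex_normed_vector"
  assumes "x \<in> ball 0 1"
  shows "(\<lambda>h :: ('a, 'b::complex_normed_vector) hinf. hinf_apply h x) cholomorphic_on S"
proof (rule cholomorphic_on_bounded_clinear)
  show *: "clinear (\<lambda>h :: ('a, 'b) hinf. hinf_apply h x)"
    by (simp add: clinear_def hinf_apply_simps)
  show "bounded_linear (\<lambda>h :: ('a, 'b) hinf. hinf_apply h x)"
    by (rule bounded_linear_clinear[OF *, of 1]) (use norm_hinf_apply_le[OF assms] in simp)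
qed

lemma norm_to_hinf_le:
  assumes f: "f cholomorphic_on ball 0 1" and B: "\<And>x. x \<in> ball 0 1 \<Longrightarrow> norm (f x) \<le> B"
  shows "norm (to_hinf f) \<le> B"
  by (rule norm_hinf_le) (simp only: hinf_apply_to_hinf[OF f B] B)


section \<open>Convergence along truncations\<close>

text \<open>Suppose that the increments at \<open>p\<^sub>0\<close> do not tend to 0, and let \<open>f1 p\<close> be the limit of
  \<open>f (p + d i)\<close> along an ultrafilter that keeps them large at \<open>p\<^sub>0\<close>.  Like \<open>f\<close>, the function \<open>f1\<close> is
  bounded and holomorphic in finitely many coordinates.  Consider a finitely supported \<open>p\<close> where
  \<open>V = \<bar>f\<bar>\<^sup>2 + K \<bar>f1 - f\<bar>\<^sup>2\<close> almost attains its supremum.  For large \<open>i\<close> the disc through \<open>p\<close> in the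
  direction \<open>d i\<close> stays in the polydisc, because the supports are disjoint.  As \<open>V\<close> is almost
  maximal at its centre, \<open>f (p + d i)\<close> is close to \<open>f p\<close>; hence \<open>f1 p\<close> is close to \<open>f p\<close>.  But for
  large \<open>K\<close> an almost maximal value of \<open>V\<close> requires a large difference \<open>f1 p - f p\<close>.\<close>

lemma tendsto_far_perturbation:
  fixes f :: "c0 \<Rightarrow> complex"
  assumes f: "f cholomorphic_on ball 0 1" and M: "\<And>x. x \<in> ball 0 1 \<Longrightarrow> cmod (f x) \<le> M"
    and \<sigma>: "0 < \<sigma>" "\<sigma> < 1"
    and d: "\<And>i. tail_supp i (d i)" "\<And>i. \<exists>m. fin_supp m (d i)" "\<And>i. norm (d i) \<le> \<sigma>"
    and p0: "fin_supp n0 p0" "norm p0 \<le> \<sigma>"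
  shows "(\<lambda>i. f (p0 + d i)) \<longlonglongrightarrow> f p0"
proof (rule ccontr)
  assume "\<not> ?thesis"
  then obtain e where e: "0 < e" "\<not> eventually (\<lambda>i. cmod (f (p0 + d i) - f p0) < e) sequentially"
    by (auto simp: tendsto_iff dist_norm)
  define F where "F = inf sequentially (principal {i. e \<le> cmod (f (p0 + d i) - f p0)})"
  have "F \<noteq> bot"
    using e(2) by (simp add: F_def trivial_limit_def eventually_inf_principal not_le)
  then obtain U where U: "U \<le> F" "ultrafilter U"
    using ex_ultrafilter_le by blast
  have Useq: "U \<le> sequentially"
    using U(1) by (simp add: F_def)
  have Ue: "eventually (\<lambda>i. e \<le> cmod (f (p0 + d i) - f p0)) U"
    using U(1) by (simp add: F_def le_principal)
  have Ubot: "U \<noteq> bot"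
    using U(2) by (simp add: ultrafilter_def)
  have M0: "0 \<le> M"
    using M[of 0] norm_ge_zero[of "f 0"] by (auto intro: order_trans simp del: norm_ge_zero)
  define \<rho> where "\<rho> = (1 + \<sigma>) / 2"
  define s where "s = \<sigma> / \<rho>"
  define R where "R = 1 / \<rho>"
  have \<rho>: "\<sigma> < \<rho>" "\<rho> < 1" "0 < \<rho>"
    using \<sigma> by (auto simp: \<rho>_def)
  have s: "0 < s" "s < 1"
    using \<sigma> \<rho> by (auto simp: s_def)
  have R: "1 < R"
    using \<rho> by (simp add: R_def)
  define X where "X = {p. (\<exists>n. fin_supp n p) \<and> norm p \<le> \<rho>}"
  define f1 where "f1 p = Lim U (\<lambda>i. f (p + d i))" for p
  have bdd: "\<forall>\<^sub>F i in U. \<forall>p. fin_supp n p \<and> norm p < 1 \<longrightarrow> p + d i \<in> ball 0 1" for n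
  proof (rule filter_leD[OF Useq], use eventually_ge_at_top[of n] in eventually_elim, intro allI impI)
    fix i p assume i: "n \<le> i" and p: "fin_supp n p \<and> norm p < 1"
    have "norm (p + d i) \<le> max (norm p) \<sigma>"
      using p d(1,3) i by (intro norm_add_disjoint_supp[of n])
        (auto intro: tail_supp_mono simp: le_max_iff_disj)
    also have "\<dots> < 1"
      using p \<sigma> by simp
    finally show "p + d i \<in> ball 0 1"
      by simp
  qed
  have f1: "((\<lambda>i. f (p + d i)) \<longlongrightarrow> f1 p) U" "cmod (f1 p) \<le> M" if "fin_supp n p" "norm p < 1" for p n
  proof -
    have "\<forall>\<^sub>F i in U. cmod (f (p + d i)) \<le> M"
      using bdd[of n] by eventually_elim (use that M in blast)
    from ultrafilter_bounded_tendsto[OF U(2) this]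
    show "((\<lambda>i. f (p + d i)) \<longlongrightarrow> f1 p) U" "cmod (f1 p) \<le> M"
      by (simp_all add: f1_def)
  qed
  \<comment> \<open>With this weight the jump at \<open>p0\<close> contributes \<open>2 * (M\<^sup>2 + 1)\<close> to \<open>V\<close>, more than \<open>\<bar>f\<bar>\<^sup>2\<close> can
    contribute anywhere; \<open>\<delta>\<close> is small enough to preserve the contradiction.\<close>
  define K where "K = 2 * (M\<^sup>2 + 1) / e\<^sup>2"
  have K: "0 < K" "K * e\<^sup>2 = 2 * (M\<^sup>2 + 1)"
    using e by (auto simp: K_def add_nonneg_pos)
  define \<delta> where "\<delta> = 1 / (K / (1 - s) + 1)"
  have \<delta>: "0 < \<delta>" "K * (\<delta> / (1 - s)) + \<delta> = 1"
  proof -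
    have pos: "0 < K / (1 - s) + 1"
      using K s by (intro add_pos_pos divide_pos_pos) auto
    then show "0 < \<delta>"
      by (simp add: \<delta>_def)
    have "K * (\<delta> / (1 - s)) + \<delta> = \<delta> * (K / (1 - s) + 1)"
      by (simp add: algebra_simps)
    then show "K * (\<delta> / (1 - s)) + \<delta> = 1"
      using pos by (simp add: \<delta>_def)
  qed
  define V where "V p = (cmod (f p))\<^sup>2 + K * (cmod (f1 p - f p))\<^sup>2" for p
  have fM: "cmod (f p) \<le> M" if "norm p < 1" for p
    using M that by simp
  have X_ball: "norm p < 1" if "p \<in> X" for p
    using that \<rho> by (simp add: X_def)
  have "V p \<le> M\<^sup>2 + K * (2 * M)\<^sup>2" if p: "p \<in> X" for p
  proof -
    have 1: "cmod (f p) \<le> M"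
      by (rule fM[OF X_ball[OF p]])
    obtain n where "fin_supp n p"
      using p by (auto simp: X_def)
    from f1(2)[OF this X_ball[OF p]] have "cmod (f1 p - f p) \<le> 2 * M"
      using 1 norm_triangle_ineq4[of "f1 p" "f p"] by linarith
    then show ?thesis
      unfolding V_def using 1 K by (intro add_mono mult_left_mono power_mono) auto
  qed
  then have bddV: "bdd_above (V ` X)"
    by (auto intro!: bdd_aboveI2)
  define S where "S = (SUP p\<in>X. V p)"
  have VS: "V p \<le> S" if "p \<in> X" for p
    unfolding S_def by (rule cSUP_upper[OF that bddV])
  have p0X: "p0 \<in> X"
    using p0 \<rho> by (auto simp: X_def)
  have "S - \<delta> < S"
    using \<delta> by simp
  then obtain p where p: "p \<in> X" "S - \<delta> < V p"
    unfolding S_def using less_cSUP_iff[OF _ bddV] p0X by blast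
  then obtain n where n: "fin_supp n p" and p\<rho>: "norm p \<le> \<rho>"
    by (auto simp: X_def)
  have jump: "(1 - s) * (cmod (f (p + d i) - f p))\<^sup>2 \<le> \<delta>" if i: "n \<le> i" for i
  proof -
    \<comment> \<open>The direction is stretched to length \<open>\<rho>\<close>, so that \<open>d i\<close> sits at the interior point \<open>s\<close> of the disc.\<close>
    define v where "v = (1 / complex_of_real s) *\<^sub>C d i"
    have v: "tail_supp n v" "norm v \<le> \<rho>"
    proof -
      show "tail_supp n v"
        unfolding v_def using i d(1) by (intro tail_supp_scaleC) (rule tail_supp_mono)
      have "norm v = norm (d i) / s"
        using s by (simp add: v_def norm_scaleC norm_divide)
      also have "\<dots> \<le> \<sigma> / s"
        using s d(3) by (intro divide_right_mono) auto
      also have "\<dots> = \<rho>"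
        using \<sigma> \<rho> by (simp add: s_def)
      finally show "norm v \<le> \<rho>" .
    qed
    obtain m where "fin_supp m (d i)"
      using d(2) by blast
    then have m: "fin_supp (max n m) (p + t *\<^sub>C v)" for t
      using n unfolding v_def
      by (intro fin_supp_add fin_supp_scaleC) (auto intro: fin_supp_mono)
    have pv: "norm (p + t *\<^sub>C v) \<le> max \<rho> (cmod t * \<rho>)" for t
    proof (rule norm_add_disjoint_supp[OF n tail_supp_scaleC[OF v(1)]])
      show "norm (t *\<^sub>C v) \<le> max \<rho> (cmod t * \<rho>)"
        using mult_left_mono[OF v(2) norm_ge_zero[of t]] by (simp add: norm_scaleC le_max_iff_disj)
    qed (use p\<rho> in simp)
    have in_ball: "norm (p + t *\<^sub>C v) < 1" if "cmod t < R" for t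
    proof -
      have "cmod t * \<rho> < 1"
        using that \<rho> by (simp add: R_def field_simps)
      then show ?thesis
        using pv[of t] \<rho> by simp
    qed
    have hol: "(\<lambda>t. f (p + t *\<^sub>C v)) holomorphic_on ball 0 R"
      using in_ball
      by (subst cholomorphic_on_iff_holomorphic_on[symmetric])
        (auto intro!: cholomorphic_on_compose[OF f cholomorphic_on_line])
    have "(\<lambda>t. f1 (p + t *\<^sub>C v)) cholomorphic_on ball 0 R"
    proof (rule cholomorphic_on_pointwise_limit[where F=U and f="\<lambda>j t. f (p + t *\<^sub>C v + d j)"])
      have ev: "\<forall>\<^sub>F j in U. \<forall>t\<in>ball 0 R. p + t *\<^sub>C v + d j \<in> ball 0 1"
        using bdd[of "max n m"] by eventually_elim (use m in_ball in auto)
      show "\<forall>\<^sub>F j in U. (\<lambda>t. f (p + t *\<^sub>C v + d j)) cholomorphic_on ball 0 R"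
        using ev
      proof eventually_elim
        case (elim j)
        show ?case
          by (rule cholomorphic_on_compose[OF f cholomorphic_on_add[OF cholomorphic_on_line cholomorphic_on_const]])
            (use elim in auto)
      qed
      show "\<forall>\<^sub>F j in U. \<forall>t\<in>ball 0 R. cmod (f (p + t *\<^sub>C v + d j)) \<le> M"
        using ev by eventually_elim (use M in blast)
      show "((\<lambda>j. f (p + t *\<^sub>C v + d j)) \<longlongrightarrow> f1 (p + t *\<^sub>C v)) U" if "t \<in> ball 0 R" for t
        using that by (intro f1(1)[OF m in_ball]) simp
    qed (use Ubot in auto)
    then have hol1: "(\<lambda>t. f1 (p + t *\<^sub>C v)) holomorphic_on ball 0 R"
      by (simp add: cholomorphic_on_iff_holomorphic_on)
    have "(cmod (f (p + 0 *\<^sub>C v)))\<^sup>2 + K * (cmod (f1 (p + 0 *\<^sub>C v) - f (p + 0 *\<^sub>C v)))\<^sup>2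
        + (1 - s) * (cmod (f (p + complex_of_real s *\<^sub>C v) - f (p + 0 *\<^sub>C v)))\<^sup>2 \<le> S"
    proof (rule circle_mean_growth[where h="\<lambda>t. f (p + t *\<^sub>C v)"
          and k="\<lambda>t. f1 (p + t *\<^sub>C v) - f (p + t *\<^sub>C v)", OF hol holomorphic_on_diff[OF hol1 hol] R])
      fix t assume "cmod t = 1"
      then have "p + t *\<^sub>C v \<in> X"
        using pv[of t] m[of t] by (auto simp: X_def)
      from VS[OF this] show "(cmod (f (p + t *\<^sub>C v)))\<^sup>2 +
          K * (cmod (f1 (p + t *\<^sub>C v) - f (p + t *\<^sub>C v)))\<^sup>2 \<le> S"
        by (simp add: V_def)
    qed (use K s in auto)
    moreover have "complex_of_real s *\<^sub>C v = d i"
      using s by (simp add: v_def scaleC_scaleC scaleC_1_left)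
    ultimately show ?thesis
      using p(2) by (simp add: scaleC_0_left V_def)
  qed
  have small: "(1 - s) * (cmod (f1 p - f p))\<^sup>2 \<le> \<delta>"
  proof (rule tendsto_le[OF Ubot tendsto_const])
    show "((\<lambda>i. (1 - s) * (cmod (f (p + d i) - f p))\<^sup>2) \<longlongrightarrow> (1 - s) * (cmod (f1 p - f p))\<^sup>2) U"
      by (intro tendsto_intros f1(1)[OF n X_ball[OF p(1)]])
    show "\<forall>\<^sub>F i in U. (1 - s) * (cmod (f (p + d i) - f p))\<^sup>2 \<le> \<delta>"
      by (rule filter_leD[OF Useq], use eventually_ge_at_top[of n] in eventually_elim) (rule jump)
  qed
  have "e \<le> cmod (f1 p0 - f p0)"
  proof (rule tendsto_le[OF Ubot _ tendsto_const])
    show "((\<lambda>i. cmod (f (p0 + d i) - f p0)) \<longlongrightarrow> cmod (f1 p0 - f p0)) U"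
      by (intro tendsto_intros f1(1)[OF p0(1) X_ball[OF p0X]])
  qed (rule Ue)
  then have "e\<^sup>2 \<le> (cmod (f1 p0 - f p0))\<^sup>2"
    using e by (intro power_mono) auto
  then have "K * e\<^sup>2 \<le> K * (cmod (f1 p0 - f p0))\<^sup>2"
    using K by (intro mult_left_mono) auto
  also have "\<dots> \<le> V p0"
    by (simp add: V_def)
  also have "\<dots> \<le> S"
    by (rule VS[OF p0X])
  also have "S \<le> V p + \<delta>"
    using p(2) by simp
  also have "V p \<le> M\<^sup>2 + K * (\<delta> / (1 - s))"
    unfolding V_def
  proof (intro add_mono mult_left_mono power_mono)
    show "(cmod (f1 p - f p))\<^sup>2 \<le> \<delta> / (1 - s)"
      using small s by (simp add: pos_le_divide_eq mult.commute)
  qed (use fM[OF X_ball[OF p(1)]] K in auto)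
  finally have "2 * (M\<^sup>2 + 1) \<le> M\<^sup>2 + 1"
    using K \<delta> by simp
  then have "M\<^sup>2 + 1 \<le> 0"
    by (simp only: mult_2)
  then show False
    using zero_le_power2[of M] by linarith
qed

text \<open>Along a sequence of counterexamples the heads subconverge within \<open>K\<close>.  As \<open>f\<close> is uniformly
  Lipschitz away from the unit sphere, the heads may be replaced by their limit, where the
  pointwise statement applies.\<close>

lemma far_perturbation_uniform_on_compact:
  fixes f :: "c0 \<Rightarrow> complex"
  assumes f: "f cholomorphic_on ball 0 1" and M: "\<And>x. x \<in> ball 0 1 \<Longrightarrow> cmod (f x) \<le> M"
    and \<sigma>: "0 < \<sigma>" "\<sigma> < 1"
    and K: "compact K" "\<And>p. p \<in> K \<Longrightarrow> fin_supp n p \<and> norm p \<le> \<sigma>" and e: "0 < e"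
  shows "\<exists>N\<ge>n. \<forall>p\<in>K. \<forall>d. tail_supp N d \<and> (\<exists>m. fin_supp m d) \<and> norm d \<le> \<sigma> \<longrightarrow>
    cmod (f (p + d) - f p) \<le> e"
proof (rule ccontr)
  assume neg: "\<not> ?thesis"
  have "\<exists>x. fst x \<in> K \<and> tail_supp (N + n) (snd x) \<and> (\<exists>m. fin_supp m (snd x)) \<and> norm (snd x) \<le> \<sigma> \<and>
      e < cmod (f (fst x + snd x) - f (fst x))" for N
  proof -
    have "\<not> (\<forall>p\<in>K. \<forall>d. tail_supp (N + n) d \<and> (\<exists>m. fin_supp m d) \<and> norm d \<le> \<sigma> \<longrightarrow>
        cmod (f (p + d) - f p) \<le> e)"
      using neg le_add2 by blast
    then show ?thesis
      by (auto simp: not_le)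
  qed
  then obtain x where "\<And>N. fst (x N) \<in> K \<and> tail_supp (N + n) (snd (x N)) \<and> (\<exists>m. fin_supp m (snd (x N))) \<and>
      norm (snd (x N)) \<le> \<sigma> \<and> e < cmod (f (fst (x N) + snd (x N)) - f (fst (x N)))"
    using choice[of "\<lambda>N x. fst x \<in> K \<and> tail_supp (N + n) (snd x) \<and> (\<exists>m. fin_supp m (snd x)) \<and>
      norm (snd x) \<le> \<sigma> \<and> e < cmod (f (fst x + snd x) - f (fst x))"] by blast
  then obtain P D where PD: "\<And>N. P N \<in> K" "\<And>N. tail_supp (N + n) (D N)" "\<And>N. \<exists>m. fin_supp m (D N)"
      "\<And>N. norm (D N) \<le> \<sigma>" and jump: "\<And>N. e < cmod (f (P N + D N) - f (P N))"
    using that[of "\<lambda>N. fst (x N)" "\<lambda>N. snd (x N)"] by blast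
  obtain l r where l: "l \<in> K" and r: "strict_mono r" and lim: "(P \<circ> r) \<longlonglongrightarrow> l"
    using K(1) PD(1) unfolding compact_def by blast
  have l_norm: "fin_supp n l" "norm l \<le> \<sigma>"
    using K(2)[OF l] by auto
  have tail: "tail_supp i (D (r i))" "tail_supp n (D (r i))" for i
    using PD(2)[of "r i"] seq_suble[OF r, of i] by (auto intro: tail_supp_mono)
  have 1: "(\<lambda>i. f (l + D (r i))) \<longlonglongrightarrow> f l"
    by (rule tendsto_far_perturbation[OF f M \<sigma> tail(1) PD(3,4) l_norm])
  have "isCont f l"
    using l_norm \<sigma> by (intro cholomorphic_on_continuous_at[OF f]) auto
  then have 2: "(\<lambda>i. f (P (r i))) \<longlonglongrightarrow> f l"
    using isCont_tendsto_compose lim[unfolded o_def] by blast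
  have v0: "(\<lambda>i. norm (P (r i) - l)) \<longlonglongrightarrow> 0"
    using lim by (simp add: o_def LIM_zero tendsto_norm_zero)
  have 3: "(\<lambda>i. f (P (r i) + D (r i)) - f (l + D (r i))) \<longlonglongrightarrow> 0"
  proof (rule Lim_null_comparison)
    have "\<forall>\<^sub>F i in sequentially. norm (P (r i) - l) < 1 - \<sigma>"
      using order_tendstoD(2)[OF v0, of "1 - \<sigma>"] \<sigma> by simp
    then show "\<forall>\<^sub>F i in sequentially. cmod (f (P (r i) + D (r i)) - f (l + D (r i)))
        \<le> 2 * M * norm (P (r i) - l) / (1 - \<sigma>)"
    proof eventually_elim
      case (elim i)
      have "norm (l + D (r i)) \<le> \<sigma>"
        by (rule norm_add_disjoint_supp[OF l_norm(1) tail(2) l_norm(2) PD(4)])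
      then have sub: "ball (l + D (r i)) (1 - \<sigma>) \<subseteq> ball 0 1"
        by (intro subsetI, unfold mem_ball) (rule le_less_trans[OF dist_triangle[of 0 _ "l + D (r i)"]], simp)
      have "cmod (f ((l + D (r i)) + (P (r i) - l)) - f (l + D (r i))) \<le> 2 * M * norm (P (r i) - l) / (1 - \<sigma>)"
        by (rule bounded_cholomorphic_increment[OF cholomorphic_on_subset[OF f sub] M])
          (use sub elim \<sigma> in auto)
      then show ?case
        by (simp add: algebra_simps)
    qed
    have "(\<lambda>i. 2 * M * norm (P (r i) - l) / (1 - \<sigma>)) \<longlonglongrightarrow> 2 * M * 0 / (1 - \<sigma>)"
      using \<sigma> by (intro tendsto_intros v0) auto
    then show "(\<lambda>i. 2 * M * norm (P (r i) - l) / (1 - \<sigma>)) \<longlonglongrightarrow> 0"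
      by simp
  qed
  have "(\<lambda>i. cmod ((f (P (r i) + D (r i)) - f (l + D (r i))) + f (l + D (r i)) - f (P (r i)))) \<longlonglongrightarrow> cmod (0 + f l - f l)"
    by (intro tendsto_intros 1 2 3)
  then have "(\<lambda>i. cmod (f (P (r i) + D (r i)) - f (P (r i)))) \<longlonglongrightarrow> 0"
    by simp
  then have "\<forall>\<^sub>F i in sequentially. cmod (f (P (r i) + D (r i)) - f (P (r i))) < e"
    using e by (rule order_tendstoD)
  then obtain i where "cmod (f (P (r i) + D (r i)) - f (P (r i))) < e"
    using eventually_happens'[OF sequentially_bot] by blast
  with jump[of "r i"] show False
    by simp
qed


definition segment :: "linf \<Rightarrow> nat \<Rightarrow> nat \<Rightarrow> c0"
  where "segment w m n = truncate n w - truncate m w"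

lemma c0_nth_segment:
  "m \<le> n \<Longrightarrow> c0_nth (segment w m n) i = (if m \<le> i \<and> i < n then apply_bcontfun w i else 0)"
  by (simp add: segment_def c0_nth_truncate)

lemma segment_supp:
  assumes "m \<le> n"
  shows "tail_supp m (segment w m n)" "fin_supp n (segment w m n)" "norm (segment w m n) \<le> norm w"
  using assms by (auto simp: tail_supp_def fin_supp_def c0_nth_segment norm_bounded intro!: norm_c0_le)

lemma segment_append: "segment w l m + segment w m n = segment w l n"
  by (simp add: segment_def)

lemma truncate_0: "truncate 0 w = 0"
  by (rule c0_eqI) (simp add: c0_nth_truncate)

text \<open>Cut \<open>w\<close> into blocks \<open>g 0, g 1, \<dots>\<close>, each so long that what comes after it hardly matters
  when the head is a combination of the earlier blocks only.  In the variables \<open>z j\<close> of the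
  polydisc \<open>\<Sum>j. z j g j\<close>, of radius \<open>R > 1\<close>, the change of \<open>f\<close> caused by the coordinates beyond the
  \<open>k\<close>-th block is then almost 0 as soon as one \<open>z j\<close> vanishes.  The Schwarz lemma in each of the \<open>k\<close>
  variables bounds this change at \<open>z = (1, \<dots>, 1)\<close> by \<open>2 M / R\<^sup>k\<close> up to an error that does not grow
  with \<open>k\<close>.\<close>

lemma convergent_truncate:
  fixes f :: "c0 \<Rightarrow> complex"
  assumes f: "f cholomorphic_on ball 0 1" and M: "\<And>x. x \<in> ball 0 1 \<Longrightarrow> cmod (f x) \<le> M"
    and w: "norm w < 1"
  shows "convergent (\<lambda>n. f (truncate n w))"
proof -
  define \<tau> where "\<tau> = (1 + 2 * norm w) / 3"
  define \<sigma> where "\<sigma> = (1 + \<tau>) / 2"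
  define R where "R = \<sigma> / \<tau>"
  have \<tau>: "norm w \<le> \<tau>" "0 < \<tau>" "\<tau> < 1"
    using w by (auto simp: \<tau>_def field_simps add_pos_nonneg)
  have \<sigma>: "\<tau> < \<sigma>" "\<sigma> < 1" "0 < \<sigma>"
    using \<tau> by (auto simp: \<sigma>_def)
  have R: "1 < R" "R * \<tau> = \<sigma>"
    using \<tau> \<sigma> by (auto simp: R_def)
  have M0: "0 \<le> M"
    using M[of 0] norm_ge_zero[of "f 0"] by (auto intro: order_trans simp del: norm_ge_zero)
  have seg: "norm (segment w m n) \<le> \<tau>" if "m \<le> n" for m n
    using segment_supp(3)[OF that, of w] \<tau> by linarith
  have seg_scaled: "norm (z *\<^sub>C segment w m n) \<le> \<sigma>" if "m \<le> n" "cmod z \<le> R" for m n z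
    using mult_mono[OF that(2) seg[OF that(1)]] R by (simp add: norm_scaleC)
  have near: "\<exists>m. \<forall>n\<ge>m. cmod (f (truncate n w) - f (truncate m w)) \<le> \<epsilon>" if \<epsilon>: "0 < \<epsilon>" for \<epsilon>
  proof -
    define e where "e = \<epsilon> * (R - 1) / (4 * (R + 1))"
    have e: "0 < e"
      using \<epsilon> R by (simp add: e_def)
    define good where "good n K \<longleftrightarrow> compact K \<and> (\<forall>p\<in>K. fin_supp n p \<and> norm p \<le> \<sigma>)" for n K
    define far where "far K N \<longleftrightarrow> (\<forall>p\<in>K. \<forall>d. tail_supp N d \<and> (\<exists>m. fin_supp m d) \<and> norm d \<le> \<sigma> \<longrightarrow>
        cmod (f (p + d) - f p) \<le> e)" for K N
    define extend where "extend K m n = (\<lambda>(p, z). p + z *\<^sub>C segment w m n) ` (K \<times> cball 0 R)" for K m n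
    have good_extend: "good n (extend K m n)" if "good m K" "m \<le> n" for m n K
      unfolding good_def
    proof
      have "continuous_on (K \<times> cball 0 R) (\<lambda>x. fst x + snd x *\<^sub>C segment w m n)"
        by (intro continuous_intros bounded_linear.continuous_on[OF bounded_linear_scaleC_left])
      then show "compact (extend K m n)"
        unfolding extend_def case_prod_beta using that
        by (intro compact_continuous_image compact_Times) (auto simp: good_def)
      show "\<forall>p\<in>extend K m n. fin_supp n p \<and> norm p \<le> \<sigma>"
      proof
        fix q assume "q \<in> extend K m n"
        then obtain p z where q: "q = p + z *\<^sub>C segment w m n" and p: "p \<in> K" and z: "cmod z \<le> R"
          by (auto simp: extend_def)
        have "fin_supp m p" "norm p \<le> \<sigma>"
          using that p by (auto simp: good_def)
        then show "fin_supp n q \<and> norm q \<le> \<sigma>"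
          unfolding q using segment_supp[OF that(2), of w] seg_scaled[OF that(2) z] that(2)
          by (auto intro!: fin_supp_add fin_supp_scaleC norm_add_disjoint_supp[of m] tail_supp_scaleC
              intro: fin_supp_mono)
      qed
    qed
    \<comment> \<open>\<open>F j\<close> pairs the end of the first \<open>j\<close> blocks with the compact set of heads built from them.\<close>
    have "\<exists>F. \<forall>j. (case F j of (n, K) \<Rightarrow> good n K \<and> truncate n w \<in> K) \<and>
        (case (F j, F (Suc j)) of ((n, K), (n', K')) \<Rightarrow> n \<le> n' \<and> far K n' \<and> K' = extend K n n')"
    proof (rule dependent_nat_choice)
      show "\<exists>x. case x of (n, K) \<Rightarrow> good n K \<and> truncate n w \<in> K"
        using \<sigma> by (intro exI[of _ "(0, {0})"]) (auto simp: good_def fin_supp_def truncate_0)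
      fix x j assume x: "case x of (n, K) \<Rightarrow> good n K \<and> truncate n w \<in> K"
      obtain n K where nK: "x = (n, K)"
        by fastforce
      have K: "good n K" "truncate n w \<in> K"
        using x nK by auto
      then obtain n' where n': "n \<le> n'" "far K n'"
        using far_perturbation_uniform_on_compact[OF f M \<sigma>(3,2), of K n e] e
        unfolding good_def far_def by blast
      moreover have "truncate n' w \<in> extend K n n'"
        unfolding extend_def using K(2) R
        by (intro image_eqI[of _ _ "(truncate n w, 1)"]) (auto simp: scaleC_1_left segment_def)
      ultimately show "\<exists>y. (case y of (n, K) \<Rightarrow> good n K \<and> truncate n w \<in> K) \<and>
          (case (x, y) of ((n, K), (n', K')) \<Rightarrow> n \<le> n' \<and> far K n' \<and> K' = extend K n n')"
        using good_extend[OF K(1) n'(1)] nK by (intro exI[of _ "(n', extend K n n')"]) auto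
    qed
    then obtain F where F: "\<And>j. (case F j of (n, K) \<Rightarrow> good n K \<and> truncate n w \<in> K) \<and>
        (case (F j, F (Suc j)) of ((n, K), (n', K')) \<Rightarrow> n \<le> n' \<and> far K n' \<and> K' = extend K n n')"
      by blast
    define N where "N j = fst (F j)" for j
    define K where "K j = snd (F j)" for j
    have NK: "good (N j) (K j)" "truncate (N j) w \<in> K j" "N j \<le> N (Suc j)" "far (K j) (N (Suc j))"
        "K (Suc j) = extend (K j) (N j) (N (Suc j))" for j
      using F[of j] by (simp_all add: N_def K_def case_prod_beta)
    have N_mono: "N i \<le> N j" if "i \<le> j" for i j
      by (rule lift_Suc_mono_le[of N, OF NK(3) that])
    have heads: "fin_supp (N j) p" "norm p \<le> \<sigma>" if "p \<in> K j" for p j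
      using NK(1)[of j] that by (auto simp: good_def)
    have ext_ball: "p + segment w (N j) n \<in> ball 0 1" if "p \<in> K j" "N j \<le> n" for p j n
    proof -
      have "norm (p + segment w (N j) n) \<le> \<sigma>"
        using heads[OF that(1)] segment_supp[OF that(2), of w] seg[OF that(2)] \<sigma>
        by (intro norm_add_disjoint_supp[of "N j"]) auto
      then show ?thesis
        using \<sigma> by simp
    qed
    \<comment> \<open>The accumulated error is the fixed point of the recursion that one use of the Schwarz lemma gives.\<close>
    define b where "b = 2 * e * (R + 1) / (R - 1)"
    have b: "2 * e + (b + 2 * e) / R = b"
      using R by (simp add: b_def divide_simps) (simp add: algebra_simps)
    have bound: "cmod (f (p + segment w (N j) n) - f (p + segment w (N j) (N (j + i)))) \<le> b + 2 * M / R ^ i"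
      if "p \<in> K j" "N (j + i) \<le> n" for p i j n
      using that
    proof (induction i arbitrary: p j)
      case 0
      have "cmod (f (p + segment w (N j) n) - f (p + segment w (N j) (N j))) \<le> M + M"
        using 0 by (intro order_trans[OF norm_triangle_ineq4 add_mono] M ext_ball) auto
      moreover have "0 \<le> b"
        using e R by (simp add: b_def)
      ultimately show ?case
        by simp
    next
      case (Suc i)
      define g where "g = segment w (N j) (N (Suc j))"
      define k where "k = Suc j + i"
      have k: "N (Suc j) \<le> N k" "N k \<le> n" "N (Suc j) \<le> n"
        using N_mono[of "Suc j" k] Suc.prems by (auto simp: k_def)
      define h where "h z = f (p + z *\<^sub>C g + segment w (N (Suc j)) n) - f (p + z *\<^sub>C g + segment w (N (Suc j)) (N k))" for z
      have head: "p + z *\<^sub>C g \<in> K (Suc j)" if "cmod z < R" for z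
        unfolding NK(5) extend_def g_def using Suc.prems that by (intro image_eqI[of _ _ "(p, z)"]) auto
      have hB: "cmod (h z) \<le> b + 2 * M / R ^ i" if "cmod z < R" for z
        using Suc.IH[OF head[OF that]] k by (simp add: h_def k_def)
      have "h holomorphic_on ball 0 R"
      proof (subst cholomorphic_on_iff_holomorphic_on[symmetric])
        show "h cholomorphic_on ball 0 R"
          unfolding h_def
          by (intro cholomorphic_on_diff cholomorphic_on_compose[OF f]
              cholomorphic_on_add[OF cholomorphic_on_line cholomorphic_on_const])
            (use ext_ball[OF head] k in auto)
      qed simp
      then have hol: "(\<lambda>z. h z - h 0) holomorphic_on ball 0 R"
        by (intro holomorphic_intros)
      have h0: "cmod (h 0) \<le> 2 * e"
      proof -
        have tails: "cmod (f (p + segment w (N (Suc j)) l) - f p) \<le> e" if "N (Suc j) \<le> l" for l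
          using NK(4)[of j] Suc.prems(1) segment_supp[OF that, of w] seg[OF that] \<sigma>
          unfolding far_def by (metis less_imp_le order_trans)
        have "h 0 = (f (p + segment w (N (Suc j)) n) - f p) - (f (p + segment w (N (Suc j)) (N k)) - f p)"
          by (simp add: h_def scaleC_0_left)
        then have "cmod (h 0) \<le> e + e"
          by (simp only:) (intro order_trans[OF norm_triangle_ineq4 add_mono] tails k)
        then show ?thesis
          by simp
      qed
      have "cmod (h 1 - h 0) \<le> (b + 2 * M / R ^ i + 2 * e) * cmod 1 / R"
      proof (rule Schwarz_scaled(1)[OF hol])
        fix z assume "cmod z < R"
        then show "cmod (h z - h 0) \<le> b + 2 * M / R ^ i + 2 * e"
          using hB[of z] h0 norm_triangle_ineq4[of "h z" "h 0"] by linarith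
      qed (use R in auto)
      then have "cmod (h 1) \<le> 2 * e + (b + 2 * M / R ^ i + 2 * e) / R"
        using h0 norm_triangle_sub[of "h 1" "h 0"] by simp
      also have "\<dots> = (2 * e + (b + 2 * e) / R) + 2 * M / R ^ Suc i"
        by (simp add: add_divide_distrib)
      also have "\<dots> = b + 2 * M / R ^ Suc i"
        by (simp only: b)
      finally have "cmod (h 1) \<le> b + 2 * M / R ^ Suc i" .
      moreover have "p + 1 *\<^sub>C g + segment w (N (Suc j)) l = p + segment w (N j) l" for l
        by (simp add: g_def scaleC_1_left add.assoc segment_append)
      ultimately show ?case
        by (simp add: h_def k_def)
    qed
    have "(\<lambda>k. 2 * M * (1 / R) ^ k) \<longlonglongrightarrow> 2 * M * 0"
      using R by (intro tendsto_intros LIMSEQ_realpow_zero) auto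
    then have "\<forall>\<^sub>F k in sequentially. 2 * M * (1 / R) ^ k < \<epsilon> / 2"
      using \<epsilon> by (intro order_tendstoD(2)) auto
    then obtain k where "2 * M * (1 / R) ^ k < \<epsilon> / 2"
      using eventually_happens'[OF sequentially_bot] by blast
    then have k: "2 * M / R ^ k < \<epsilon> / 2"
      by (simp add: power_one_over field_simps)
    have b_eq: "b = \<epsilon> / 2"
      using R by (simp add: b_def e_def divide_simps)
    show ?thesis
    proof (intro exI[of _ "N k"] allI impI)
      fix n assume n: "N k \<le> n"
      have tr: "truncate (N 0) w + segment w (N 0) l = truncate l w" for l
        by (simp add: segment_def)
      show "cmod (f (truncate n w) - f (truncate (N k) w)) \<le> \<epsilon>"
        using bound[of "truncate (N 0) w" 0 k n] NK(2)[of 0] n k b_eq by (simp add: tr)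
    qed
  qed
  have "Cauchy (\<lambda>n. f (truncate n w))"
  proof (rule metric_CauchyI)
    fix \<epsilon> :: real assume "0 < \<epsilon>"
    then obtain m where m: "\<And>n. m \<le> n \<Longrightarrow> cmod (f (truncate n w) - f (truncate m w)) \<le> \<epsilon> / 3"
      using near[of "\<epsilon> / 3"] by auto
    have "dist (f (truncate i w)) (f (truncate j w)) < \<epsilon>" if "m \<le> i" "m \<le> j" for i j
      using m[OF that(1)] m[OF that(2)] dist_triangle2[of "f (truncate i w)" "f (truncate j w)" "f (truncate m w)"] \<open>0 < \<epsilon>\<close>
      unfolding dist_norm by linarith
    then show "\<exists>m. \<forall>i\<ge>m. \<forall>j\<ge>m. dist (f (truncate i w)) (f (truncate j w)) < \<epsilon>"
      by blast
  qed
  then show ?thesis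
    by (rule Cauchy_convergent)
qed


section \<open>An interpolating partition of unity\<close>

text \<open>\<open>disc_shift n\<close> is the automorphism of the disc that sends the values 0 and \<open>marker n\<close> to
  \<open>- peak n\<close> and \<open>peak n\<close>, which for large \<open>n\<close> are close to -1 and 1.  Composed with it, the functions
  \<open>((1 - z) / 2)\<^sup>2\<close> and \<open>((1 + z) / 2)\<^sup>2\<close> become weights that are almost 1 and 0 at the value 0, and
  almost 0 and 1 at the value \<open>marker n\<close>.  By the parallelogram law their moduli add up to at
  most 1 on the whole disc.\<close>

definition peak :: "nat \<Rightarrow> real"
  where "peak n = 1 - (1 / 2) ^ n"

definition marker :: "nat \<Rightarrow> real"
  where "marker n = 2 * peak n / (1 + (peak n)\<^sup>2)"

definition disc_shift :: "nat \<Rightarrow> complex \<Rightarrow> complex"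
  where "disc_shift n z = (z - of_real (peak n)) / (1 - of_real (peak n) * z)"

definition on_weight :: "nat \<Rightarrow> complex \<Rightarrow> complex"
  where "on_weight n z = ((1 + disc_shift n z) / 2)\<^sup>2"

definition off_weight :: "nat \<Rightarrow> complex \<Rightarrow> complex"
  where "off_weight n z = ((1 - disc_shift n z) / 2)\<^sup>2"

lemma peak_bounds: "0 \<le> peak n" "peak n < 1"
  by (simp_all add: peak_def power_le_one)

lemma marker_bounds: "0 \<le> marker n" "marker n < 1"
proof -
  have "0 < (1 - peak n)\<^sup>2"
    using peak_bounds[of n] by simp
  then have "2 * peak n < 1 + (peak n)\<^sup>2"
    by (simp add: power2_eq_square algebra_simps)
  then show "marker n < 1"
    by (simp add: marker_def divide_simps add_pos_nonneg)
  show "0 \<le> marker n"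
    using peak_bounds[of n] by (simp add: marker_def)
qed

lemma marker_tendsto_1: "marker \<longlonglongrightarrow> 1"
proof -
  have "peak \<longlonglongrightarrow> 1 - 0"
    unfolding peak_def by (intro tendsto_intros LIMSEQ_realpow_zero) auto
  then have "(\<lambda>n. 2 * peak n / (1 + (peak n)\<^sup>2)) \<longlonglongrightarrow> 2 * 1 / (1 + 1\<^sup>2)"
    by (intro tendsto_intros) auto
  then show ?thesis
    by (simp add: marker_def[abs_def])
qed

lemma disc_shift_denominator_nonzero: "cmod z < 1 \<Longrightarrow> 1 - of_real (peak n) * z \<noteq> 0"
proof
  assume z: "cmod z < 1" and "1 - of_real (peak n) * z = 0"
  then have "1 = cmod (of_real (peak n) * z)"
    by (metis eq_iff_diff_eq_0 norm_one)
  also have "\<dots> \<le> 1 * cmod z"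
    unfolding norm_mult using peak_bounds[of n] by (intro mult_right_mono) auto
  finally show False
    using z by simp
qed

lemma disc_shift_holomorphic: "disc_shift n holomorphic_on ball 0 1"
  unfolding disc_shift_def[abs_def]
  by (intro holomorphic_intros) (use disc_shift_denominator_nonzero in auto)

lemma norm_disc_shift_le: "cmod z < 1 \<Longrightarrow> cmod (disc_shift n z) \<le> 1"
proof -
  assume z: "cmod z < 1"
  let ?s = "peak n"
  have "0 \<le> (1 - ?s\<^sup>2) * (1 - (cmod z)\<^sup>2)"
    using z peak_bounds[of n] by (intro mult_nonneg_nonneg) (auto simp: power_le_one abs_square_le_1)
  also have "\<dots> = (cmod (1 - of_real ?s * z))\<^sup>2 - (cmod (z - of_real ?s))\<^sup>2"
    unfolding cmod_power2 by (simp add: power2_eq_square algebra_simps)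
  finally have "(cmod (z - of_real ?s))\<^sup>2 \<le> (cmod (1 - of_real ?s * z))\<^sup>2"
    by simp
  then have "cmod (z - of_real ?s) \<le> cmod (1 - of_real ?s * z)"
    by (rule power2_le_imp_le) simp
  then show ?thesis
    using disc_shift_denominator_nonzero[OF z, of n] by (simp add: disc_shift_def norm_divide)
qed

lemma norm_weights_le: "cmod z < 1 \<Longrightarrow> cmod (off_weight n z) + cmod (on_weight n z) \<le> 1"
proof -
  assume "cmod z < 1"
  then have "(cmod (disc_shift n z))\<^sup>2 \<le> 1"
    using norm_disc_shift_le by (simp add: power_le_one)
  moreover have "(cmod (1 - u))\<^sup>2 + (cmod (1 + u))\<^sup>2 = 2 + 2 * (cmod u)\<^sup>2" for u
    unfolding cmod_power2 by (simp add: power2_eq_square algebra_simps)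
  ultimately have "((cmod (1 - disc_shift n z))\<^sup>2 + (cmod (1 + disc_shift n z))\<^sup>2) / 4 \<le> 1"
    by simp
  then show ?thesis
    by (simp add: off_weight_def on_weight_def norm_power norm_divide power_divide flip: add_divide_distrib)
qed

lemma disc_shift_0: "disc_shift n 0 = - of_real (peak n)"
  by (simp add: disc_shift_def)

lemma disc_shift_marker: "disc_shift n (of_real (marker n)) = of_real (peak n)"
proof -
  let ?s = "peak n"
  have pos: "0 < 1 + ?s\<^sup>2" "0 < 1 - ?s\<^sup>2"
    using peak_bounds[of n] by (auto simp: add_pos_nonneg power_less_one_iff abs_square_less_1)
  have "marker n - ?s = ?s * (1 - ?s\<^sup>2) / (1 + ?s\<^sup>2)" "1 - ?s * marker n = (1 - ?s\<^sup>2) / (1 + ?s\<^sup>2)"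
    using pos by (simp_all add: marker_def divide_simps) (simp_all add: power2_eq_square algebra_simps)
  then have "(marker n - ?s) / (1 - ?s * marker n) = ?s"
    using pos by simp
  then have "complex_of_real ((marker n - ?s) / (1 - ?s * marker n)) = of_real ?s"
    by (rule arg_cong)
  then show ?thesis
    by (simp add: disc_shift_def)
qed

lemma weights_at_0: "cmod (1 - off_weight n 0) + cmod (on_weight n 0) \<le> 3 * (1 / 2) ^ Suc n"
  and weights_at_marker:
    "cmod (off_weight n (of_real (marker n))) + cmod (1 - on_weight n (of_real (marker n))) \<le> 3 * (1 / 2) ^ Suc n"
proof -
  define e :: real where "e = (1 / 2) ^ Suc n"
  have e: "0 \<le> e" "e \<le> 1"
    unfolding e_def by (rule zero_le_power, simp) (rule power_le_one, simp_all)
  have s: "peak n = 1 - 2 * e"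
    by (simp add: peak_def e_def)
  have sq: "cmod (1 - (of_real (1 - e))\<^sup>2) + cmod ((of_real e)\<^sup>2) \<le> 3 * e"
  proof -
    have "1 - (complex_of_real (1 - e))\<^sup>2 = of_real (2 * e - e\<^sup>2)"
      by (simp add: power2_eq_square algebra_simps)
    then have "cmod (1 - (of_real (1 - e))\<^sup>2) = \<bar>2 * e - e\<^sup>2\<bar>"
      by (simp only: norm_of_real)
    also have "\<dots> = 2 * e - e\<^sup>2"
      using e mult_left_le[of e e] by (simp add: power2_eq_square)
    finally show ?thesis
      using e by (simp add: norm_power)
  qed
  have half: "(1 + of_real (peak n)) / 2 = complex_of_real (1 - e)"
      "(1 - of_real (peak n)) / 2 = complex_of_real e"
    by (simp_all add: s field_simps)
  have "off_weight n 0 = (of_real (1 - e))\<^sup>2" "on_weight n 0 = (of_real e)\<^sup>2"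
    unfolding off_weight_def on_weight_def disc_shift_0 half[symmetric] by simp_all
  then show "cmod (1 - off_weight n 0) + cmod (on_weight n 0) \<le> 3 * (1 / 2) ^ Suc n"
    using sq by (simp only: e_def)
  have "on_weight n (of_real (marker n)) = (of_real (1 - e))\<^sup>2" "off_weight n (of_real (marker n)) = (of_real e)\<^sup>2"
    unfolding off_weight_def on_weight_def disc_shift_marker half[symmetric] by simp_all
  then show "cmod (off_weight n (of_real (marker n))) + cmod (1 - on_weight n (of_real (marker n))) \<le> 3 * (1 / 2) ^ Suc n"
    using sq by (simp only: e_def add.commute)
qed

text \<open>\<open>\<phi> n\<close> is switched on, and everything before it switched off, when the coordinate \<open>2 n\<close> has the
  value \<open>marker n\<close>; when that coordinate is 0, the blend hardly changes.  The last marker of \<open>y\<close>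
  therefore selects a function.\<close>

primrec blend :: "(nat \<Rightarrow> c0 \<Rightarrow> complex) \<Rightarrow> nat \<Rightarrow> c0 \<Rightarrow> complex"
  where "blend \<phi> 0 y = 0"
  | "blend \<phi> (Suc n) y = off_weight n (c0_nth y (2 * n)) * blend \<phi> n y
      + on_weight n (c0_nth y (2 * n)) * \<phi> n y"

lemma cholomorphic_on_weight:
  "(\<lambda>y. off_weight n (c0_nth y i)) cholomorphic_on ball 0 1"
  "(\<lambda>y. on_weight n (c0_nth y i)) cholomorphic_on ball 0 1"
proof -
  have "off_weight n holomorphic_on ball 0 1" "on_weight n holomorphic_on ball 0 1"
    unfolding off_weight_def[abs_def] on_weight_def[abs_def]
    by (intro holomorphic_intros disc_shift_holomorphic; simp)+
  then have "off_weight n cholomorphic_on ball 0 1" "on_weight n cholomorphic_on ball 0 1"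
    by (simp_all add: cholomorphic_on_iff_holomorphic_on)
  moreover have "(\<lambda>y. c0_nth y i) ` ball 0 1 \<subseteq> ball 0 1"
    using norm_c0_nth_le le_less_trans by fastforce
  ultimately show "(\<lambda>y. off_weight n (c0_nth y i)) cholomorphic_on ball 0 1"
    "(\<lambda>y. on_weight n (c0_nth y i)) cholomorphic_on ball 0 1"
    using cholomorphic_on_compose[OF _ cholomorphic_on_c0_nth] by blast+
qed

text \<open>The blends of \<open>\<phi>\<close> never leave the disc of radius \<open>B\<close>, since each is an absolutely convex combination
  of the previous one and \<open>\<phi> n\<close>.  A limit of them along an ultrafilter on the natural numbers is
  holomorphic, and the errors of the single steps sum to a geometric series.\<close>

lemma interpolation_at_markers:
  fixes \<phi> :: "nat \<Rightarrow> c0 \<Rightarrow> complex"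
  assumes \<phi>: "\<And>n. \<phi> n cholomorphic_on ball 0 1" and B: "\<And>n y. y \<in> ball 0 1 \<Longrightarrow> cmod (\<phi> n y) \<le> B"
  shows "\<exists>F. norm F \<le> B \<and> (\<forall>k. \<forall>y\<in>ball 0 1. c0_nth y (2 * k) = of_real (marker k) \<longrightarrow>
    (\<forall>m>k. c0_nth y (2 * m) = 0) \<longrightarrow> cmod (hinf_apply F y - \<phi> k y) \<le> 3 * B * (1 / 2) ^ k)"
proof -
  have B0: "0 \<le> B"
    using order_trans[OF norm_ge_zero B[of 0 0]] by simp
  have hol: "blend \<phi> n cholomorphic_on ball 0 1" for n
  proof (induction n)
    case 0
    then show ?case
      by (simp add: cholomorphic_on_const)
  next
    case (Suc n)
    then show ?case
      by (simp only: blend.simps) (intro cholomorphic_on_add cholomorphic_on_mult cholomorphic_on_weight \<phi>)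
  qed
  have coord: "cmod (c0_nth y i) < 1" if "y \<in> ball 0 1" for y i
    using that norm_c0_nth_le[of y i] by simp
  have bound: "cmod (blend \<phi> n y) \<le> B" if y: "y \<in> ball 0 1" for n y
  proof (induction n)
    case (Suc n)
    let ?z = "c0_nth y (2 * n)"
    have "cmod (blend \<phi> (Suc n) y) \<le> cmod (off_weight n ?z) * B + cmod (on_weight n ?z) * B"
      unfolding blend.simps
      by (rule order_trans[OF norm_triangle_ineq], unfold norm_mult)
        (intro add_mono mult_left_mono Suc B y norm_ge_zero)
    also have "\<dots> \<le> 1 * B"
      unfolding distrib_right[symmetric] by (intro mult_right_mono norm_weights_le coord y B0)
    finally show ?case
      by simp
  qed (simp add: B0)
  obtain U :: "nat filter" where U: "U \<le> sequentially" "ultrafilter U"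
    using ex_ultrafilter_le[OF sequentially_bot] by blast
  have Ubot: "U \<noteq> bot"
    using U(2) by (simp add: ultrafilter_def)
  define G where "G y = Lim U (\<lambda>n. blend \<phi> n y)" for y
  have G: "((\<lambda>n. blend \<phi> n y) \<longlongrightarrow> G y) U" "cmod (G y) \<le> B" if "y \<in> ball 0 1" for y
    unfolding G_def using ultrafilter_bounded_tendsto[OF U(2), of "\<lambda>n. blend \<phi> n y" B] bound[OF that] by simp_all
  have Ghol: "G cholomorphic_on ball 0 1"
    by (rule cholomorphic_on_pointwise_limit[OF Ubot open_ball, where f="blend \<phi>" and M=B])
      (use hol bound G in auto)
  have near: "cmod (G y - \<phi> k y) \<le> 3 * B * (1 / 2) ^ k"
    if y: "y \<in> ball 0 1" and at: "c0_nth y (2 * k) = of_real (marker k)" and off: "\<forall>m>k. c0_nth y (2 * m) = 0" for k y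
  proof -
    have step: "cmod (a * x + b * z - x) \<le> 3 * B * (1 / 2) ^ Suc n"
      if "cmod (1 - a) + cmod b \<le> 3 * (1 / 2) ^ Suc n" "cmod x \<le> B" "cmod z \<le> B" for a b x z and n :: nat
    proof -
      have "a * x + b * z - x = b * z - (1 - a) * x"
        by (simp add: algebra_simps)
      also have "cmod \<dots> \<le> cmod b * cmod z + cmod (1 - a) * cmod x"
        by (rule order_trans[OF norm_triangle_ineq4]) (simp add: norm_mult)
      also have "\<dots> \<le> cmod b * B + cmod (1 - a) * B"
        using that by (intro add_mono mult_left_mono) auto
      also have "\<dots> \<le> 3 * (1 / 2) ^ Suc n * B"
        unfolding distrib_right[symmetric] using that(1) B0 by (intro mult_right_mono) auto
      finally show ?thesis
        by (simp add: mult_ac)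
    qed
    have partial: "cmod (blend \<phi> (Suc (k + j)) y - \<phi> k y) \<le> 3 * B * ((1 / 2) ^ k - (1 / 2) ^ Suc (k + j))" for j
    proof (induction j)
      case 0
      have "cmod (blend \<phi> (Suc k) y - \<phi> k y) \<le> 3 * B * (1 / 2) ^ Suc k"
        using step[of "on_weight k (c0_nth y (2 * k))" "off_weight k (c0_nth y (2 * k))" k "\<phi> k y" "blend \<phi> k y"]
          weights_at_marker[of k] B[OF y] bound[OF y] at by (simp add: add.commute)
      then show ?case
        by simp
    next
      case (Suc j)
      let ?n = "Suc (k + j)"
      have z: "c0_nth y (2 * ?n) = 0"
        using off by (metis less_add_Suc1)
      have "cmod (blend \<phi> (Suc ?n) y - blend \<phi> ?n y) \<le> 3 * B * (1 / 2) ^ Suc ?n"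
        unfolding blend.simps(2)[of \<phi> ?n] z by (rule step[OF weights_at_0 bound[OF y] B[OF y]])
      moreover have "blend \<phi> (Suc ?n) y - \<phi> k y = (blend \<phi> (Suc ?n) y - blend \<phi> ?n y) + (blend \<phi> ?n y - \<phi> k y)"
        by simp
      ultimately have "cmod (blend \<phi> (Suc ?n) y - \<phi> k y)
          \<le> 3 * B * (1 / 2) ^ Suc ?n + 3 * B * ((1 / 2) ^ k - (1 / 2) ^ ?n)"
        using Suc norm_triangle_mono by metis
      also have "\<dots> = 3 * B * ((1 / 2) ^ k - (1 / 2) ^ Suc ?n)"
        by (simp add: algebra_simps)
      finally show ?case
        by (simp del: blend.simps)
    qed
    show ?thesis
    proof (rule tendsto_le[OF Ubot tendsto_const])
      show "((\<lambda>n. cmod (blend \<phi> n y - \<phi> k y)) \<longlongrightarrow> cmod (G y - \<phi> k y)) U"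
        by (intro tendsto_intros G y)
      show "\<forall>\<^sub>F n in U. cmod (blend \<phi> n y - \<phi> k y) \<le> 3 * B * (1 / 2) ^ k"
      proof (rule filter_leD[OF U(1)], use eventually_ge_at_top[of "Suc k"] in eventually_elim)
        fix n assume "Suc k \<le> n"
        then obtain j where n: "n = Suc (k + j)"
          by (metis add_Suc le_iff_add)
        have "3 * B * ((1 / 2) ^ k - (1 / 2) ^ Suc (k + j)) \<le> 3 * B * (1 / 2) ^ k"
          using B0 by (intro mult_left_mono) auto
        then show "cmod (blend \<phi> n y - \<phi> k y) \<le> 3 * B * (1 / 2) ^ k"
          unfolding n by (rule order_trans[OF partial])
      qed
    qed
  qed
  show ?thesis
  proof (intro exI[of _ "to_hinf G"] conjI allI ballI impI)
    show "norm (to_hinf G) \<le> B"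
      by (rule norm_to_hinf_le[OF Ghol G(2)])
    fix k y assume y: "y \<in> ball 0 1" and "c0_nth y (2 * k) = of_real (marker k)" "\<forall>m>k. c0_nth y (2 * m) = 0"
    then show "cmod (hinf_apply (to_hinf G) y - \<phi> k y) \<le> 3 * B * (1 / 2) ^ k"
      using near[of y k] hinf_apply_to_hinf[OF Ghol G(2) y] by simp
  qed
qed


section \<open>Spots: finitely supported points carrying two bounded sequences\<close>

text \<open>The coordinates of a spot are an initial segment of \<open>u\<close> multiplied by \<open>marker k\<close>, the initial segment
  of \<open>w\<close> of the same length, one marker at the position \<open>2 k\<close>, and zeros.  No marker position
  beyond \<open>2 k\<close> is occupied, so that the marker at \<open>2 k\<close> is the last one whatever \<open>u\<close> and \<open>w\<close> are.
  The factor keeps the point in the open ball when \<open>u\<close> has norm 1.\<close>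

definition spot :: "nat \<Rightarrow> linf \<Rightarrow> linf \<Rightarrow> c0"
  where "spot k u w = of_real (marker k) *\<^sub>C rearrange {..<k} (\<lambda>i. i) u
    + rearrange {k..<2 * k} (\<lambda>i. i - k) w + of_real (marker k) *\<^sub>C unit_c0 (2 * k)"

definition readback :: "nat \<Rightarrow> c0 \<Rightarrow> c0"
  where "readback k y = rearrange {..<k} (\<lambda>i. i + k) (linf_of_c0 y)"

lemma c0_nth_spot:
  "c0_nth (spot k u w) i = (if i < k then of_real (marker k) * apply_bcontfun u i
    else if i < 2 * k then apply_bcontfun w (i - k) else if i = 2 * k then of_real (marker k) else 0)"
  by (auto simp: spot_def c0_nth_rearrange)

lemma readback_spot: "readback k (spot k u w) = truncate k w"
  by (rule c0_eqI)
    (simp add: readback_def c0_nth_rearrange c0_nth_truncate c0_nth_def[symmetric] c0_nth_spot)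

lemma spot_truncate: "k \<le> n \<Longrightarrow> spot k u (linf_of_c0 (truncate n w)) = spot k u w"
  by (rule c0_eqI) (auto simp: c0_nth_spot c0_nth_def[symmetric] c0_nth_truncate)

lemma spot_in_ball:
  assumes "norm u \<le> 1" "norm w < 1"
  shows "spot k u w \<in> ball 0 1"
proof -
  have "norm (spot k u w) \<le> max (marker k) (norm w)"
  proof (rule norm_c0_le)
    fix i
    have "marker k * cmod (apply_bcontfun u i) \<le> marker k * 1"
      using assms norm_bounded[of u i] marker_bounds[of k] by (intro mult_left_mono) auto
    then show "cmod (c0_nth (spot k u w) i) \<le> max (marker k) (norm w)"
      using marker_bounds[of k] norm_bounded[of w "i - k"]
      by (auto simp: c0_nth_spot norm_mult le_max_iff_disj)
  qed
  then show ?thesis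
    using assms marker_bounds[of k] by simp
qed

lemma cholomorphic_on_spot:
  assumes "u cholomorphic_on S" "w cholomorphic_on S"
  shows "(\<lambda>x. spot k (u x) (w x)) cholomorphic_on S"
  unfolding spot_def
  by (intro cholomorphic_on_add cholomorphic_on_scaleC cholomorphic_on_const
      cholomorphic_on_compose[OF cholomorphic_on_rearrange assms(1) subset_UNIV]
      cholomorphic_on_compose[OF cholomorphic_on_rearrange assms(2) subset_UNIV]) simp_all

lemma readback_in_ball: "y \<in> ball 0 1 \<Longrightarrow> readback k y \<in> ball 0 1"
  using norm_rearrange_le[of "{..<k}" "\<lambda>i. i + k" "linf_of_c0 y"]
  by (simp add: readback_def norm_c0.rep_eq)

lemma cholomorphic_on_readback: "readback k cholomorphic_on S"
  unfolding readback_def[abs_def]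
  by (intro cholomorphic_on_compose[OF cholomorphic_on_rearrange cholomorphic_on_linf_of_c0 subset_UNIV]) simp

text \<open>The functionals in \<open>\<ell>\<^sub>1\<close> see only \<open>u\<close> in the limit, because the copy of \<open>w\<close> and the marker move
  off to infinity.\<close>

lemma l1_pairing_spot_tendsto:
  assumes u: "norm u \<le> 1" and w: "norm w < 1"
  shows "(\<lambda>k. l1_pairing a (linf_of_c0 (spot k u w))) \<longlonglongrightarrow> l1_pairing a u"
proof -
  have "((\<lambda>k. \<Sum>n. l1_nth a n * c0_nth (spot k u w) n) \<longlongrightarrow> (\<Sum>n. l1_nth a n * apply_bcontfun u n)) sequentially"
  proof (rule tannerys_theorem[THEN conjunct2, THEN conjunct2])
    fix n
    have "(\<lambda>k. l1_nth a n * (of_real (marker k) * apply_bcontfun u n)) \<longlonglongrightarrow> l1_nth a n * (of_real 1 * apply_bcontfun u n)"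
      by (intro tendsto_intros marker_tendsto_1)
    moreover have "\<forall>\<^sub>F k in sequentially. of_real (marker k) * apply_bcontfun u n = c0_nth (spot k u w) n"
      using eventually_gt_at_top[of n] by eventually_elim (simp add: c0_nth_spot)
    ultimately show "(\<lambda>k. l1_nth a n * c0_nth (spot k u w) n) \<longlonglongrightarrow> l1_nth a n * apply_bcontfun u n"
      by (auto elim!: Lim_transform_eventually eventually_mono)
  next
    have "cmod (l1_nth a n * c0_nth (spot k u w) n) \<le> cmod (l1_nth a n)" for n k
    proof -
      have "cmod (c0_nth (spot k u w) n) \<le> 1"
        using spot_in_ball[OF u w, of k] norm_c0_nth_le[of "spot k u w" n] by simp
      from mult_left_mono[OF this norm_ge_zero[of "l1_nth a n"]] show ?thesis
        by (simp add: norm_mult)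
    qed
    then show "\<forall>\<^sub>F (n, k) in at_top \<times>\<^sub>F sequentially. cmod (l1_nth a n * c0_nth (spot k u w) n) \<le> cmod (l1_nth a n)"
      by (intro always_eventually) (simp add: case_prod_beta)
    show "summable (\<lambda>n. cmod (l1_nth a n))"
      using l1_nth[of a] by simp
  qed simp
  then show ?thesis
    by (simp add: l1_pairing_def c0_nth_def)
qed

lemma l1_pairing_separates:
  assumes "\<And>a. l1_pairing a u = l1_pairing a w"
  shows "u = w"
proof (rule bcontfun_eqI)
  fix i
  define e where "e = Abs_l1 (\<lambda>n. if n = i then 1 else 0)"
  have "summable (\<lambda>n. cmod (if n = i then 1 else 0))"
    by (rule summable_finite[of "{i}"]) auto
  then have e: "l1_nth e = (\<lambda>n. if n = i then 1 else 0)"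
    unfolding e_def by (intro Abs_l1_inverse) simp
  have "l1_pairing e v = apply_bcontfun v i" for v
  proof -
    have "l1_pairing e v = (\<Sum>n. if n = i then apply_bcontfun v n else 0)"
      unfolding l1_pairing_def e by (intro suminf_cong) auto
    also have "\<dots> = apply_bcontfun v i"
      using suminf_finite[of "{i}" "\<lambda>n. if n = i then apply_bcontfun v n else 0"] by simp
    finally show ?thesis .
  qed
  then show "apply_bcontfun u i = apply_bcontfun w i"
    using assms[of e] by simp
qed

lemma xi_eqI:
  assumes "\<And>x a. x \<in> ball 0 1 \<Longrightarrow> hinf_apply (\<Phi> (hinf_of_l1 a)) x = l1_pairing a (hinf_apply g x)"
  shows "xi \<Phi> = g"
  unfolding xi_def
proof (rule the_equality)
  show "\<forall>x\<in>ball 0 1. \<forall>a. l1_pairing a (hinf_apply g x) = hinf_apply (\<Phi> (hinf_of_l1 a)) x"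
    using assms by simp
  fix g' assume "\<forall>x\<in>ball 0 1. \<forall>a. l1_pairing a (hinf_apply g' x) = hinf_apply (\<Phi> (hinf_of_l1 a)) x"
  then show "g' = g"
    using assms by (intro hinf_eqI l1_pairing_separates) simp
qed

section \<open>Composition homomorphisms\<close>

lemma canonical_ext_tendsto:
  assumes "norm w < 1"
  shows "(\<lambda>n. hinf_apply f (truncate n w)) \<longlonglongrightarrow> canonical_ext f w"
  unfolding canonical_ext_def convergent_LIMSEQ_iff[symmetric]
  by (rule convergent_truncate[OF cholomorphic_on_hinf_apply norm_hinf_apply_le assms])

lemma canonical_ext_eqI:
  assumes "norm w < 1" "(\<lambda>n. hinf_apply f (truncate n w)) \<longlonglongrightarrow> l"
  shows "canonical_ext f w = l"
  using canonical_ext_tendsto[OF assms(1)] assms(2) by (rule LIMSEQ_unique)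

lemma norm_hinf_apply_less: "h \<in> ball 0 1 \<Longrightarrow> x \<in> ball 0 1 \<Longrightarrow> norm (hinf_apply h x) < 1"
  using norm_hinf_apply_le[of x h] by simp

text \<open>The composite is a pointwise limit of uniformly bounded holomorphic functions, hence holomorphic
  and bounded; only then does \<open>Abs_hinf\<close> return an element with the given values.\<close>

lemma comp_hom_apply:
  assumes h: "h \<in> ball 0 1" and x: "x \<in> ball 0 1"
  shows "hinf_apply (comp_hom h f) x = canonical_ext f (hinf_apply h x)"
proof -
  have tr: "truncate n (hinf_apply h x) \<in> ball 0 1" if "x \<in> ball 0 1" for n x
    using norm_truncate_le[of n "hinf_apply h x"] norm_hinf_apply_less[OF h that] by simp
  have lim: "((\<lambda>n. hinf_apply f (truncate n (hinf_apply h x))) \<longlongrightarrow> canonical_ext f (hinf_apply h x)) sequentially"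
    if "x \<in> ball 0 1" for x
    by (rule canonical_ext_tendsto[OF norm_hinf_apply_less[OF h that]])
  have hol: "(\<lambda>x. canonical_ext f (hinf_apply h x)) cholomorphic_on ball 0 1"
  proof (rule cholomorphic_on_pointwise_limit[where F=sequentially and M="norm f"
        and f="\<lambda>n x. hinf_apply f (truncate n (hinf_apply h x))"])
    show "\<forall>\<^sub>F n in sequentially. (\<lambda>x. hinf_apply f (truncate n (hinf_apply h x))) cholomorphic_on ball 0 1"
      using tr
      by (intro always_eventually allI cholomorphic_on_compose[OF cholomorphic_on_hinf_apply]
          cholomorphic_on_compose[OF cholomorphic_on_truncate cholomorphic_on_hinf_apply subset_UNIV]) auto
    show "\<forall>\<^sub>F n in sequentially. \<forall>x\<in>ball 0 1. cmod (hinf_apply f (truncate n (hinf_apply h x))) \<le> norm f"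
      using tr by (intro always_eventually allI ballI norm_hinf_apply_le)
  qed (use lim in auto)
  have "cmod (canonical_ext f (hinf_apply h x)) \<le> norm f" if "x \<in> ball 0 1" for x
    by (rule tendsto_le[OF sequentially_bot tendsto_const tendsto_norm[OF lim[OF that]]])
      (use tr[OF that] in \<open>intro always_eventually allI norm_hinf_apply_le\<close>)
  from hinf_apply_to_hinf[OF hol this x] show ?thesis
    by (simp add: comp_hom_def to_hinf_def)
qed

section \<open>The Gleason metric on contractive linear maps\<close>

text \<open>\<open>onorm\<close> is an operator norm in the usual sense only on bounded operators, whereas the elements
  of \<open>Minf\<close> are not bounded by definition.\<close>

definition contractive_clinear :: "endo \<Rightarrow> bool"
  where "contractive_clinear \<Phi> \<longleftrightarrow> clinear \<Phi> \<and> (\<forall>f. norm (\<Phi> f) \<le> norm f)"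

lemma bounded_linear_diff_contractive:
  assumes "contractive_clinear \<Phi>" "contractive_clinear \<Psi>"
  shows "bounded_linear (\<lambda>f. \<Phi> f - \<Psi> f)"
proof -
  have "bounded_linear \<Phi>" "bounded_linear \<Psi>"
    using assms unfolding contractive_clinear_def by (auto intro!: bounded_linear_clinear[of _ 1])
  then show ?thesis
    by (rule bounded_linear_sub)
qed

lemma norm_diff_le_gleason_dist:
  assumes "contractive_clinear \<Phi>" "contractive_clinear \<Psi>"
  shows "norm (\<Phi> f - \<Psi> f) \<le> gleason_dist \<Phi> \<Psi> * norm f"
  unfolding gleason_dist_def by (rule onorm[OF bounded_linear_diff_contractive[OF assms]])

lemma gleason_dist_nonneg:
  assumes "contractive_clinear \<Phi>" "contractive_clinear \<Psi>"
  shows "0 \<le> gleason_dist \<Phi> \<Psi>"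
  unfolding gleason_dist_def by (rule onorm_pos_le[OF bounded_linear_diff_contractive[OF assms]])

lemma gleason_dist_le:
  assumes "0 \<le> b" and "\<And>f x. x \<in> ball 0 1 \<Longrightarrow> cmod (hinf_apply (\<Phi> f) x - hinf_apply (\<Psi> f) x) \<le> b * norm f"
  shows "gleason_dist \<Phi> \<Psi> \<le> b"
  unfolding gleason_dist_def
  using assms by (intro onorm_bound norm_hinf_le) (simp_all only: minus_hinf_apply)

lemma contractive_clinear_comp_hom:
  assumes h: "h \<in> ball 0 1"
  shows "contractive_clinear (comp_hom h)"
proof -
  have lim: "(\<lambda>n. hinf_apply f (truncate n (hinf_apply h x))) \<longlonglongrightarrow> hinf_apply (comp_hom h f) x" if "x \<in> ball 0 1" for f x
    unfolding comp_hom_apply[OF h that] by (rule canonical_ext_tendsto[OF norm_hinf_apply_less[OF h that]])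
  have tr: "truncate n (hinf_apply h x) \<in> ball 0 1" if "x \<in> ball 0 1" for n x
    using norm_truncate_le[of n "hinf_apply h x"] norm_hinf_apply_less[OF h that] by simp
  show ?thesis
    unfolding contractive_clinear_def clinear_def
  proof (intro conjI allI)
    show "comp_hom h (f + f') = comp_hom h f + comp_hom h f'" for f f'
    proof (rule hinf_eqI)
      fix x :: c0 assume x: "x \<in> ball 0 1"
      show "hinf_apply (comp_hom h (f + f')) x = hinf_apply (comp_hom h f + comp_hom h f') x"
        using lim[OF x, of "f + f'"] tendsto_add[OF lim[OF x, of f] lim[OF x, of f']]
        unfolding hinf_apply_simps by (rule LIMSEQ_unique)
    qed
    show "comp_hom h (c *\<^sub>C f) = c *\<^sub>C comp_hom h f" for c f
    proof (rule hinf_eqI)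
      fix x :: c0 assume x: "x \<in> ball 0 1"
      show "hinf_apply (comp_hom h (c *\<^sub>C f)) x = hinf_apply (c *\<^sub>C comp_hom h f) x"
        using lim[OF x, of "c *\<^sub>C f"] tendsto_mult_left[OF lim[OF x, of f], of c]
        unfolding hinf_apply_simps scaleC_complex_def by (rule LIMSEQ_unique)
    qed
    show "norm (comp_hom h f) \<le> norm f" for f
    proof (rule norm_hinf_le)
      fix x :: c0 assume x: "x \<in> ball 0 1"
      show "norm (hinf_apply (comp_hom h f) x) \<le> norm f"
        by (rule tendsto_le[OF sequentially_bot tendsto_const tendsto_norm[OF lim[OF x]]])
          (use tr[OF x] in \<open>intro always_eventually allI norm_hinf_apply_le\<close>)
    qed
  qed
qed

section \<open>Homomorphisms in the fiber\<close>

definition spot_hom :: "(c0, linf) hinf \<Rightarrow> nat filter \<Rightarrow> (c0, linf) hinf \<Rightarrow> endo"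
  where "spot_hom g \<eta> h f =
    to_hinf (\<lambda>x. Lim \<eta> (\<lambda>k. hinf_apply f (spot k (hinf_apply g x) (hinf_apply h x))))"

lemma betaN_remainder_free:
  assumes "\<eta> \<in> betaN_remainder"
  shows "ultrafilter \<eta>" "\<eta> \<noteq> bot" "\<eta> \<le> sequentially"
proof -
  show U: "ultrafilter \<eta>"
    using assms by (simp add: topspace_betaN)
  then show "\<eta> \<noteq> bot"
    by (simp add: ultrafilter_def)
  have ne: "eventually (\<lambda>m. m \<noteq> n) \<eta>" for n
  proof (rule ccontr)
    assume "\<not> ?thesis"
    then have n: "eventually (\<lambda>m. m = n) \<eta>"
      using ultrafilter_not[OF U, of "\<lambda>m. m = n"] by blast
    have "\<eta> = principal {n}"
    proof (rule filter_eqI)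
      fix P
      show "eventually P \<eta> = eventually P (principal {n})"
      proof
        assume "eventually P \<eta>"
        then have "eventually (\<lambda>_. P n) \<eta>"
          using n by eventually_elim simp
        then show "eventually P (principal {n})"
          using \<open>\<eta> \<noteq> bot\<close> by (simp add: eventually_const eventually_principal)
      next
        assume "eventually P (principal {n})"
        then show "eventually P \<eta>"
          using n by (auto simp: eventually_principal elim: eventually_mono)
      qed
    qed
    then show False
      using assms by (simp add: betaN_of_nat_def)
  qed
  have ge: "eventually (\<lambda>m. n \<le> m) \<eta>" for n
  proof (induction n)
    case (Suc n)
    with ne[of n] show ?case
      by eventually_elim simp
  qed simp
  then show "\<eta> \<le> sequentially"
    unfolding le_filter_def eventually_sequentially
  proof (intro allI impI, elim exE)
    fix P and N :: nat assume "\<forall>n\<ge>N. P n"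
    with ge[of N] show "eventually P \<eta>"
      by (auto elim: eventually_mono)
  qed
qed

context
  fixes g :: "(c0, linf) hinf" and \<eta> :: "nat filter"
  assumes g: "g \<in> cball 0 1" and \<eta>: "\<eta> \<in> betaN_remainder"
begin

lemma spot_hinf_in_ball:
  assumes "h \<in> ball 0 1" "x \<in> ball 0 1"
  shows "spot k (hinf_apply g x) (hinf_apply h x) \<in> ball 0 1"
  using norm_hinf_apply_le[OF assms(2), of g] g
  by (intro spot_in_ball norm_hinf_apply_less assms) simp

lemma spot_Lim:
  assumes "h \<in> ball 0 1" "x \<in> ball 0 1"
  shows "((\<lambda>k. hinf_apply f (spot k (hinf_apply g x) (hinf_apply h x))) \<longlongrightarrow>
      Lim \<eta> (\<lambda>k. hinf_apply f (spot k (hinf_apply g x) (hinf_apply h x)))) \<eta>"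
    and "cmod (Lim \<eta> (\<lambda>k. hinf_apply f (spot k (hinf_apply g x) (hinf_apply h x)))) \<le> norm f"
proof -
  have "\<forall>\<^sub>F k in \<eta>. cmod (hinf_apply f (spot k (hinf_apply g x) (hinf_apply h x))) \<le> norm f"
    by (intro always_eventually allI norm_hinf_apply_le spot_hinf_in_ball assms)
  from ultrafilter_bounded_tendsto[OF betaN_remainder_free(1)[OF \<eta>] this]
  show "((\<lambda>k. hinf_apply f (spot k (hinf_apply g x) (hinf_apply h x))) \<longlongrightarrow>
      Lim \<eta> (\<lambda>k. hinf_apply f (spot k (hinf_apply g x) (hinf_apply h x)))) \<eta>"
    "cmod (Lim \<eta> (\<lambda>k. hinf_apply f (spot k (hinf_apply g x) (hinf_apply h x)))) \<le> norm f"
    by simp_all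
qed

lemma spot_hom_apply:
  assumes h: "h \<in> ball 0 1" and x: "x \<in> ball 0 1"
  shows "hinf_apply (spot_hom g \<eta> h f) x = Lim \<eta> (\<lambda>k. hinf_apply f (spot k (hinf_apply g x) (hinf_apply h x)))"
  unfolding spot_hom_def
proof (rule hinf_apply_to_hinf[OF _ spot_Lim(2)[OF h] x])
  show "(\<lambda>x. Lim \<eta> (\<lambda>k. hinf_apply f (spot k (hinf_apply g x) (hinf_apply h x)))) cholomorphic_on ball 0 1"
  proof (rule cholomorphic_on_pointwise_limit[OF betaN_remainder_free(2)[OF \<eta>] open_ball _ _ spot_Lim(1)[OF h]])
    show "\<forall>\<^sub>F k in \<eta>. (\<lambda>x. hinf_apply f (spot k (hinf_apply g x) (hinf_apply h x))) cholomorphic_on ball 0 1"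
      using spot_hinf_in_ball[OF h]
      by (intro always_eventually allI cholomorphic_on_compose[OF cholomorphic_on_hinf_apply]
          cholomorphic_on_spot cholomorphic_on_hinf_apply) auto
    show "\<forall>\<^sub>F k in \<eta>. \<forall>x\<in>ball 0 1. cmod (hinf_apply f (spot k (hinf_apply g x) (hinf_apply h x))) \<le> norm f"
      by (intro always_eventually allI ballI norm_hinf_apply_le spot_hinf_in_ball h)
  qed
qed

lemma spot_hom_tendsto:
  assumes h: "h \<in> ball 0 1" and x: "x \<in> ball 0 1"
  shows "((\<lambda>k. hinf_apply f (spot k (hinf_apply g x) (hinf_apply h x))) \<longlongrightarrow> hinf_apply (spot_hom g \<eta> h f) x) \<eta>"
  unfolding spot_hom_apply[OF assms] by (rule spot_Lim(1)[OF assms])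

lemma spot_hom_eqI:
  assumes h: "h \<in> ball 0 1" and x: "x \<in> ball 0 1"
    and "((\<lambda>k. hinf_apply f (spot k (hinf_apply g x) (hinf_apply h x))) \<longlongrightarrow> l) \<eta>"
  shows "hinf_apply (spot_hom g \<eta> h f) x = l"
  using spot_hom_tendsto[OF h x] assms(3) by (rule tendsto_unique[OF betaN_remainder_free(2)[OF \<eta>]])

lemma contractive_clinear_spot_hom:
  assumes h: "h \<in> ball 0 1"
  shows "contractive_clinear (spot_hom g \<eta> h)"
  unfolding contractive_clinear_def clinear_def
proof (intro conjI allI)
  show "spot_hom g \<eta> h (f + f') = spot_hom g \<eta> h f + spot_hom g \<eta> h f'" for f f'
    unfolding plus_hinf.rep_eq
    by (rule hinf_eqI, rule spot_hom_eqI[OF h])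
      (simp_all only: plus_hinf.rep_eq tendsto_add spot_hom_tendsto[OF h])
  show "spot_hom g \<eta> h (c *\<^sub>C f) = c *\<^sub>C spot_hom g \<eta> h f" for c f
    by (rule hinf_eqI, rule spot_hom_eqI[OF h])
      (simp_all only: scaleC_hinf.rep_eq scaleC_complex_def tendsto_mult_left spot_hom_tendsto[OF h])
  show "norm (spot_hom g \<eta> h f) \<le> norm f" for f
    by (rule norm_hinf_le) (simp only: spot_hom_apply[OF h] spot_Lim(2)[OF h])
qed

lemma spot_hom_in_fiber:
  assumes h: "h \<in> ball 0 1"
  shows "spot_hom g \<eta> h \<in> fiber g"
proof -
  have "spot_hom g \<eta> h (f * f') = spot_hom g \<eta> h f * spot_hom g \<eta> h f'" for f f'
    by (rule hinf_eqI, rule spot_hom_eqI[OF h])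
      (simp_all only: times_hinf.rep_eq tendsto_mult spot_hom_tendsto[OF h])
  moreover have "spot_hom g \<eta> h \<noteq> (\<lambda>_. 0)"
  proof
    assume zero: "spot_hom g \<eta> h = (\<lambda>_. 0)"
    define one :: "(c0, complex) hinf" where "one = to_hinf (\<lambda>_. 1)"
    have one: "hinf_apply one x = 1" if "x \<in> ball 0 1" for x
      unfolding one_def by (rule hinf_apply_to_hinf[OF cholomorphic_on_const _ that, of _ 1]) simp
    have "hinf_apply (spot_hom g \<eta> h one) 0 = 1"
      by (rule spot_hom_eqI[OF h]) (simp_all only: one spot_hinf_in_ball[OF h] tendsto_const centre_in_ball zero_less_one)
    then show False
      by (simp add: zero zero_hinf.rep_eq)
  qed
  moreover have "xi (spot_hom g \<eta> h) = g"
  proof (rule xi_eqI, rule spot_hom_eqI[OF h])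
    fix x :: c0 and a assume x: "x \<in> ball 0 1"
    have "norm (hinf_apply g x) \<le> 1"
      using norm_hinf_apply_le[OF x, of g] g by simp
    from l1_pairing_spot_tendsto[OF this norm_hinf_apply_less[OF h x], of a]
    have "((\<lambda>k. l1_pairing a (linf_of_c0 (spot k (hinf_apply g x) (hinf_apply h x)))) \<longlongrightarrow>
        l1_pairing a (hinf_apply g x)) \<eta>"
      by (rule tendsto_mono[OF betaN_remainder_free(3)[OF \<eta>]])
    then show "((\<lambda>k. hinf_apply (hinf_of_l1 a) (spot k (hinf_apply g x) (hinf_apply h x))) \<longlongrightarrow>
        l1_pairing a (hinf_apply g x)) \<eta>"
      by (simp only: hinf_of_l1.rep_eq spot_hinf_in_ball[OF h x] if_True)
  qed
  ultimately show ?thesis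
    using contractive_clinear_spot_hom[OF h] by (simp add: fiber_def Minf_def contractive_clinear_def)
qed

lemma spot_hom_analytic: "analytic_into_Minf (spot_hom g \<eta>)"
  unfolding analytic_into_Minf_def
proof (intro allI ballI)
  fix f :: "(c0, complex) hinf" and x :: c0 assume x: "x \<in> ball 0 1"
  show "(\<lambda>h. hinf_apply (spot_hom g \<eta> h f) x) cholomorphic_on ball 0 1"
  proof (rule cholomorphic_on_pointwise_limit[OF betaN_remainder_free(2)[OF \<eta>] open_ball _ _ spot_hom_tendsto[OF _ x]])
    show "\<forall>\<^sub>F k in \<eta>. (\<lambda>h. hinf_apply f (spot k (hinf_apply g x) (hinf_apply h x))) cholomorphic_on ball 0 1"
      using spot_hinf_in_ball[OF _ x]
      by (intro always_eventually allI cholomorphic_on_compose[OF cholomorphic_on_hinf_apply]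
          cholomorphic_on_spot cholomorphic_on_const cholomorphic_on_hinf_eval[OF x]) auto
    show "\<forall>\<^sub>F k in \<eta>. \<forall>h\<in>ball 0 1. cmod (hinf_apply f (spot k (hinf_apply g x) (hinf_apply h x))) \<le> norm f"
      by (intro always_eventually allI ballI norm_hinf_apply_le spot_hinf_in_ball x)
  qed
qed

text \<open>For fixed \<open>k\<close> and \<open>x\<close>, the value of \<open>f\<close> at a spot is a bounded holomorphic function of the second
  sequence that involves finitely many of its coordinates.  Its canonical extension is given by
  the same formula, so the distance of the composition homomorphisms bounds its increments.\<close>

lemma spot_hom_dist_le:
  assumes h: "h \<in> ball 0 1" and h': "h' \<in> ball 0 1"
  shows "gleason_dist (spot_hom g \<eta> h) (spot_hom g \<eta> h') \<le> gleason_dist (comp_hom h) (comp_hom h')"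
proof -
  note contr = contractive_clinear_comp_hom[OF h] contractive_clinear_comp_hom[OF h']
  let ?G = "gleason_dist (comp_hom h) (comp_hom h')"
  have G0: "0 \<le> ?G"
    by (rule gleason_dist_nonneg[OF contr])
  show ?thesis
  proof (rule gleason_dist_le[OF G0])
    fix f :: "(c0, complex) hinf" and x :: c0 assume x: "x \<in> ball 0 1"
    have gx: "norm (hinf_apply g x) \<le> 1"
      using norm_hinf_apply_le[OF x, of g] g by simp
    have "cmod (hinf_apply f (spot k (hinf_apply g x) (hinf_apply h x))
        - hinf_apply f (spot k (hinf_apply g x) (hinf_apply h' x))) \<le> ?G * norm f" for k
    proof -
      define F where "F = to_hinf (\<lambda>y. hinf_apply f (spot k (hinf_apply g x) (linf_of_c0 y)))"
      have ball: "spot k (hinf_apply g x) (linf_of_c0 y) \<in> ball 0 1" if "y \<in> ball 0 1" for y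
        using that by (intro spot_in_ball gx) (simp add: norm_c0.rep_eq)
      have hol: "(\<lambda>y. hinf_apply f (spot k (hinf_apply g x) (linf_of_c0 y))) cholomorphic_on ball 0 1"
        using ball
        by (intro cholomorphic_on_compose[OF cholomorphic_on_hinf_apply]
            cholomorphic_on_spot cholomorphic_on_const cholomorphic_on_linf_of_c0) auto
      have bound: "cmod (hinf_apply f (spot k (hinf_apply g x) (linf_of_c0 y))) \<le> norm f" if "y \<in> ball 0 1" for y
        by (rule norm_hinf_apply_le[OF ball[OF that]])
      have F: "norm F \<le> norm f"
        unfolding F_def by (rule norm_to_hinf_le[OF hol bound])
      have ev: "hinf_apply (comp_hom q F) x = hinf_apply f (spot k (hinf_apply g x) (hinf_apply q x))"
        if q: "q \<in> ball 0 1" for q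
        unfolding comp_hom_apply[OF q x]
      proof (rule canonical_ext_eqI[OF norm_hinf_apply_less[OF q x]])
        show "(\<lambda>n. hinf_apply F (truncate n (hinf_apply q x)))
            \<longlonglongrightarrow> hinf_apply f (spot k (hinf_apply g x) (hinf_apply q x))"
        proof (rule tendsto_eventually, use eventually_ge_at_top[of k] in eventually_elim)
          fix n assume n: "k \<le> n"
          have "truncate n (hinf_apply q x) \<in> ball 0 1"
            using norm_truncate_le[of n "hinf_apply q x"] norm_hinf_apply_less[OF q x] by simp
          then show "hinf_apply F (truncate n (hinf_apply q x)) = hinf_apply f (spot k (hinf_apply g x) (hinf_apply q x))"
            unfolding F_def by (simp only: hinf_apply_to_hinf[OF hol bound] spot_truncate[OF n])
        qed
      qed
      have "cmod (hinf_apply (comp_hom h F - comp_hom h' F) x) \<le> norm (comp_hom h F - comp_hom h' F)"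
        by (rule norm_hinf_apply_le[OF x])
      also have "\<dots> \<le> ?G * norm F"
        by (rule norm_diff_le_gleason_dist[OF contr])
      also have "\<dots> \<le> ?G * norm f"
        by (rule mult_left_mono[OF F G0])
      finally show ?thesis
        by (simp only: minus_hinf_apply ev h h')
    qed
    then show "cmod (hinf_apply (spot_hom g \<eta> h f) x - hinf_apply (spot_hom g \<eta> h' f) x) \<le> ?G * norm f"
      by (intro tendsto_le[OF betaN_remainder_free(2)[OF \<eta>] tendsto_const
            tendsto_norm[OF tendsto_diff[OF spot_hom_tendsto[OF h x] spot_hom_tendsto[OF h' x]]]])
        (simp only: eventually_True)
  qed
qed

text \<open>Every spot of index \<open>k\<close> has its last marker at \<open>2 k\<close>, independently of \<open>g\<close>, \<open>h\<close> and \<open>x\<close>.\<close>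

lemma spot_hom_interpolation:
  fixes \<phi> :: "nat \<Rightarrow> c0 \<Rightarrow> complex"
  assumes near: "\<forall>k. \<forall>y\<in>ball 0 1. c0_nth y (2 * k) = of_real (marker k) \<longrightarrow>
      (\<forall>m>k. c0_nth y (2 * m) = 0) \<longrightarrow> cmod (hinf_apply F y - \<phi> k y) \<le> B * (1 / 2) ^ k"
    and h: "h \<in> ball 0 1" and x: "x \<in> ball 0 1"
    and lim: "((\<lambda>k. \<phi> k (spot k (hinf_apply g x) (hinf_apply h x))) \<longlongrightarrow> l) \<eta>"
  shows "hinf_apply (spot_hom g \<eta> h F) x = l"
proof (rule spot_hom_eqI[OF h x])
  let ?y = "\<lambda>k. spot k (hinf_apply g x) (hinf_apply h x)"
  have le: "cmod (hinf_apply F (?y k) - \<phi> k (?y k)) \<le> B * (1 / 2) ^ k" for k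
    using near spot_hinf_in_ball[OF h x, of k] by (auto simp: c0_nth_spot)
  have "(\<lambda>k. B * (1 / 2) ^ k) \<longlonglongrightarrow> B * 0"
    by (intro tendsto_intros LIMSEQ_realpow_zero) auto
  then have "((\<lambda>k. B * (1 / 2) ^ k) \<longlongrightarrow> 0) \<eta>"
    using tendsto_mono[OF betaN_remainder_free(3)[OF \<eta>]] by simp
  then have "((\<lambda>k. hinf_apply F (?y k) - \<phi> k (?y k)) \<longlongrightarrow> 0) \<eta>"
    by (rule Lim_null_comparison[OF always_eventually, rotated]) (simp add: le)
  from tendsto_add[OF this lim] show "((\<lambda>k. hinf_apply F (?y k)) \<longlongrightarrow> l) \<eta>"
    by simp
qed

text \<open>Interpolating the functions \<open>f \<circ> readback k\<close> gives a function \<open>F\<close>, no larger than \<open>f\<close>, whose values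
  at spots are asymptotically those of \<open>f\<close> at truncations of \<open>h x\<close>.  Hence the fiber homomorphisms
  act on \<open>F\<close> as the composition homomorphisms act on \<open>f\<close>.\<close>

lemma spot_hom_dist_ge:
  assumes h: "h \<in> ball 0 1" and h': "h' \<in> ball 0 1"
  shows "gleason_dist (comp_hom h) (comp_hom h') \<le> gleason_dist (spot_hom g \<eta> h) (spot_hom g \<eta> h')"
proof -
  note contr = contractive_clinear_spot_hom[OF h] contractive_clinear_spot_hom[OF h']
  let ?G = "gleason_dist (spot_hom g \<eta> h) (spot_hom g \<eta> h')"
  have G0: "0 \<le> ?G"
    by (rule gleason_dist_nonneg[OF contr])
  show ?thesis
  proof (rule gleason_dist_le[OF G0])
    fix f :: "(c0, complex) hinf" and x :: c0 assume x: "x \<in> ball 0 1"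
    define \<phi> where "\<phi> k y = hinf_apply f (readback k y)" for k y
    have "\<phi> k cholomorphic_on ball 0 1" for k
      unfolding \<phi>_def using readback_in_ball
      by (intro cholomorphic_on_compose[OF cholomorphic_on_hinf_apply cholomorphic_on_readback]) auto
    moreover have "cmod (\<phi> k y) \<le> norm f" if "y \<in> ball 0 1" for k y
      unfolding \<phi>_def by (intro norm_hinf_apply_le readback_in_ball that)
    ultimately obtain F where F: "norm F \<le> norm f" and near: "\<forall>k. \<forall>y\<in>ball 0 1.
        c0_nth y (2 * k) = of_real (marker k) \<longrightarrow> (\<forall>m>k. c0_nth y (2 * m) = 0) \<longrightarrow>
        cmod (hinf_apply F y - \<phi> k y) \<le> 3 * norm f * (1 / 2) ^ k"
      using interpolation_at_markers[of \<phi> "norm f"] by blast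
    have ev: "hinf_apply (spot_hom g \<eta> q F) x = hinf_apply (comp_hom q f) x" if q: "q \<in> ball 0 1" for q
    proof (rule spot_hom_interpolation[OF near q x])
      show "((\<lambda>k. \<phi> k (spot k (hinf_apply g x) (hinf_apply q x))) \<longlongrightarrow> hinf_apply (comp_hom q f) x) \<eta>"
        unfolding \<phi>_def readback_spot comp_hom_apply[OF q x]
        by (rule tendsto_mono[OF betaN_remainder_free(3)[OF \<eta>]
              canonical_ext_tendsto[OF norm_hinf_apply_less[OF q x]]])
    qed
    have "cmod (hinf_apply (spot_hom g \<eta> h F - spot_hom g \<eta> h' F) x) \<le> norm (spot_hom g \<eta> h F - spot_hom g \<eta> h' F)"
      by (rule norm_hinf_apply_le[OF x])
    also have "\<dots> \<le> ?G * norm F"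
      by (rule norm_diff_le_gleason_dist[OF contr])
    also have "\<dots> \<le> ?G * norm f"
      by (rule mult_left_mono[OF F G0])
    finally show "cmod (hinf_apply (comp_hom h f) x - hinf_apply (comp_hom h' f) x) \<le> ?G * norm f"
      by (simp only: minus_hinf_apply ev h h')
  qed
qed

lemma spot_hom_isometry: "gleason_isometry (spot_hom g \<eta>)"
  unfolding gleason_isometry_def by (intro ballI antisym spot_hom_dist_le spot_hom_dist_ge)

end

text \<open>A set \<open>Q\<close> of indices belongs to one of the ultrafilters and its complement to the other.
  Interpolating 1 on \<open>Q\<close> and -1 off \<open>Q\<close> gives a function of norm at most 1 that the two homomorphisms
  send to functions with the values 1 and -1 at the origin.\<close>

lemma spot_hom_different_parts:
  assumes g: "g \<in> cball 0 1" and \<eta>: "\<eta>\<^sub>1 \<in> betaN_remainder" "\<eta>\<^sub>2 \<in> betaN_remainder" "\<eta>\<^sub>1 \<noteq> \<eta>\<^sub>2"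
    and h: "h\<^sub>1 \<in> ball 0 1" "h\<^sub>2 \<in> ball 0 1"
  shows "2 \<le> gleason_dist (spot_hom g \<eta>\<^sub>1 h\<^sub>1) (spot_hom g \<eta>\<^sub>2 h\<^sub>2)"
proof -
  obtain P where "eventually P \<eta>\<^sub>1 \<noteq> eventually P \<eta>\<^sub>2"
    using \<eta>(3) by (auto simp: filter_eq_iff)
  then obtain Q where Q: "eventually Q \<eta>\<^sub>1" "eventually (\<lambda>k. \<not> Q k) \<eta>\<^sub>2"
    using ultrafilter_not[OF betaN_remainder_free(1)[OF \<eta>(1)], of P]
      ultrafilter_not[OF betaN_remainder_free(1)[OF \<eta>(2)], of P]
      that[of P] that[of "\<lambda>k. \<not> P k"] by fastforce
  define \<phi> :: "nat \<Rightarrow> c0 \<Rightarrow> complex" where "\<phi> k y = (if Q k then 1 else -1)" for k y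
  have "\<phi> k cholomorphic_on ball 0 1" for k
    unfolding \<phi>_def by (rule cholomorphic_on_const)
  moreover have "cmod (\<phi> k y) \<le> 1" for k y
    by (simp add: \<phi>_def)
  ultimately obtain F where F: "norm F \<le> 1" and near: "\<forall>k. \<forall>y\<in>ball 0 1.
      c0_nth y (2 * k) = of_real (marker k) \<longrightarrow> (\<forall>m>k. c0_nth y (2 * m) = 0) \<longrightarrow>
      cmod (hinf_apply F y - \<phi> k y) \<le> 3 * 1 * (1 / 2) ^ k"
    using interpolation_at_markers[of \<phi> 1] by blast
  have x: "(0::c0) \<in> ball 0 1"
    by simp
  have "hinf_apply (spot_hom g \<eta>\<^sub>1 h\<^sub>1 F) 0 = 1"
    by (rule spot_hom_interpolation[OF g \<eta>(1) near h(1) x], rule tendsto_eventually)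
      (use Q(1) in eventually_elim, simp add: \<phi>_def)
  moreover have "hinf_apply (spot_hom g \<eta>\<^sub>2 h\<^sub>2 F) 0 = -1"
    by (rule spot_hom_interpolation[OF g \<eta>(2) near h(2) x], rule tendsto_eventually)
      (use Q(2) in eventually_elim, simp add: \<phi>_def)
  ultimately have "2 = cmod (hinf_apply (spot_hom g \<eta>\<^sub>1 h\<^sub>1 F - spot_hom g \<eta>\<^sub>2 h\<^sub>2 F) 0)"
    by (simp add: minus_hinf_apply)
  also have "\<dots> \<le> norm (spot_hom g \<eta>\<^sub>1 h\<^sub>1 F - spot_hom g \<eta>\<^sub>2 h\<^sub>2 F)"
    by (rule norm_hinf_apply_le[OF x])
  also have "\<dots> \<le> gleason_dist (spot_hom g \<eta>\<^sub>1 h\<^sub>1) (spot_hom g \<eta>\<^sub>2 h\<^sub>2) * norm F"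
    by (intro norm_diff_le_gleason_dist contractive_clinear_spot_hom g \<eta> h)
  also have "\<dots> \<le> gleason_dist (spot_hom g \<eta>\<^sub>1 h\<^sub>1) (spot_hom g \<eta>\<^sub>2 h\<^sub>2) * 1"
    by (intro mult_left_mono F gleason_dist_nonneg contractive_clinear_spot_hom g \<eta> h)
  finally show ?thesis
    by simp
qed

theorem theorem2p4:
  fixes g :: "(c0, linf) hinf"
  assumes "g \<in> cball 0 1"
  shows "\<exists>\<Psi> :: nat filter \<times> (c0, linf) hinf \<Rightarrow> endo.
    \<Psi> \<in> betaN_remainder \<times> ball 0 1 \<rightarrow> fiber g \<and>
    (\<forall>\<eta>\<in>betaN_remainder. analytic_into_Minf (\<lambda>h. \<Psi> (\<eta>, h)) \<and> gleason_isometry (\<lambda>h. \<Psi> (\<eta>, h))) \<and>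
    (\<forall>\<eta>\<^sub>1\<in>betaN_remainder. \<forall>\<eta>\<^sub>2\<in>betaN_remainder. \<eta>\<^sub>1 \<noteq> \<eta>\<^sub>2 \<longrightarrow>
      in_different_gleason_parts ((\<lambda>h. \<Psi> (\<eta>\<^sub>1, h)) ` ball 0 1) ((\<lambda>h. \<Psi> (\<eta>\<^sub>2, h)) ` ball 0 1))"
proof (intro exI[of _ "\<lambda>(\<eta>, h). spot_hom g \<eta> h"] conjI ballI impI)
  show "(\<lambda>(\<eta>, h). spot_hom g \<eta> h) \<in> betaN_remainder \<times> ball 0 1 \<rightarrow> fiber g"
    using spot_hom_in_fiber[OF assms] by (auto simp del: mem_ball mem_ball_0 Diff_iff)
next
  fix \<eta> assume \<eta>: "\<eta> \<in> betaN_remainder"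
  show "analytic_into_Minf (\<lambda>h. case (\<eta>, h) of (\<eta>, h) \<Rightarrow> spot_hom g \<eta> h)"
    using spot_hom_analytic[OF assms \<eta>] by simp
  show "gleason_isometry (\<lambda>h. case (\<eta>, h) of (\<eta>, h) \<Rightarrow> spot_hom g \<eta> h)"
    using spot_hom_isometry[OF assms \<eta>] by simp
next
  fix \<eta>\<^sub>1 \<eta>\<^sub>2 assume \<eta>: "\<eta>\<^sub>1 \<in> betaN_remainder" "\<eta>\<^sub>2 \<in> betaN_remainder" "\<eta>\<^sub>1 \<noteq> \<eta>\<^sub>2"
  show "in_different_gleason_parts ((\<lambda>h. case (\<eta>\<^sub>1, h) of (\<eta>, h) \<Rightarrow> spot_hom g \<eta> h) ` ball 0 1)
      ((\<lambda>h. case (\<eta>\<^sub>2, h) of (\<eta>, h) \<Rightarrow> spot_hom g \<eta> h) ` ball 0 1)"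
    unfolding in_different_gleason_parts_def prod.case
  proof (intro ballI, elim imageE, intro conjI)
    fix \<Phi>\<^sub>1 \<Phi>\<^sub>2 h\<^sub>1 h\<^sub>2
    assume h: "h\<^sub>1 \<in> ball 0 1" "h\<^sub>2 \<in> ball 0 1"
      and \<Phi>: "\<Phi>\<^sub>1 = spot_hom g \<eta>\<^sub>1 h\<^sub>1" "\<Phi>\<^sub>2 = spot_hom g \<eta>\<^sub>2 h\<^sub>2"
    show "\<Phi>\<^sub>1 \<notin> gleason_part \<Phi>\<^sub>2"
      using spot_hom_different_parts[OF assms \<eta>(2,1) \<eta>(3)[symmetric] h(2,1)] by (simp add: gleason_part_def \<Phi>)
    show "\<Phi>\<^sub>2 \<notin> gleason_part \<Phi>\<^sub>1"
      using spot_hom_different_parts[OF assms \<eta> h] by (simp add: gleason_part_def \<Phi>)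
  qed
qed

end
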